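(* Let $p(\rho)=\rho^\gamma$ with $\gamma>1$. Let $\rho_-\neq\rho_+$, $\rho_\pm>0$ and $v_{+2}\in\mathbb{R}$ be given. Then there exists a real number $V=V(\rho_-,\rho_+,v_{+2},\gamma)$ with $$V<\sqrt{\frac{(\rho_+-\rho_-)(p(\rho_+)-p(\rho_-))}{\rho_+\rho_-}}$$ such that for all $v_{-2}\in\mathbb{R}$ satisfying $$V<v_{-2}-v_{+2}<\sqrt{\frac{(\rho_+-\rho_-)(p(\rho_+)-p(\rho_-))}{\rho_+\rho_-}}$$ and all $v_{-1}=v_{+1}\in\mathbb{R}$, there exist infinitely many bounded admissible weak solutions $(\rho,v)$ on $\mathbb{R}^2\times[0,\infty)$ of the isentropic compressible Euler equations $$\partial_t\rho+\mathrm{div}_x(\rho v)=0,\qquad \partial_t(\rho v)+\mathrm{div}_x(\rho v\otimes v)+\nabla_x[p(\rho)]=0,\qquad \rho(\cdot,0)=\rho^0,\quad v(\cdot,0)=v^0,$$ with Riemann initial data $$(\rho^0(x),v^0(x))=\begin{cases}(\rho_-,v_-)&\text{if }x_2<0,\\(\rho_+,v_+)&\text{if }x_2>0,\end{cases}\qquad v_-=(v_{-1},v_{-2}),\quad v_+=(v_{+1},v_{+2}).$$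
   Context: The space variable is $x=(x_1,x_2)\in\mathbb{R}^2$ and $t\ge 0$ is time; the unknowns are the density $\rho>0$ (scalar) and the velocity $v$ (with values in $\mathbb{R}^2$). The internal energy $\varepsilon$ is related to the pressure by $p(r)=r^2\varepsilon'(r)$; for $p(r)=r^\gamma$, $\gamma>1$, one may take $\varepsilon(r)=\frac{r^{\gamma-1}}{\gamma-1}$. A bounded weak solution is a pair $(\rho,v)\in L^\infty(\mathbb{R}^2\times[0,\infty))$ satisfying the system in the usual distributional sense with initial data, i.e. for all test functions $\psi\in C_c^\infty(\mathbb{R}^2\times[0,\infty))$ and $\phi\in C_c^\infty(\mathbb{R}^2\times[0,\infty);\mathbb{R}^2)$, $$\int_0^\infty\!\!\int_{\mathbb{R}^2}\big[\rho\,\partial_t\psi+\rho v\cdot\nabla_x\psi\big]\,dx\,dt+\int_{\mathbb{R}^2}\rho^0(x)\psi(x,0)\,dx=0,$$ $$\int_0^\infty\!\!\int_{\mathbb{R}^2}\big[\rho v\cdot\partial_t\phi+\rho v\otimes v:\nabla_x\phi+p(\rho)\,\mathrm{div}_x\phi\big]\,dx\,dt+\int_{\mathbb{R}^2}\rho^0(x)v^0(x)\cdot\phi(x,0)\,dx=0.$$ A bounded weak solution is admissible (an entropy solution) if it satisfies the energy inequality $$\partial_t\Big(\rho\varepsilon(\rho)+\rho\frac{|v|^2}{2}\Big)+\mathrm{div}_x\Big[\Big(\rho\varepsilon(\rho)+\rho\frac{|v|^2}{2}+p(\rho)\Big)v\Big]\le 0$$ in the sense of distributions including the initial data, i.e.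 for every nonnegative $\varphi\in C_c^\infty(\mathbb{R}^2\times[0,\infty))$, $$\int_0^\infty\!\!\int_{\mathbb{R}^2}\Big[\Big(\rho\varepsilon(\rho)+\rho\frac{|v|^2}{2}\Big)\partial_t\varphi+\Big(\rho\varepsilon(\rho)+\rho\frac{|v|^2}{2}+p(\rho)\Big)v\cdot\nabla_x\varphi\Big]dx\,dt+\int_{\mathbb{R}^2}\Big(\rho^0\varepsilon(\rho^0)+\rho^0\frac{|v^0|^2}{2}\Big)\varphi(x,0)\,dx\ge 0.$$ Solutions are identified if they agree almost everywhere. *)

theory Defs
  imports "HOL-Analysis.Analysis"
begin

text \<open>A function of class \<open>C\<^sup>k\<close>: all directional derivatives are again of class \<open>C\<^sup>k\<^sup>-\<^sup>1\<close>.
  In finite dimension this agrees with the definition by iterated partial derivatives.\<close>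

fun class_C :: "nat \<Rightarrow> ('a::euclidean_space \<Rightarrow> 'b::real_normed_vector) \<Rightarrow> bool" where
  "class_C 0 f \<longleftrightarrow> continuous_on UNIV f"
| "class_C (Suc k) f \<longleftrightarrow>
     (\<forall>z. f differentiable (at z)) \<and> (\<forall>h. class_C k (\<lambda>z. frechet_derivative f (at z) h))"

definition smooth :: "('a::euclidean_space \<Rightarrow> 'b::real_normed_vector) \<Rightarrow> bool" where
  "smooth f \<longleftrightarrow> (\<forall>k. class_C k f)"

text \<open>Points of space-time are pairs \<open>(x, t)\<close>. The elements of
  \<open>C\<^sub>c\<^sup>\<infinity>(\<real>\<^sup>2 \<times> [0,\<infinity>))\<close> are represented by smooth compactly supported functions on the whole of
  \<open>\<real>\<^sup>2 \<times> \<real>\<close>, of which only the restriction to \<open>t \<ge> 0\<close> is ever used; in particular they need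
  not vanish at \<open>t = 0\<close>.\<close>

definition test_function :: "((real^2) \<times> real \<Rightarrow> 'b::real_normed_vector) \<Rightarrow> bool" where
  "test_function f \<longleftrightarrow> smooth f \<and> compact (closure {z. f z \<noteq> 0})"

definition time_deriv :: "((real^2) \<times> real \<Rightarrow> 'b::real_normed_vector) \<Rightarrow> (real^2) \<times> real \<Rightarrow> 'b" where
  "time_deriv f = (\<lambda>(x, t). vector_derivative (\<lambda>s. f (x, s)) (at t))"

definition space_grad :: "((real^2) \<times> real \<Rightarrow> real) \<Rightarrow> (real^2) \<times> real \<Rightarrow> real^2" where
  "space_grad f = (\<lambda>(x, t). \<chi> i. frechet_derivative (\<lambda>y. f (y, t)) (at x) (axis i 1))"

definition space_jacobian :: "((real^2) \<times> real \<Rightarrow> real^2) \<Rightarrow> (real^2) \<times> real \<Rightarrow> real^2^2" where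
  "space_jacobian f = (\<lambda>(x, t). jacobian (\<lambda>y. f (y, t)) (at x))"

definition space_div :: "((real^2) \<times> real \<Rightarrow> real^2) \<Rightarrow> (real^2) \<times> real \<Rightarrow> real" where
  "space_div f z = trace (space_jacobian f z)"

definition tensor :: "real^2 \<Rightarrow> real^2 \<Rightarrow> real^2^2" where
  "tensor v w = (\<chi> i j. v $ i * w $ j)"

definition half_space :: "((real^2) \<times> real) measure" where
  "half_space = lebesgue_on (UNIV \<times> {0..})"

definition bounded_state ::
  "((real^2) \<times> real \<Rightarrow> real) \<Rightarrow> ((real^2) \<times> real \<Rightarrow> real^2) \<Rightarrow> bool" where
  "bounded_state \<rho> v \<longleftrightarrow>
     \<rho> \<in> borel_measurable half_space \<and> v \<in> borel_measurable half_space \<and>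
     (\<exists>C. AE z in half_space. \<bar>\<rho> z\<bar> \<le> C \<and> norm (v z) \<le> C) \<and>
     (AE z in half_space. \<rho> z > 0)"

text \<open>The inner product on \<^typ>\<open>real^2^2\<close> is the Frobenius product \<open>A : B\<close>.\<close>

definition weak_solution ::
  "(real \<Rightarrow> real) \<Rightarrow> (real^2 \<Rightarrow> real) \<Rightarrow> (real^2 \<Rightarrow> real^2) \<Rightarrow>
   ((real^2) \<times> real \<Rightarrow> real) \<Rightarrow> ((real^2) \<times> real \<Rightarrow> real^2) \<Rightarrow> bool" where
  "weak_solution p \<rho>0 v0 \<rho> v \<longleftrightarrow>
     bounded_state \<rho> v \<and>
     (\<forall>\<psi> :: (real^2) \<times> real \<Rightarrow> real. test_function \<psi> \<longrightarrow>
        (\<integral>z. \<rho> z * time_deriv \<psi> z + \<rho> z * (v z \<bullet> space_grad \<psi> z) \<partial>half_space)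
        + (\<integral>x. \<rho>0 x * \<psi> (x, 0) \<partial>lebesgue) = 0) \<and>
     (\<forall>\<phi> :: (real^2) \<times> real \<Rightarrow> real^2. test_function \<phi> \<longrightarrow>
        (\<integral>z. \<rho> z * (v z \<bullet> time_deriv \<phi> z)
            + \<rho> z * (tensor (v z) (v z) \<bullet> space_jacobian \<phi> z)
            + p (\<rho> z) * space_div \<phi> z \<partial>half_space)
        + (\<integral>x. \<rho>0 x * (v0 x \<bullet> \<phi> (x, 0)) \<partial>lebesgue) = 0)"

definition energy :: "(real \<Rightarrow> real) \<Rightarrow> real \<Rightarrow> real^2 \<Rightarrow> real" where
  "energy \<epsilon> r u = r * \<epsilon> r + r * (norm u)\<^sup>2 / 2"

definition admissible_weak_solution ::
  "(real \<Rightarrow> real) \<Rightarrow> (real \<Rightarrow> real) \<Rightarrow> (real^2 \<Rightarrow> real) \<Rightarrow> (real^2 \<Rightarrow> real^2) \<Rightarrow>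
   ((real^2) \<times> real \<Rightarrow> real) \<Rightarrow> ((real^2) \<times> real \<Rightarrow> real^2) \<Rightarrow> bool" where
  "admissible_weak_solution p \<epsilon> \<rho>0 v0 \<rho> v \<longleftrightarrow>
     weak_solution p \<rho>0 v0 \<rho> v \<and>
     (\<forall>\<phi> :: (real^2) \<times> real \<Rightarrow> real. test_function \<phi> \<and> (\<forall>x. \<forall>t\<ge>0. \<phi> (x, t) \<ge> 0) \<longrightarrow>
        (\<integral>z. energy \<epsilon> (\<rho> z) (v z) * time_deriv \<phi> z
            + (energy \<epsilon> (\<rho> z) (v z) + p (\<rho> z)) * (v z \<bullet> space_grad \<phi> z) \<partial>half_space)
        + (\<integral>x. energy \<epsilon> (\<rho>0 x) (v0 x) * \<phi> (x, 0) \<partial>lebesgue) \<ge> 0)"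

definition ae_equal ::
  "((((real^2) \<times> real \<Rightarrow> real) \<times> ((real^2) \<times> real \<Rightarrow> real^2)) \<times>
    (((real^2) \<times> real \<Rightarrow> real) \<times> ((real^2) \<times> real \<Rightarrow> real^2))) set" where
  "ae_equal = {((\<rho>, v), (\<rho>', v')). AE z in half_space. \<rho> z = \<rho>' z \<and> v z = v' z}"

definition pressure :: "real \<Rightarrow> real \<Rightarrow> real" where
  "pressure \<gamma> r = r powr \<gamma>"

definition internal_energy :: "real \<Rightarrow> real \<Rightarrow> real" where
  "internal_energy \<gamma> r = r powr (\<gamma> - 1) / (\<gamma> - 1)"

lemma pressure_internal_energy:
  assumes "\<gamma> > 1" "r > 0"
  shows "(internal_energy \<gamma> has_real_derivative pressure \<gamma> r / r\<^sup>2) (at r)"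
proof -
  have eq: "r powr (\<gamma> - 2) = r powr \<gamma> / r\<^sup>2"
    using assms by (simp add: powr_diff)
  have "((\<lambda>r. r powr (\<gamma> - 1) / (\<gamma> - 1)) has_real_derivative
      ((\<gamma> - 1) * r powr (\<gamma> - 1 - 1)) / (\<gamma> - 1)) (at r)"
    by (rule DERIV_cdivide) (rule has_real_derivative_powr[OF assms(2)])
  then show ?thesis
    using assms(1) eq unfolding internal_energy_def[abs_def] pressure_def by simp
qed

text \<open>The value on the null set \<open>x\<^sub>2 = 0\<close> is immaterial.\<close>

definition riemann_data :: "'b \<Rightarrow> 'b \<Rightarrow> real^2 \<Rightarrow> 'b" where
  "riemann_data a b x = (if x $ 2 < 0 then a else b)"

end

theory Submission
  imports Defs "HOL-Computational_Algebra.Polynomial"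
begin

text \<open>The infinitely many solutions share one piecewise constant density and differ only in the wedge
  \<open>{\<mu> t < x\<^sub>2 < \<nu> t}\<close>, where both the density \<open>r\<close> and the speed, \<open>|v|\<^sup>2 = C\<close>, are constant. Convex
  integration (De Lellis--Szekelyhidi) yields infinitely many such velocities, all with the same averaged
  state: a mean velocity \<open>(\<alpha>, \<beta>)\<close> and a mean of \<open>v \<otimes> v\<close> exceeding \<open>(\<alpha>, \<beta>) \<otimes> (\<alpha>, \<beta>)\<close> by \<open>\<epsilon>1 > 0\<close> in the
  \<open>(2,2)\<close> entry and by \<open>\<epsilon>2 > 0\<close> in the \<open>(1,1)\<close> entry. Energy and momentum flux
  then see only that mean state, so admissibility reduces to the Rankine--Hugoniot conditions and an energy
  inequality on each of the two lines bounding the wedge.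

  These algebraic conditions are solved by perturbing the pure shock, which corresponds to the critical
  value of the velocity jump. One line carries a slightly weakened shock; its strict dissipation leaves room
  for an \<open>\<epsilon>2\<close> bounded away from 0. On the other line \<open>r\<close> is only slightly different from the outer density.
  The perturbation is measured by the jump \<open>h\<close> of the specific volume, the velocity jump is a continuous
  function of \<open>h\<close>, and the intermediate value theorem covers a whole interval below the critical value.\<close>

section \<open>Difference quotients and integration by parts\<close>

text \<open>In the wedge the nonlinearity is removed by treating the traceless part \<open>u\<close>
  of \<open>v \<otimes> v\<close> as a separate unknown. The equations become linear in
  \<open>(v, u)\<close>, and the lost relation remains as a pointwise constraint, relaxed to the
  strict inequality \<open>subsol\<close>. The obstacle is to add oscillations that solve the linear
  system, are supported in a box and stay inside the open set of strict subsolutions, yet gain a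
  definite amount of energy. Since the constraint is quadratic, weak limits are useless, and strong
  convergence has to be forced. Here the gain is bounded below by a multiple of the integral of the
  squared gap \<open>C - |V|^2\<close>, so an explicit iteration can replace a Baire category
  argument: increments almost orthogonal to all earlier stages make the energies converge, and then
  the gap must vanish. The same control of pairings separates solutions: limits obtained from two
  subsolutions that correlate differently with a fixed field are different. Perturbations are
  extended by zero and satisfy the linear equations on all of space-time, so that those on disjoint
  boxes may simply be added, without any traces on faces.\<close>

definition dir_deriv :: "('a::euclidean_space \<Rightarrow> real) \<Rightarrow> 'a \<Rightarrow> ('a \<Rightarrow> real) \<Rightarrow> bool" where
  "dir_deriv H e D \<longleftrightarrow> (\<forall>z. ((\<lambda>s. H (z + s *\<^sub>R e)) has_real_derivative D z) (at 0))"

lemma dir_deriv_line: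
  assumes "dir_deriv H e D"
  shows "((\<lambda>s. H (z + s *\<^sub>R e)) has_real_derivative D (z + r *\<^sub>R e)) (at r)"
proof -
  have "((\<lambda>s. H ((z + r *\<^sub>R e) + s *\<^sub>R e)) has_real_derivative D (z + r *\<^sub>R e)) (at 0)"
    using assms by (simp add: dir_deriv_def)
  moreover have "(\<lambda>s. H ((z + r *\<^sub>R e) + s *\<^sub>R e)) = (\<lambda>s. H (z + (s + r) *\<^sub>R e))"
    by (simp add: algebra_simps)
  ultimately show ?thesis
    using DERIV_shift[of "\<lambda>s. H (z + s *\<^sub>R e)" "D (z + r *\<^sub>R e)" 0 r] by simp
qed

lemma integral_translate:
  fixes f :: "'a::euclidean_space \<Rightarrow> 'b::{banach, second_countable_topology}"
  assumes "f \<in> borel_measurable borel"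
  shows "(\<integral>z. f (z + c) \<partial>lborel) = (\<integral>z. f z \<partial>lborel)"
proof -
  have "(\<integral>z. f z \<partial>lborel) = (\<integral>z. f z \<partial>(distr lborel borel ((+) c)))"
    by (simp add: lborel_distr_plus)
  also have "\<dots> = (\<integral>z. f (c + z) \<partial>lborel)"
    by (rule integral_distr) (use assms in auto)
  finally show ?thesis by (simp add: add.commute)
qed

lemma continuous_vanishing_integrable:
  fixes f :: "'a::euclidean_space \<Rightarrow> 'b::{banach, second_countable_topology}"
  assumes "continuous_on UNIV f" "bounded S" "\<And>z. z \<notin> S \<Longrightarrow> f z = 0"
  shows "integrable lborel f"
proof -
  have c: "compact (closure S)"
    using assms(2) by (simp add: compact_closure)
  have "integrable lborel (\<lambda>x. indicator (closure S) x *\<^sub>R f x)"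
    by (rule borel_integrable_compact[OF c]) (use assms(1) continuous_on_subset in blast)
  also have "(\<lambda>x. indicator (closure S) x *\<^sub>R f x) = f"
    using assms(3) closure_subset[of S] by (auto simp: fun_eq_iff indicator_def)
  finally show ?thesis .
qed

lemma continuous_vanishing_bounded:
  fixes f :: "'a::euclidean_space \<Rightarrow> 'b::real_normed_vector"
  assumes "continuous_on UNIV f" "bounded S" "\<And>z. z \<notin> S \<Longrightarrow> f z = 0"
  obtains B where "B > 0" "\<And>z. norm (f z) \<le> B"
proof -
  have "compact (f ` closure S)"
    using assms by (intro compact_continuous_image) (auto simp: compact_closure intro: continuous_on_subset)
  then obtain B where B: "B > 0" "\<forall>y\<in>f ` closure S. norm y \<le> B"
    using bounded_pos compact_imp_bounded by blast
  have "norm (f z) \<le> B" for z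
    using B assms(3)[of z] closure_subset[of S] by (cases "z \<in> S") auto
  with B(1) show ?thesis using that by blast
qed

lemma integrable_indicator_bounded:
  fixes S :: "'a::euclidean_space set"
  assumes "bounded S" "S \<in> sets borel"
  shows "integrable lborel (\<lambda>z. indicator S z * (c::real))"
proof -
  have "emeasure lborel S < \<infinity>" using assms(1) by (rule emeasure_bounded_finite)
  then show ?thesis using assms by (intro integrable_mult_left) (auto intro!: integrable_real_indicator)
qed

text \<open>By the mean value theorem the quotients are bounded by a bound of \<open>D\<close>, and
  they vanish off a fixed ball, so dominated convergence applies. The region \<open>R\<close> is
  kept general: \<open>UNIV\<close> yields integration by parts, and sectors of space-time yield the
  interface terms of \<open>fan_identity\<close>.\<close>

lemma difference_quotient_limit:
  fixes H D :: "'a::euclidean_space \<Rightarrow> real"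
  assumes dd: "dir_deriv H e D" and cD: "continuous_on UNIV D" and cH: "continuous_on UNIV H"
    and S: "bounded S" "\<And>z. z \<notin> S \<Longrightarrow> H z = 0" "\<And>z. z \<notin> S \<Longrightarrow> D z = 0"
    and R[measurable]: "R \<in> sets borel"
  shows "(\<lambda>n. real (Suc n) * ((\<integral>z. indicator R z * H (z + e /\<^sub>R real (Suc n)) \<partial>lborel)
            - (\<integral>z. indicator R z * H z \<partial>lborel)))
          \<longlonglongrightarrow> (\<integral>z. indicator R z * D z \<partial>lborel)"
proof -
  let ?q = "\<lambda>n z. real (Suc n) * (H (z + e /\<^sub>R real (Suc n)) - H z)"
  obtain B where B: "B > 0" "\<And>z. norm (D z) \<le> B"
    using continuous_vanishing_bounded[OF cD S(1,3)] by blast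
  obtain M where M: "\<And>z. z \<in> S \<Longrightarrow> norm z \<le> M"
    using S(1) unfolding bounded_iff by blast
  have mH[measurable]: "H \<in> borel_measurable borel" and mD[measurable]: "D \<in> borel_measurable borel"
    using cH cD borel_measurable_continuous_onI by blast+
  have lim: "(\<lambda>n. ?q n z) \<longlonglongrightarrow> D z" for z
  proof -
    have "((\<lambda>s. H (z + s *\<^sub>R e)) has_real_derivative D z) (at 0)"
      using dd by (simp add: dir_deriv_def)
    then have "((\<lambda>h. (H (z + h *\<^sub>R e) - H z) / h) \<longlongrightarrow> D z) (at 0)"
      by (simp add: DERIV_def)
    moreover have "filterlim (\<lambda>n. inverse (real (Suc n))) (at 0) sequentially"
      by (intro filterlim_atI LIMSEQ_inverse_real_of_nat) auto
    ultimately have "(\<lambda>n. (H (z + inverse (real (Suc n)) *\<^sub>R e) - H z) / inverse (real (Suc n))) \<longlonglongrightarrow> D z"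
      by (rule filterlim_compose)
    then show ?thesis by (simp add: divide_simps mult.commute del: of_nat_Suc)
  qed
  have bnd: "\<bar>?q n z\<bar> \<le> B" for n z
  proof -
    have p: "(0::real) < inverse (real (Suc n))" by simp
    obtain x where x: "H (z + inverse (real (Suc n)) *\<^sub>R e) - H (z + 0 *\<^sub>R e) = (inverse (real (Suc n)) - 0) * D (z + x *\<^sub>R e)"
      using MVT2[OF p, of "\<lambda>s. H (z + s *\<^sub>R e)" "\<lambda>s. D (z + s *\<^sub>R e)"] dir_deriv_line[OF dd] by blast
    then have "?q n z = D (z + x *\<^sub>R e)" by (simp add: field_simps del: of_nat_Suc)
    then show ?thesis using B(2) by simp
  qed
  have zero: "?q n z = 0" if "norm z > M + norm e" for n z
  proof -
    have "norm (e /\<^sub>R real (Suc n)) \<le> norm e"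
    proof -
      have "inverse (real (Suc n)) * norm e \<le> 1 * norm e"
        by (intro mult_right_mono) (auto simp: field_simps)
      then show ?thesis by simp
    qed
    then have "norm (z + e /\<^sub>R real (Suc n)) > M"
      using that norm_triangle_ineq4[of "z + e /\<^sub>R real (Suc n)" "e /\<^sub>R real (Suc n)"] by simp
    then have "z + e /\<^sub>R real (Suc n) \<notin> S" using M by force
    moreover have "z \<notin> S" using M[of z] that norm_ge_zero[of e] by (smt (verit))
    ultimately show ?thesis using S(2) by simp
  qed
  have "(\<lambda>n. \<integral>z. indicator R z * ?q n z \<partial>lborel) \<longlonglongrightarrow> (\<integral>z. indicator R z * D z \<partial>lborel)"
  proof (rule integral_dominated_convergence[where w="\<lambda>z. indicator (cball 0 (M + norm e)) z * B"])
    show "integrable lborel (\<lambda>z. indicator (cball 0 (M + norm e)) z * B)"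
      by (rule integrable_indicator_bounded) auto
    show "AE z in lborel. (\<lambda>n. indicator R z * ?q n z) \<longlonglongrightarrow> indicator R z * D z"
      using lim by (intro AE_I2 tendsto_mult_left)
    show "AE z in lborel. norm (indicator R z * ?q n z) \<le> indicator (cball 0 (M + norm e)) z * B" for n
    proof (rule AE_I2)
      fix z :: 'a
      show "norm (indicator R z * ?q n z) \<le> indicator (cball 0 (M + norm e)) z * B"
        using bnd[of n z] zero[of z n] B(1) by (auto simp: indicator_def abs_mult simp del: of_nat_Suc)
    qed
  qed (measurable)
  moreover have "(\<integral>z. indicator R z * ?q n z \<partial>lborel) = real (Suc n) * ((\<integral>z. indicator R z * H (z + e /\<^sub>R real (Suc n)) \<partial>lborel)
            - (\<integral>z. indicator R z * H z \<partial>lborel))" for n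
  proof -
    have i1: "integrable lborel H" by (rule continuous_vanishing_integrable[OF cH S(1,2)])
    have i2: "integrable lborel (\<lambda>z. H (z + e /\<^sub>R real (Suc n)))"
    proof (rule continuous_vanishing_integrable[where S="(\<lambda>z. z - e /\<^sub>R real (Suc n)) ` S"])
      show "bounded ((\<lambda>z. z - e /\<^sub>R real (Suc n)) ` S)" by (rule bounded_translation_minus[OF S(1)])
      show "continuous_on UNIV (\<lambda>z. H (z + e /\<^sub>R real (Suc n)))"
        by (rule continuous_on_compose2[OF cH]) (auto intro!: continuous_intros)
      show "H (z + e /\<^sub>R real (Suc n)) = 0" if "z \<notin> (\<lambda>z. z - e /\<^sub>R real (Suc n)) ` S" for z
        using that S(2) by (metis add_diff_cancel image_eqI)
    qed
    have j: "integrable lborel (\<lambda>z. indicator R z * H z)" "integrable lborel (\<lambda>z. indicator R z * H (z + e /\<^sub>R real (Suc n)))"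
      using i1 i2 by (auto intro: integrable_mult_indicator[where f="\<lambda>z. _ z :: real", simplified] simp: R)
    show ?thesis
      by (subst Bochner_Integration.integral_diff[OF j(2,1), symmetric],
          subst Bochner_Integration.integral_mult_right_zero[symmetric]) (simp add: algebra_simps)
  qed
  ultimately show ?thesis by simp
qed

text \<open>Over the whole space translation invariance makes every difference quotient integrate to
  0.\<close>

lemma integral_dir_deriv_zero:
  fixes H D :: "'a::euclidean_space \<Rightarrow> real"
  assumes dd: "dir_deriv H e D" and cD: "continuous_on UNIV D" and cH: "continuous_on UNIV H"
    and S: "bounded S" "\<And>z. z \<notin> S \<Longrightarrow> H z = 0" "\<And>z. z \<notin> S \<Longrightarrow> D z = 0"
  shows "(\<integral>z. D z \<partial>lborel) = 0"
proof -
  have "H \<in> borel_measurable borel"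
    using cH borel_measurable_continuous_onI by blast
  then have "(\<integral>z. H (z + c) \<partial>lborel) = (\<integral>z. H z \<partial>lborel)" for c
    by (rule integral_translate)
  then have "(\<lambda>n. 0) \<longlonglongrightarrow> (\<integral>z. D z \<partial>lborel)"
    using difference_quotient_limit[OF assms, of UNIV] by simp
  then show ?thesis using LIMSEQ_const_iff by metis
qed

type_synonym spacetime = "(real^2) \<times> real"

section \<open>Divergence-free space-time fields\<close>

definition C1_grad :: "('a::euclidean_space \<Rightarrow> real) \<Rightarrow> ('a \<Rightarrow> 'a) \<Rightarrow> bool" where
  "C1_grad \<psi> G \<longleftrightarrow> (\<forall>z. (\<psi> has_derivative (\<lambda>h. G z \<bullet> h)) (at z)) \<and> continuous_on UNIV G"

definition space_part :: "spacetime \<Rightarrow> complex" where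
  "space_part z = Complex (fst z $ 1) (fst z $ 2)"

text \<open>\<open>\<real>\<^sup>2\<close>-valued fields are written as complex-valued ones, and \<open>divfree q w\<close> says that
  \<open>\<partial>\<^sub>t q + div w = 0\<close> weakly. The test functions need not have bounded support, so a divergence-free field
  supported in a bounded set has mean zero.\<close>

definition divfree :: "(spacetime \<Rightarrow> real) \<Rightarrow> (spacetime \<Rightarrow> complex) \<Rightarrow> bool" where
  "divfree q w \<longleftrightarrow> (\<forall>\<psi> G. C1_grad \<psi> G \<longrightarrow> (\<integral>z. w z \<bullet> space_part (G z) + q z * snd (G z) \<partial>lborel) = 0)"

abbreviation axis_x1 :: spacetime where "axis_x1 \<equiv> (axis 1 1, 0)"
abbreviation axis_x2 :: spacetime where "axis_x2 \<equiv> (axis 2 1, 0)"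
abbreviation axis_t :: spacetime where "axis_t \<equiv> (0, 1)"

lemma inner_axes [simp]: "G \<bullet> axis_x1 = fst G $ 1" "G \<bullet> axis_x2 = fst G $ 2" "G \<bullet> axis_t = snd G"
  by (auto simp: inner_prod_def inner_axis)

lemma continuous_on_space_part [continuous_intros]:
  "continuous_on S f \<Longrightarrow> continuous_on S (\<lambda>z. space_part (f z))"
  unfolding space_part_def Complex_eq by (intro continuous_intros)

lemma C1_grad_continuous: "C1_grad \<psi> G \<Longrightarrow> continuous_on UNIV \<psi>"
  unfolding C1_grad_def
  by (meson UNIV_I continuous_at_imp_continuous_on differentiable_imp_continuous_within differentiableI)

lemma C1_grad_dir_deriv: "C1_grad \<psi> G \<Longrightarrow> dir_deriv \<psi> e (\<lambda>z. G z \<bullet> e)"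
  unfolding dir_deriv_def
proof
  fix z assume "C1_grad \<psi> G"
  then have "(\<psi> has_derivative (\<lambda>h. G z \<bullet> h)) (at (z + 0 *\<^sub>R e))" by (simp add: C1_grad_def)
  moreover have "((\<lambda>s::real. z + s *\<^sub>R e) has_derivative (\<lambda>s. s *\<^sub>R e)) (at 0)"
    by (auto intro!: derivative_eq_intros)
  ultimately have "((\<lambda>s. \<psi> (z + s *\<^sub>R e)) has_derivative (\<lambda>s. G z \<bullet> (s *\<^sub>R e))) (at 0)"
    by (rule has_derivative_compose[rotated])
  then show "((\<lambda>s. \<psi> (z + s *\<^sub>R e)) has_real_derivative G z \<bullet> e) (at 0)"
    by (simp add: has_field_derivative_def mult_commute_abs)
qed

lemma dir_deriv_add: "dir_deriv f e f' \<Longrightarrow> dir_deriv g e g' \<Longrightarrow> dir_deriv (\<lambda>z. f z + g z) e (\<lambda>z. f' z + g' z)"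
  unfolding dir_deriv_def by (auto intro!: derivative_eq_intros)

lemma dir_deriv_cmult: "dir_deriv f e f' \<Longrightarrow> dir_deriv (\<lambda>z. c * f z) e (\<lambda>z. c * f' z)"
  unfolding dir_deriv_def by (auto intro!: derivative_eq_intros)

lemma dir_deriv_mult: "dir_deriv f e f' \<Longrightarrow> dir_deriv g e g' \<Longrightarrow> dir_deriv (\<lambda>z. f z * g z) e (\<lambda>z. f' z * g z + f z * g' z)"
  unfolding dir_deriv_def by (auto intro!: derivative_eq_intros)

text \<open>Each coordinate direction is integrated by parts separately, applying
  \<open>integral_dir_deriv_zero\<close> to the product of a component with \<open>\<psi>\<close>;
  the three terms in which the component is differentiated cancel by \<open>div\<close>.\<close>

lemma divfreeI:
  assumes d: "dir_deriv w1 axis_x1 d1" "dir_deriv w2 axis_x2 d2" "dir_deriv q axis_t d3"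
    and c: "continuous_on UNIV w1" "continuous_on UNIV w2" "continuous_on UNIV q"
      "continuous_on UNIV d1" "continuous_on UNIV d2" "continuous_on UNIV d3"
    and S: "bounded S" "\<And>z. z \<notin> S \<Longrightarrow> w1 z = 0 \<and> w2 z = 0 \<and> q z = 0 \<and> d1 z = 0 \<and> d2 z = 0 \<and> d3 z = 0"
    and div: "\<And>z. d1 z + d2 z + d3 z = 0"
  shows "divfree q (\<lambda>z. Complex (w1 z) (w2 z))"
  unfolding divfree_def
proof (intro allI impI)
  fix \<psi> :: "spacetime \<Rightarrow> real" and G assume C: "C1_grad \<psi> G"
  note c\<psi> = C1_grad_continuous[OF C]
  have cG: "continuous_on UNIV (\<lambda>z. G z \<bullet> e)" for e
    using C by (auto simp: C1_grad_def intro!: continuous_intros)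
  have i: "(\<integral>z. d z * \<psi> z + w z * (G z \<bullet> e) \<partial>lborel) = 0"
    "integrable lborel (\<lambda>z. d z * \<psi> z + w z * (G z \<bullet> e))"
    if "dir_deriv w e d" "continuous_on UNIV w" "continuous_on UNIV d" "\<And>z. z \<notin> S \<Longrightarrow> w z = 0 \<and> d z = 0" for w d e
  proof -
    have k: "continuous_on UNIV (\<lambda>z. d z * \<psi> z + w z * (G z \<bullet> e))"
      using that(2,3) c\<psi> cG by (intro continuous_on_add continuous_on_mult)
    show "(\<integral>z. d z * \<psi> z + w z * (G z \<bullet> e) \<partial>lborel) = 0"
      by (rule integral_dir_deriv_zero[OF dir_deriv_mult[OF that(1) C1_grad_dir_deriv[OF C]] k _ S(1)])
        (use that c\<psi> in \<open>auto intro!: continuous_intros\<close>)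
    show "integrable lborel (\<lambda>z. d z * \<psi> z + w z * (G z \<bullet> e))"
      by (rule continuous_vanishing_integrable[OF k S(1)]) (use that in auto)
  qed
  note i1 = i[OF d(1) c(1,4)] and i2 = i[OF d(2) c(2,5)] and i3 = i[OF d(3) c(3,6)]
  have eq: "Complex (w1 z) (w2 z) \<bullet> space_part (G z) + q z * snd (G z) =
    (d1 z * \<psi> z + w1 z * (G z \<bullet> axis_x1)) + (d2 z * \<psi> z + w2 z * (G z \<bullet> axis_x2)) + (d3 z * \<psi> z + q z * (G z \<bullet> axis_t))" for z
  proof -
    have "(d1 z + d2 z + d3 z) * \<psi> z = 0" using div by simp
    then show ?thesis by (simp add: space_part_def inner_complex_def algebra_simps)
  qed
  show "(\<integral>z. Complex (w1 z) (w2 z) \<bullet> space_part (G z) + q z * snd (G z) \<partial>lborel) = 0"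
    unfolding eq using i1 i2 i3 S(2) by (subst Bochner_Integration.integral_add; simp)+
qed

section \<open>Oscillating building blocks\<close>

lemma power_Suc_dvd_pderiv:
  fixes q p :: "real poly"
  assumes "q ^ Suc n dvd p"
  shows "q ^ n dvd pderiv p"
proof -
  obtain r where "p = q ^ Suc n * r" using assms by (elim dvdE)
  then have "pderiv p = q ^ Suc n * pderiv r + (r * smult (of_nat (Suc n)) (q ^ n)) * pderiv q"
    by (simp only: pderiv_mult pderiv_power_Suc)
  also have "\<dots> = q ^ n * (q * pderiv r + smult (of_nat (Suc n)) (r * pderiv q))"
    by (simp add: algebra_simps)
  finally show ?thesis by simp
qed

text \<open>At an endpoint \<open>p\<close> and its derivative vanish, so the difference quotient of
  \<open>p\<close> tends to 0 there; it dominates the quotient of the truncated function.\<close>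

lemma DERIV_cutoff_poly:
  fixes p :: "real poly"
  assumes ab: "a < b"
    and "poly p a = 0" "poly (pderiv p) a = 0" "poly p b = 0" "poly (pderiv p) b = 0"
  shows "((\<lambda>s. if s \<in> {a<..<b} then poly p s else 0) has_real_derivative
    (if s \<in> {a<..<b} then poly (pderiv p) s else 0)) (at s)"
proof -
  let ?f = "\<lambda>s. if s \<in> {a<..<b} then poly p s else 0"
  have end_zero: "(?f has_real_derivative 0) (at c)" if "poly p c = 0" "poly (pderiv p) c = 0" "c = a \<or> c = b" for c
  proof -
    have "(poly p has_real_derivative 0) (at c)" using poly_DERIV[of p c] that by simp
    then have "((\<lambda>h. poly p (c + h) / h) \<longlongrightarrow> 0) (at 0)"
      using that by (simp add: DERIV_def)
    then have "((\<lambda>h. norm (poly p (c + h) / h)) \<longlongrightarrow> 0) (at 0)"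
      by (rule tendsto_norm_zero)
    then have "((\<lambda>h. ?f (c + h) / h) \<longlongrightarrow> 0) (at 0)"
      by (rule Lim_null_comparison[rotated]) (auto simp: eventually_at_filter)
    then show ?thesis using that by (auto simp add: DERIV_def)
  qed
  consider "s < a" | "s = a" | "a < s" "s < b" | "s = b" | "b < s" by linarith
  then show ?thesis
  proof cases
    case 1
    have "(?f has_real_derivative 0) (at s)"
      by (rule has_field_derivative_transform_within_open[where S="{..<a}" and f="\<lambda>_. 0"]) (use 1 in auto)
    with 1 show ?thesis by auto
  next
    case 2
    then show ?thesis using end_zero[of a] assms by auto
  next
    case 3
    have "(?f has_real_derivative poly (pderiv p) s) (at s)"
      by (rule has_field_derivative_transform_within_open[where S="{a<..<b}" and f="poly p"]) (use 3 poly_DERIV in auto)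
    with 3 show ?thesis by auto
  next
    case 4
    then show ?thesis using end_zero[of b] assms by auto
  next
    case 5
    have "(?f has_real_derivative 0) (at s)"
      by (rule has_field_derivative_transform_within_open[where S="{b<..}" and f="\<lambda>_. 0"]) (use 5 in auto)
    with 5 show ?thesis by auto
  qed
qed

text \<open>Finite smoothness is enough: the fields are third derivatives of a potential, and their
  divergence takes one derivative more. Roots of order 6 at both ends make the derivatives up to the
  fifth vanish there, hence \<open>g k\<close> is differentiable across the ends for
  \<open>k \<le> 4\<close>.\<close>

lemma bump_exists:
  fixes a b :: real
  assumes ab: "a < b"
  obtains g :: "nat \<Rightarrow> real \<Rightarrow> real" where
    "\<And>k s. k \<le> 4 \<Longrightarrow> (g k has_real_derivative g (Suc k) s) (at s)"
    "\<And>k s. s \<notin> {a<..<b} \<Longrightarrow> g k s = 0"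
    "\<And>s. 0 \<le> g 0 s" "\<And>s. g 0 s \<le> 1"
    "\<And>s. s \<in> {a + (b - a) / 4..b - (b - a) / 4} \<Longrightarrow> g 0 s \<ge> 1/8"
proof -
  \<comment> \<open>The scaling makes the maximum, attained at the midpoint, equal to 1. On the
    middle half the base of the sixth power is at least 3/4, and (3/4)^6 exceeds 1/8.\<close>
  define p :: "real poly" where "p = smult ((4 / (b - a)^2)^6) (([:-a,1:] * [:b,-1:])^6)"
  define g where "g k s = (if s \<in> {a<..<b} then poly ((pderiv ^^ k) p) s else 0)" for k s
  have da: "[:-a,1:]^(6-k) dvd (pderiv ^^ k) p" if "k \<le> 6" for k using that
  proof (induction k)
    case 0
    show ?case unfolding p_def power_mult_distrib by (simp add: dvd_smult)
  next
    case (Suc k)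
    moreover have "6 - k = Suc (6 - Suc k)" using Suc.prems by simp
    ultimately have "[:-a,1:] ^ Suc (6 - Suc k) dvd (pderiv ^^ k) p" by (metis Suc_leD)
    from power_Suc_dvd_pderiv[OF this] show ?case by simp
  qed
  have db: "[:b,-1:]^(6-k) dvd (pderiv ^^ k) p" if "k \<le> 6" for k using that
  proof (induction k)
    case 0
    show ?case unfolding p_def power_mult_distrib by (simp add: dvd_smult)
  next
    case (Suc k)
    moreover have "6 - k = Suc (6 - Suc k)" using Suc.prems by simp
    ultimately have "[:b,-1:] ^ Suc (6 - Suc k) dvd (pderiv ^^ k) p" by (metis Suc_leD)
    from power_Suc_dvd_pderiv[OF this] show ?case by simp
  qed
  have z: "poly ((pderiv ^^ k) p) a = 0" "poly ((pderiv ^^ k) p) b = 0" if "k \<le> 5" for k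
  proof -
    have "0 < 6 - k" using that by simp
    then have "[:-a,1:] dvd (pderiv ^^ k) p" "[:b,-1:] dvd (pderiv ^^ k) p"
      using da[of k] db[of k] that dvd_trans[OF dvd_power] by force+
    then obtain q r where "(pderiv ^^ k) p = [:-a,1:] * q" "(pderiv ^^ k) p = [:b,-1:] * r"
      by (elim dvdE)
    from arg_cong[OF this(1), of "\<lambda>p. poly p a"] arg_cong[OF this(2), of "\<lambda>p. poly p b"]
    show "poly ((pderiv ^^ k) p) a = 0" "poly ((pderiv ^^ k) p) b = 0"
      by (simp_all del: mult_pCons_left)
  qed
  have val: "poly p s = (4 * ((s - a) * (b - s)) / (b - a)^2)^6" for s
  proof -
    have "poly p s = (4 / (b - a)^2)^6 * (poly ([:-a,1:] * [:b,-1:]) s)^6"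
      by (simp only: p_def poly_smult poly_power)
    also have "poly ([:-a,1:] * [:b,-1:]) s = (s - a) * (b - s)"
      by (simp add: algebra_simps)
    finally show ?thesis by (simp only: power_mult_distrib[symmetric]) simp
  qed
  have le1: "4 * ((s - a) * (b - s)) / (b - a)^2 \<le> 1" for s
  proof -
    have "0 \<le> (a + b - 2 * s)^2" by simp
    then have "4 * ((s - a) * (b - s)) \<le> (b - a)^2" by (simp add: power2_eq_square algebra_simps)
    then show ?thesis using ab by (simp add: divide_simps)
  qed
  have ge: "4 * ((s - a) * (b - s)) / (b - a)^2 \<ge> 3/4" if "s \<in> {a + (b - a) / 4..b - (b - a) / 4}" for s
  proof -
    have "0 \<le> (s - (a + (b - a) / 4)) * (b - (b - a) / 4 - s)" using that by (intro mult_nonneg_nonneg) auto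
    then have "4 * ((s - a) * (b - s)) \<ge> 3/4 * (b - a)^2" by (simp add: power2_eq_square field_simps)
    then show ?thesis using ab by (simp add: divide_simps)
  qed
  show ?thesis
  proof (rule that[of g])
    show "(g k has_real_derivative g (Suc k) s) (at s)" if "k \<le> 4" for k s
    proof -
      have "poly (pderiv ((pderiv ^^ k) p)) a = 0" "poly (pderiv ((pderiv ^^ k) p)) b = 0"
        using z[of "Suc k"] that by simp_all
      with z[of k] that have "((\<lambda>s. if s \<in> {a<..<b} then poly ((pderiv ^^ k) p) s else 0) has_real_derivative
          (if s \<in> {a<..<b} then poly (pderiv ((pderiv ^^ k) p)) s else 0)) (at s)"
        by (intro DERIV_cutoff_poly[OF ab]) auto
      then show ?thesis by (simp only: g_def[abs_def] funpow.simps o_apply)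
    qed
    show "g k s = 0" if "s \<notin> {a<..<b}" for k s
      using that by (auto simp: g_def)
    show "0 \<le> g 0 s" for s
      by (auto simp: g_def val)
    show "g 0 s \<le> 1" for s
    proof (cases "s \<in> {a<..<b}")
      case True
      then have "0 \<le> 4 * ((s - a) * (b - s)) / (b - a)^2" by simp
      then show ?thesis using le1[of s] True by (simp add: g_def val power_le_one)
    qed (auto simp: g_def)
    show "g 0 s \<ge> 1/8" if s: "s \<in> {a + (b - a) / 4..b - (b - a) / 4}" for s
    proof -
      have "s \<in> {a<..<b}" using s ab by (auto simp: field_simps)
      moreover have "(3/4)^6 \<le> (4 * ((s - a) * (b - s)) / (b - a)^2)^6"
        by (rule power_mono[OF ge[OF s]]) simp
      moreover have "(1/8::real) \<le> (3/4)^6" by (simp add: power_divide)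
      ultimately show ?thesis unfolding g_def funpow.simps id_apply val by (simp only: if_True)
    qed
  qed
qed

text \<open>The complex number \<open>u = a + ib\<close> stands for the traceless symmetric matrix \<open>[[a, b], [b, -a]]\<close>, whose rows are
  \<open>u\<close> and \<open>-iu\<close> as complex numbers. So \<open>solenoidal v u\<close> is the linear system \<open>div v = 0\<close>,
  \<open>\<partial>\<^sub>t v + div u = 0\<close>.\<close>

definition solenoidal :: "(spacetime \<Rightarrow> complex) \<Rightarrow> (spacetime \<Rightarrow> complex) \<Rightarrow> bool" where
  "solenoidal v u \<longleftrightarrow> divfree (\<lambda>_. 0) v \<and> divfree (\<lambda>z. Re (v z)) u \<and> divfree (\<lambda>z. Im (v z)) (\<lambda>z. - \<i> * u z)"

text \<open>The \<open>k\<close>-th derivative of \<open>g(s) exp(i(n+1)\<xi>s)\<close> is \<open>(n+1)\<^sup>k osc_coeff g \<xi> n k 0 s exp(i(n+1)\<xi>s)\<close>, where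
  \<open>g j\<close> is the \<open>j\<close>-th derivative of \<open>g = g 0\<close>.\<close>

primrec osc_coeff :: "(nat \<Rightarrow> real \<Rightarrow> real) \<Rightarrow> real \<Rightarrow> nat \<Rightarrow> nat \<Rightarrow> nat \<Rightarrow> real \<Rightarrow> complex" where
  "osc_coeff g \<xi> n 0 = (\<lambda>j s. of_real (g j s))"
| "osc_coeff g \<xi> n (Suc k) = (\<lambda>j s. \<i> * of_real \<xi> * osc_coeff g \<xi> n k j s + osc_coeff g \<xi> n k (Suc j) s / of_nat (Suc n))"

text \<open>Uniform closeness of two sequences instead of convergence to a limit, because the
  leading terms oscillate faster and faster with \<open>n\<close>.\<close>

definition asymp_eq :: "(nat \<Rightarrow> 'a \<Rightarrow> 'b::real_normed_vector) \<Rightarrow> (nat \<Rightarrow> 'a \<Rightarrow> 'b) \<Rightarrow> bool" where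
  "asymp_eq f f' \<longleftrightarrow> (\<forall>\<delta>>0. \<forall>\<^sub>F n in sequentially. \<forall>z. norm (f n z - f' n z) \<le> \<delta>)"

lemma asymp_eq_D: "asymp_eq f f' \<Longrightarrow> \<delta> > 0 \<Longrightarrow> \<forall>\<^sub>F n in sequentially. \<forall>z. norm (f n z - f' n z) \<le> \<delta>"
  by (auto simp: asymp_eq_def)

lemma asymp_eq_compose: "asymp_eq f f' \<Longrightarrow> asymp_eq (\<lambda>n z. f n (h z)) (\<lambda>n z. f' n (h z))"
  unfolding asymp_eq_def
proof (intro allI impI)
  fix \<delta> :: real
  assume "\<forall>\<delta>>0. \<forall>\<^sub>F n in sequentially. \<forall>z. norm (f n z - f' n z) \<le> \<delta>" "\<delta> > 0"
  then have "\<forall>\<^sub>F n in sequentially. \<forall>z. norm (f n z - f' n z) \<le> \<delta>" by blast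
  then show "\<forall>\<^sub>F n in sequentially. \<forall>z. norm (f n (h z) - f' n (h z)) \<le> \<delta>"
    by (rule eventually_mono) blast
qed

text \<open>Only the model sequences \<open>f'\<close> and \<open>g'\<close> need bounds; closeness
  then bounds \<open>g\<close> by \<open>B + 1\<close>, and the splitting
  \<open>(f - f') * g + f' * (g - g')\<close> gives the error
  \<open>d * (A + B + 1)\<close>.\<close>

lemma asymp_eq_mult:
  fixes f f' g g' :: "nat \<Rightarrow> 'a \<Rightarrow> 'b::real_normed_algebra"
  assumes "asymp_eq f f'" "asymp_eq g g'" "\<And>n z. norm (f' n z) \<le> A" "\<And>n z. norm (g' n z) \<le> B"
  shows "asymp_eq (\<lambda>n z. f n z * g n z) (\<lambda>n z. f' n z * g' n z)"
  unfolding asymp_eq_def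
proof (intro allI impI)
  fix \<delta> :: real assume \<delta>: "\<delta> > 0"
  have AB: "0 \<le> A" "0 \<le> B" using assms(3,4) norm_ge_zero order_trans by blast+
  define d where "d = min 1 (\<delta> / (A + B + 1))"
  have d: "d > 0" "d \<le> 1" "d * (A + B + 1) \<le> \<delta>"
  proof -
    show "d > 0" "d \<le> 1" using \<delta> AB by (auto simp: d_def)
    have "d * (A + B + 1) \<le> \<delta> / (A + B + 1) * (A + B + 1)"
      using AB by (intro mult_right_mono) (auto simp: d_def)
    then show "d * (A + B + 1) \<le> \<delta>" using AB by simp
  qed
  have "\<forall>\<^sub>F n in sequentially. \<forall>z. norm (f n z - f' n z) \<le> d" "\<forall>\<^sub>F n in sequentially. \<forall>z. norm (g n z - g' n z) \<le> d"
    using assms d by (auto simp: asymp_eq_def)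
  then show "\<forall>\<^sub>F n in sequentially. \<forall>z. norm (f n z * g n z - f' n z * g' n z) \<le> \<delta>"
  proof eventually_elim
    case (elim n)
    show ?case
    proof
      fix z
      have 1: "norm (f n z - f' n z) \<le> d" "norm (g n z - g' n z) \<le> d" using elim by auto
      have 2: "norm (g n z) \<le> B + 1"
        using norm_triangle_ineq2[of "g n z" "g' n z"] 1(2) assms(4)[where n=n and z=z] d(2) by linarith
      have "f n z * g n z - f' n z * g' n z = (f n z - f' n z) * g n z + f' n z * (g n z - g' n z)"
        by (simp add: algebra_simps)
      also have "norm \<dots> \<le> d * (B + 1) + A * d"
        using 1 2 assms(3) d(1) AB
        by (intro norm_triangle_mono order_trans[OF norm_mult_ineq] mult_mono) auto
      also have "\<dots> = d * (A + B + 1)" by (simp add: algebra_simps)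
      finally show "norm (f n z * g n z - f' n z * g' n z) \<le> \<delta>" using d(3) by linarith
    qed
  qed
qed

lemma asymp_eq_cmult:
  fixes f f' :: "nat \<Rightarrow> 'a \<Rightarrow> 'b::real_normed_algebra"
  assumes "asymp_eq f f'"
  shows "asymp_eq (\<lambda>n z. c * f n z) (\<lambda>n z. c * f' n z)"
  unfolding asymp_eq_def
proof (intro allI impI)
  fix \<delta> :: real assume \<delta>: "\<delta> > 0"
  then have "\<forall>\<^sub>F n in sequentially. \<forall>z. norm (f n z - f' n z) \<le> \<delta> / (norm c + 1)"
    using assms by (auto simp: asymp_eq_def add_nonneg_pos)
  then show "\<forall>\<^sub>F n in sequentially. \<forall>z. norm (c * f n z - c * f' n z) \<le> \<delta>"
  proof eventually_elim
    case (elim n)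
    show ?case
    proof
      fix z
      have "norm (c * f n z - c * f' n z) \<le> norm c * norm (f n z - f' n z)"
        by (metis norm_mult_ineq right_diff_distrib)
      also have "\<dots> \<le> (norm c + 1) * (\<delta> / (norm c + 1))"
        using elim by (intro mult_mono) auto
      also have "\<dots> = \<delta>"
        using norm_ge_zero[of c] by (simp add: add_nonneg_eq_0_iff)
      finally show "norm (c * f n z - c * f' n z) \<le> \<delta>" .
    qed
  qed
qed

lemma asymp_eq_Re:
  assumes "asymp_eq f f'"
  shows "asymp_eq (\<lambda>n z. Re (f n z)) (\<lambda>n z. Re (f' n z))"
  unfolding asymp_eq_def
proof (intro allI impI)
  fix \<delta> :: real
  assume "\<delta> > 0"
  from asymp_eq_D[OF assms this] show "\<forall>\<^sub>F n in sequentially. \<forall>z. norm (Re (f n z) - Re (f' n z)) \<le> \<delta>"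
    by (rule eventually_mono) (metis abs_Re_le_cmod minus_complex.sel(1) order_trans real_norm_def)
qed

text \<open>\<open>F n k\<close> is the \<open>k\<close>-th derivative of \<open>F n 0\<close>
  divided by \<open>(Suc n)^k\<close>. With this normalization the derivatives stay bounded as the
  frequency grows, and up to an error of order \<open>1 / Suc n\<close> only the phase gets
  differentiated.\<close>

lemma oscillating_factor:
  fixes a b \<xi> :: real
  assumes ab: "a < b"
  obtains F :: "nat \<Rightarrow> nat \<Rightarrow> real \<Rightarrow> complex" and p :: "real \<Rightarrow> real" where
    "\<And>n k s. k \<le> 3 \<Longrightarrow> (F n k has_vector_derivative of_nat (Suc n) * F n (Suc k) s) (at s)"
    "\<And>n k. k \<le> 4 \<Longrightarrow> continuous_on UNIV (F n k)"
    "\<And>n k s. s \<notin> {a<..<b} \<Longrightarrow> F n k s = 0"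
    "continuous_on UNIV p" "\<And>s. 0 \<le> p s" "\<And>s. p s \<le> 1" "\<And>s. s \<notin> {a<..<b} \<Longrightarrow> p s = 0"
    "\<And>s. s \<in> {a + (b - a) / 4..b - (b - a) / 4} \<Longrightarrow> p s \<ge> 1/8"
    "\<And>k. k \<le> 3 \<Longrightarrow> asymp_eq (\<lambda>n. F n k) (\<lambda>n s. (\<i> * of_real \<xi>)^k * of_real (p s) * cis (real (Suc n) * \<xi> * s))"
proof -
  obtain g where g: "\<And>k s. k \<le> 4 \<Longrightarrow> (g k has_real_derivative g (Suc k) s) (at s)"
    "\<And>k s. s \<notin> {a<..<b} \<Longrightarrow> g k s = 0"
    "\<And>s. 0 \<le> g 0 s" "\<And>s. g 0 s \<le> (1::real)"
    "\<And>s. s \<in> {a + (b - a) / 4..b - (b - a) / 4} \<Longrightarrow> g 0 s \<ge> 1/8"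
    using bump_exists[OF ab] by blast
  let ?h = "osc_coeff g \<xi>"
  define F where "F n k s = ?h n k 0 s * cis (real (Suc n) * \<xi> * s)" for n k s
  have gc: "continuous_on UNIV (g k)" if "k \<le> 4" for k
    using g(1)[OF that] by (auto simp: continuous_on_eq_continuous_at intro: DERIV_isCont)
  have der: "(?h n k j has_vector_derivative ?h n k (Suc j) s) (at s)" if "k + j \<le> 4" for n k j s
    using that
  proof (induction k arbitrary: j)
    case 0
    then show ?case using g(1)[of j s]
      by (auto intro!: has_vector_derivative_of_real simp: has_real_derivative_iff_has_vector_derivative)
  next
    case (Suc k)
    from Suc.IH[of j] Suc.IH[of "Suc j"] Suc.prems show ?case
      by (auto intro!: derivative_eq_intros)
  qed
  have derF: "(F n k has_vector_derivative of_nat (Suc n) * F n (Suc k) s) (at s)" if "k \<le> 4" for n k s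
  proof -
    have "((\<lambda>s. cis (real (Suc n) * \<xi> * s)) has_vector_derivative (real (Suc n) * \<xi>) *\<^sub>R (\<i> * cis (real (Suc n) * \<xi> * s))) (at s)"
      unfolding has_vector_derivative_def by (auto intro!: derivative_eq_intros simp del: of_nat_Suc)
    moreover have "?h n k 0 s * ((real (Suc n) * \<xi>) *\<^sub>R (\<i> * cis (real (Suc n) * \<xi> * s))) + ?h n k (Suc 0) s * cis (real (Suc n) * \<xi> * s)
      = of_nat (Suc n) * F n (Suc k) s"
    proof -
      define N where "N = complex_of_nat (Suc n)"
      have "N \<noteq> 0" by (simp add: N_def del: of_nat_Suc)
      then show ?thesis
        unfolding F_def osc_coeff.simps scaleR_conv_of_real of_real_mult of_real_of_nat_eq N_def[symmetric]
        by (simp add: field_simps)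
    qed
    ultimately show ?thesis
      using has_vector_derivative_mult[OF der[of k 0 n s]] that unfolding F_def[abs_def] by fastforce
  qed
  \<comment> \<open>The induction generalizes over \<open>j\<close>, since a step in
    \<open>k\<close> calls on the coefficient with \<open>Suc j\<close>. That one enters divided by
    \<open>Suc n\<close>, so its boundedness is all that the error estimate requires.\<close>
  have bnd: "\<exists>B. \<forall>n s. norm (?h n k j s) \<le> B \<and> norm (?h n k j s - (\<i> * of_real \<xi>)^k * of_real (g j s)) \<le> B / real (Suc n)"
    if "k + j \<le> 4" for k j
    using that
  proof (induction k arbitrary: j)
    case 0
    then have j: "j \<le> 4" by simp
    obtain B where "B > 0" "\<And>s. norm (g j s) \<le> B"
      using continuous_vanishing_bounded[OF gc[OF j], of "{a<..<b}"] g(2) by auto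
    then show ?case by (intro exI[of _ B]) simp
  next
    case (Suc k)
    from Suc.IH[of j] Suc.prems obtain B1 where B1: "\<And>n s. norm (?h n k j s) \<le> B1"
      "\<And>n s. norm (?h n k j s - (\<i> * of_real \<xi>)^k * of_real (g j s)) \<le> B1 / real (Suc n)" by auto
    from Suc.IH[of "Suc j"] Suc.prems obtain B2 where B2: "\<And>n s. norm (?h n k (Suc j) s) \<le> B2" by auto
    have B20: "0 \<le> B2" using B2 norm_ge_zero order_trans by blast
    have q: "norm (?h n k (Suc j) s / of_nat (Suc n)) \<le> B2 / real (Suc n)" for n s
      using B2[of n s] by (simp add: norm_divide divide_right_mono del: of_nat_Suc)
    show ?case
    proof (intro exI[of _ "\<bar>\<xi>\<bar> * B1 + B2"] allI conjI)
      fix n s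
      have "B2 / real (Suc n) \<le> B2" using B20 by (simp add: field_simps)
      then have "norm (?h n k (Suc j) s / of_nat (Suc n)) \<le> B2" using q[of n s] by linarith
      moreover have "norm (\<i> * of_real \<xi> * ?h n k j s) \<le> \<bar>\<xi>\<bar> * B1"
        using B1(1)[of n s] by (simp add: norm_mult mult_left_mono)
      ultimately show "norm (?h n (Suc k) j s) \<le> \<bar>\<xi>\<bar> * B1 + B2"
        by (simp only: osc_coeff.simps) (rule norm_triangle_mono)
      have "?h n (Suc k) j s - (\<i> * of_real \<xi>)^Suc k * of_real (g j s) =
        \<i> * of_real \<xi> * (?h n k j s - (\<i> * of_real \<xi>)^k * of_real (g j s)) + ?h n k (Suc j) s / of_nat (Suc n)"
        by (simp add: algebra_simps del: of_nat_Suc)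
      moreover have "norm (\<i> * of_real \<xi> * (?h n k j s - (\<i> * of_real \<xi>)^k * of_real (g j s))) \<le> \<bar>\<xi>\<bar> * (B1 / real (Suc n))"
        unfolding norm_mult using mult_left_mono[OF B1(2)[of n s], of "\<bar>\<xi>\<bar>"] by (simp del: of_nat_Suc)
      ultimately have "norm (?h n (Suc k) j s - (\<i> * of_real \<xi>)^Suc k * of_real (g j s)) \<le> \<bar>\<xi>\<bar> * (B1 / real (Suc n)) + B2 / real (Suc n)"
        using q[of n s] by (simp only:) (rule norm_triangle_mono)
      then show "norm (?h n (Suc k) j s - (\<i> * of_real \<xi>)^Suc k * of_real (g j s)) \<le> (\<bar>\<xi>\<bar> * B1 + B2) / real (Suc n)"
        by (simp only: add_divide_distrib times_divide_eq_right)
    qed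
  qed
  show ?thesis
  proof (rule that[of F "g 0"])
    show "(F n k has_vector_derivative of_nat (Suc n) * F n (Suc k) s) (at s)" if "k \<le> 3" for n k s
      using derF that by simp
    show "continuous_on UNIV (F n k)" if "k \<le> 4" for n k
      using derF[OF that] by (auto simp: continuous_on_eq_continuous_at intro: has_vector_derivative_continuous)
    have "?h n k j s = 0" if "s \<notin> {a<..<b}" for n k j s
      using that by (induction k arbitrary: j) (auto simp: g(2))
    then show "F n k s = 0" if "s \<notin> {a<..<b}" for n k s
      using that by (simp add: F_def)
    show "continuous_on UNIV (g 0)" using gc by simp
    show "asymp_eq (\<lambda>n. F n k) (\<lambda>n s. (\<i> * of_real \<xi>)^k * of_real (g 0 s) * cis (real (Suc n) * \<xi> * s))" if k: "k \<le> 3" for k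
      unfolding asymp_eq_def
    proof (intro allI impI)
      fix \<delta> :: real assume \<delta>: "\<delta> > 0"
      obtain B where B: "\<And>n s. norm (?h n k 0 s - (\<i> * of_real \<xi>)^k * of_real (g 0 s)) \<le> B / real (Suc n)"
        using bnd[of k 0] k by auto
      have "(\<lambda>n. B / real (Suc n)) \<longlonglongrightarrow> 0" by (rule LIMSEQ_Suc[OF lim_const_over_n])
      then have "\<forall>\<^sub>F n in sequentially. B / real (Suc n) < \<delta>"
        using \<delta> by (rule order_tendstoD(2))
      then show "\<forall>\<^sub>F n in sequentially. \<forall>s. norm (F n k s - (\<i> * of_real \<xi>)^k * of_real (g 0 s) * cis (real (Suc n) * \<xi> * s)) \<le> \<delta>"
      proof eventually_elim
        case (elim n)
        have "norm (F n k s - (\<i> * of_real \<xi>)^k * of_real (g 0 s) * cis (real (Suc n) * \<xi> * s)) = norm (?h n k 0 s - (\<i> * of_real \<xi>)^k * of_real (g 0 s))" for s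
          unfolding F_def left_diff_distrib[symmetric] norm_mult by (simp del: of_nat_Suc)
        then show ?case using B[of n] elim by (metis less_imp_le order_trans)
      qed
    qed
  qed (use g in auto)
qed

lemma mem_box_spacetime:
  "z \<in> box a b \<longleftrightarrow> fst z $ 1 \<in> {fst a $ 1<..<fst b $ 1} \<and> fst z $ 2 \<in> {fst a $ 2<..<fst b $ 2}
     \<and> snd z \<in> {snd a<..<snd (b::spacetime)}"
  by (auto simp: mem_box Basis_prod_def Basis_vec_def forall_2 inner_axis inner_prod_def)

lemma mem_cbox_spacetime:
  "z \<in> cbox a b \<longleftrightarrow> fst z $ 1 \<in> {fst a $ 1..fst b $ 1} \<and> fst z $ 2 \<in> {fst a $ 2..fst b $ 2}
     \<and> snd z \<in> {snd a..snd (b::spacetime)}"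
  by (cases a; cases b; cases z) (auto simp: cbox_Pair_eq mem_box_cart forall_2)

lemma measure_middle_box:
  fixes a b :: "'a::euclidean_space"
  assumes "box a b \<noteq> {}"
  shows "measure lborel (cbox (a + (b - a) /\<^sub>R 4) (b - (b - a) /\<^sub>R 4)) = measure lborel (box a b) / 2 ^ DIM('a)"
proof -
  have le: "a \<bullet> i \<le> b \<bullet> i" if "i \<in> Basis" for i
    using assms that by (metis box_ne_empty(2) less_imp_le)
  have "(b - (b - a) /\<^sub>R 4 - (a + (b - a) /\<^sub>R 4)) \<bullet> i = (b - a) \<bullet> i / 2" for i
    by (simp add: inner_diff_left inner_add_left field_simps)
  moreover have "(a + (b - a) /\<^sub>R 4) \<bullet> i \<le> (b - (b - a) /\<^sub>R 4) \<bullet> i" if "i \<in> Basis" for i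
    using le[OF that] by (simp add: inner_diff_left inner_add_left field_simps)
  ultimately have "measure lborel (cbox (a + (b - a) /\<^sub>R 4) (b - (b - a) /\<^sub>R 4)) = (\<Prod>i\<in>Basis. (b - a) \<bullet> i / 2)"
    by (subst measure_lborel_cbox) (auto intro!: prod.cong)
  also have "\<dots> = (\<Prod>i\<in>Basis. (b - a) \<bullet> i) / 2 ^ DIM('a)"
    by (simp add: prod_dividef)
  also have "(\<Prod>i\<in>Basis. (b - a) \<bullet> i) = measure lborel (box a b)"
    using le by (subst measure_lborel_box) auto
  finally show ?thesis .
qed

lemma dir_deriv_uminus: "dir_deriv f e f' \<Longrightarrow> dir_deriv (\<lambda>z. - f z) e (\<lambda>z. - f' z)"
  unfolding dir_deriv_def by (auto intro!: derivative_eq_intros)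

lemma Re_mult_minus_ii: "(Re x)\<^sup>2 + (Re (- \<i> * x))\<^sup>2 = (norm x)\<^sup>2"
  by (simp add: cmod_power2)

lemma norm_Complex_le: "\<bar>x\<bar> \<le> d \<Longrightarrow> \<bar>y\<bar> \<le> d \<Longrightarrow> norm (Complex x y) \<le> 2 * d"
  using cmod_def[of "Complex x y"] sqrt_sum_squares_le_sum_abs[of x y] by simp

text \<open>The potential is \<open>v = \<nabla>\<^sup>\<bottom> \<Delta>\<phi>\<close>, \<open>u = (2 \<partial>\<^sub>1\<partial>\<^sub>2 + i (\<partial>\<^sub>2\<partial>\<^sub>2 - \<partial>\<^sub>1\<partial>\<^sub>1)) \<partial>\<^sub>t\<phi>\<close>, which is solenoidal for every \<open>\<phi>\<close>;
  \<open>\<phi>\<close> is a plane wave of high frequency, cut off to the box. Of two such waves in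
  quadrature, whose total energy does not oscillate, one carries at least half of that energy.\<close>

lemma building_block:
  fixes a b :: spacetime and e :: complex and \<tau> A \<eta> :: real
  assumes ne: "box a b \<noteq> {}" and e: "norm e = 1" and A: "A > 0" and \<eta>: "\<eta> > 0"
  obtains v u :: "spacetime \<Rightarrow> complex" and s :: "spacetime \<Rightarrow> real" where
    "continuous_on UNIV v" "continuous_on UNIV u"
    "\<And>z. z \<notin> box a b \<Longrightarrow> v z = 0 \<and> u z = 0" "solenoidal v u"
    "\<And>z. \<bar>s z\<bar> \<le> A" "\<And>z. norm (v z - s z *\<^sub>R e) \<le> \<eta>" "\<And>z. norm (u z - s z *\<^sub>R (\<i> * of_real \<tau> * e\<^sup>2)) \<le> \<eta>"
    "A\<^sup>2 / 2^24 * measure lborel (box a b) \<le> (\<integral>z. (norm (v z))\<^sup>2 \<partial>lborel)"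
proof -
  \<comment> \<open>The spatial frequency is a unit vector orthogonal to \<open>e\<close>, so that
    the rotated gradient in \<open>v\<close> points along \<open>e\<close> and the Laplacian
    contributes no further factor in modulus. The time frequency \<open>- \<tau>\<close> gives
    \<open>u\<close> the amplitude \<open>\<i> * \<tau> * e^2\<close>.\<close>
  define \<xi>1 \<xi>2 \<xi>3 where "\<xi>1 = - Im e" and "\<xi>2 = Re e" and "\<xi>3 = - \<tau>"
  have n1: "\<xi>1\<^sup>2 + \<xi>2\<^sup>2 = 1" using e by (simp add: \<xi>1_def \<xi>2_def cmod_def)
  have lt: "fst a $ 1 < fst b $ 1" "fst a $ 2 < fst b $ 2" "snd a < snd b"
    using ne mem_box_spacetime[of _ a b] by (force)+
  obtain F1 p1 where F1: "\<And>n k s. k \<le> 3 \<Longrightarrow> (F1 n k has_vector_derivative of_nat (Suc n) * F1 n (Suc k) s) (at s)"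
    "\<And>n k. k \<le> 4 \<Longrightarrow> continuous_on UNIV (F1 n k)"
    "\<And>n k s. s \<notin> {fst a $ 1<..<fst b $ 1} \<Longrightarrow> F1 n k s = 0"
    and p1: "continuous_on UNIV p1" "\<And>s. 0 \<le> p1 s" "\<And>s. p1 s \<le> 1" "\<And>s. s \<notin> {fst a $ 1<..<fst b $ 1} \<Longrightarrow> p1 s = 0"
    "\<And>s. s \<in> {fst a $ 1 + (fst b $ 1 - fst a $ 1) / 4..fst b $ 1 - (fst b $ 1 - fst a $ 1) / 4} \<Longrightarrow> p1 s \<ge> 1/8"
    and as1: "\<And>k. k \<le> 3 \<Longrightarrow> asymp_eq (\<lambda>n. F1 n k) (\<lambda>n s. (\<i> * of_real \<xi>1)^k * of_real (p1 s) * cis (real (Suc n) * \<xi>1 * s))"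
    using oscillating_factor[OF lt(1), of \<xi>1] by blast
  obtain F2 p2 where F2: "\<And>n k s. k \<le> 3 \<Longrightarrow> (F2 n k has_vector_derivative of_nat (Suc n) * F2 n (Suc k) s) (at s)"
    "\<And>n k. k \<le> 4 \<Longrightarrow> continuous_on UNIV (F2 n k)"
    "\<And>n k s. s \<notin> {fst a $ 2<..<fst b $ 2} \<Longrightarrow> F2 n k s = 0"
    and p2: "continuous_on UNIV p2" "\<And>s. 0 \<le> p2 s" "\<And>s. p2 s \<le> 1" "\<And>s. s \<notin> {fst a $ 2<..<fst b $ 2} \<Longrightarrow> p2 s = 0"
    "\<And>s. s \<in> {fst a $ 2 + (fst b $ 2 - fst a $ 2) / 4..fst b $ 2 - (fst b $ 2 - fst a $ 2) / 4} \<Longrightarrow> p2 s \<ge> 1/8"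
    and as2: "\<And>k. k \<le> 3 \<Longrightarrow> asymp_eq (\<lambda>n. F2 n k) (\<lambda>n s. (\<i> * of_real \<xi>2)^k * of_real (p2 s) * cis (real (Suc n) * \<xi>2 * s))"
    using oscillating_factor[OF lt(2), of \<xi>2] by blast
  obtain F3 p3 where F3: "\<And>n k s. k \<le> 3 \<Longrightarrow> (F3 n k has_vector_derivative of_nat (Suc n) * F3 n (Suc k) s) (at s)"
    "\<And>n k. k \<le> 4 \<Longrightarrow> continuous_on UNIV (F3 n k)"
    "\<And>n k s. s \<notin> {snd a<..<snd b} \<Longrightarrow> F3 n k s = 0"
    and p3: "continuous_on UNIV p3" "\<And>s. 0 \<le> p3 s" "\<And>s. p3 s \<le> 1" "\<And>s. s \<notin> {snd a<..<snd b} \<Longrightarrow> p3 s = 0"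
    "\<And>s. s \<in> {snd a + (snd b - snd a) / 4..snd b - (snd b - snd a) / 4} \<Longrightarrow> p3 s \<ge> 1/8"
    and as3: "\<And>k. k \<le> 3 \<Longrightarrow> asymp_eq (\<lambda>n. F3 n k) (\<lambda>n s. (\<i> * of_real \<xi>3)^k * of_real (p3 s) * cis (real (Suc n) * \<xi>3 * s))"
    using oscillating_factor[OF lt(3), of \<xi>3] by blast
  define P where "P k1 k2 k3 n z = F1 n k1 (fst z $ 1) * F2 n k2 (fst z $ 2) * F3 n k3 (snd z)" for k1 k2 k3 n and z :: spacetime
  define cut where "cut z = p1 (fst z $ 1) * p2 (fst z $ 2) * p3 (snd z)" for z :: spacetime
  define E where "E n z = cis (real (Suc n) * \<xi>1 * fst z $ 1) * cis (real (Suc n) * \<xi>2 * fst z $ 2) * cis (real (Suc n) * \<xi>3 * snd z)" for n and z :: spacetime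
  have nE: "norm (E n z) = 1" for n z by (simp add: E_def norm_mult del: of_nat_Suc)
  have cut01: "0 \<le> cut z" "cut z \<le> 1" for z
    using p1 p2 p3 by (auto simp: cut_def intro!: mult_le_one)
  have ccut: "continuous_on UNIV cut"
    unfolding cut_def
    by (intro continuous_intros continuous_on_compose2[OF p1(1)] continuous_on_compose2[OF p2(1)] continuous_on_compose2[OF p3(1)]) auto
  have asP: "asymp_eq (P k1 k2 k3) (\<lambda>n z. ((\<i> * of_real \<xi>1)^k1 * (\<i> * of_real \<xi>2)^k2 * (\<i> * of_real \<xi>3)^k3) * (of_real (cut z) * E n z))"
    if k: "k1 \<le> 3" "k2 \<le> 3" "k3 \<le> 3" for k1 k2 k3
  proof -
    have b: "norm ((\<i> * of_real \<xi>)^k * of_real (p s) * cis (real (Suc n) * \<xi> * s)) \<le> \<bar>\<xi>\<bar> ^ k" if "\<And>s. 0 \<le> p s" "\<And>s. p s \<le> 1" for \<xi> k and p :: "real \<Rightarrow> real" and s n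
    proof -
      have "norm ((\<i> * of_real \<xi>)^k * of_real (p s) * cis (real (Suc n) * \<xi> * s)) = \<bar>\<xi>\<bar> ^ k * p s"
        using that(1)[of s] by (simp add: norm_mult norm_power del: of_nat_Suc)
      also have "\<dots> \<le> \<bar>\<xi>\<bar> ^ k * 1" using that(2)[of s] by (intro mult_left_mono) auto
      finally show ?thesis by simp
    qed
    note b1 = b[of p1 \<xi>1 k1, OF p1(2,3)] and b2 = b[of p2 \<xi>2 k2, OF p2(2,3)] and b3 = b[of p3 \<xi>3 k3, OF p3(2,3)]
    have "asymp_eq (P k1 k2 k3) (\<lambda>n z. ((\<i> * of_real \<xi>1)^k1 * of_real (p1 (fst z $ 1)) * cis (real (Suc n) * \<xi>1 * fst z $ 1))
       * ((\<i> * of_real \<xi>2)^k2 * of_real (p2 (fst z $ 2)) * cis (real (Suc n) * \<xi>2 * fst z $ 2))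
       * ((\<i> * of_real \<xi>3)^k3 * of_real (p3 (snd z)) * cis (real (Suc n) * \<xi>3 * snd z)))"
      unfolding P_def
      by (intro asymp_eq_mult[where A="\<bar>\<xi>1\<bar>^k1 * \<bar>\<xi>2\<bar>^k2" and B="\<bar>\<xi>3\<bar>^k3"] asymp_eq_mult[where A="\<bar>\<xi>1\<bar>^k1" and B="\<bar>\<xi>2\<bar>^k2"]
         asymp_eq_compose[OF as1] asymp_eq_compose[OF as2] asymp_eq_compose[OF as3] k b1 b2 b3
         order_trans[OF norm_mult_ineq] mult_mono) auto
    then show ?thesis
      unfolding cut_def E_def by (simp add: mult_ac del: of_nat_Suc)
  qed
  \<comment> \<open>The corresponding partial derivative of the real potential, divided by
    \<open>Suc n\<close> to the total order. As \<open>v\<close> and \<open>u\<close> are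
    homogeneous of order 3, this amounts to scaling the potential by \<open>(Suc n)^(-3)\<close>;
    each further derivative costs the common factor \<open>Suc n\<close>, which does not disturb the
    cancellations in the divergence.\<close>
  define R where "R \<theta> k1 k2 k3 n z = A * Re (\<theta> * P k1 k2 k3 n z)" for \<theta> k1 k2 k3 n z
  have z0: "R \<theta> k1 k2 k3 n z = 0" if "z \<notin> box a b" for \<theta> k1 k2 k3 n z
    using that F1(3) F2(3) F3(3) unfolding mem_box_spacetime R_def P_def by auto
  have cR: "continuous_on UNIV (R \<theta> k1 k2 k3 n)" if "k1 \<le> 4" "k2 \<le> 4" "k3 \<le> 4" for \<theta> k1 k2 k3 n
    unfolding R_def P_def
    by (intro continuous_intros continuous_on_compose2[OF F1(2)] continuous_on_compose2[OF F2(2)] continuous_on_compose2[OF F3(2)] that) auto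
  have lin: "((\<lambda>s. A * Re (\<theta> * (c * f (x + s) * d))) has_real_derivative A * Re (\<theta> * (c * (of_nat (Suc n) * f') * d))) (at 0)"
    if "(f has_vector_derivative of_nat (Suc n) * f') (at x)" for f f' c d \<theta> x n
  proof -
    have "(f has_vector_derivative of_nat (Suc n) * f') (at (x + 0))" using that by simp
    moreover have "((\<lambda>s. x + s) has_vector_derivative 0 + 1) (at 0)"
      by (intro has_vector_derivative_add has_vector_derivative_const has_vector_derivative_id)
    ultimately have "((\<lambda>s. f (x + s)) has_vector_derivative of_nat (Suc n) * f') (at 0)"
      using vector_diff_chain_at[of "\<lambda>s. x + s" "0 + 1" 0 f "of_nat (Suc n) * f'"]
      by (simp add: o_def del: of_nat_Suc)
    then have "((\<lambda>s. A *\<^sub>R (\<theta> * (c * f (x + s) * d))) has_vector_derivative A *\<^sub>R (\<theta> * (c * (of_nat (Suc n) * f') * d))) (at 0)"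
      by (auto intro!: derivative_eq_intros)
    from bounded_linear.has_vector_derivative[OF bounded_linear_Re this] show ?thesis
      by (simp add: has_real_derivative_iff_has_vector_derivative del: of_nat_Suc)
  qed
  have d1: "dir_deriv (R \<theta> k1 k2 k3 n) axis_x1 (\<lambda>z. real (Suc n) * R \<theta> (Suc k1) k2 k3 n z)" if "k1 \<le> 3" for \<theta> k1 k2 k3 n
    unfolding dir_deriv_def
  proof
    fix z :: spacetime
    show "((\<lambda>s. R \<theta> k1 k2 k3 n (z + s *\<^sub>R axis_x1)) has_real_derivative real (Suc n) * R \<theta> (Suc k1) k2 k3 n z) (at 0)"
      using lin[OF F1(1)[OF that], where \<theta>=\<theta> and c=1 and d="F2 n k2 (fst z $ 2) * F3 n k3 (snd z)" and x="fst z $ 1"]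
      unfolding R_def P_def by (simp add: axis_def algebra_simps del: of_nat_Suc)
  qed
  have d2: "dir_deriv (R \<theta> k1 k2 k3 n) axis_x2 (\<lambda>z. real (Suc n) * R \<theta> k1 (Suc k2) k3 n z)" if "k2 \<le> 3" for \<theta> k1 k2 k3 n
    unfolding dir_deriv_def
  proof
    fix z :: spacetime
    show "((\<lambda>s. R \<theta> k1 k2 k3 n (z + s *\<^sub>R axis_x2)) has_real_derivative real (Suc n) * R \<theta> k1 (Suc k2) k3 n z) (at 0)"
      using lin[OF F2(1)[OF that], where \<theta>=\<theta> and c="F1 n k1 (fst z $ 1)" and d="F3 n k3 (snd z)" and x="fst z $ 2"]
      unfolding R_def P_def by (simp add: axis_def algebra_simps del: of_nat_Suc)
  qed
  have d3: "dir_deriv (R \<theta> k1 k2 k3 n) axis_t (\<lambda>z. real (Suc n) * R \<theta> k1 k2 (Suc k3) n z)" if "k3 \<le> 3" for \<theta> k1 k2 k3 n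
    unfolding dir_deriv_def
  proof
    fix z :: spacetime
    show "((\<lambda>s. R \<theta> k1 k2 k3 n (z + s *\<^sub>R axis_t)) has_real_derivative real (Suc n) * R \<theta> k1 k2 (Suc k3) n z) (at 0)"
      using lin[OF F3(1)[OF that], where \<theta>=\<theta> and c="F1 n k1 (fst z $ 1) * F2 n k2 (fst z $ 2)" and d=1 and x="snd z"]
      unfolding R_def P_def by (simp add: algebra_simps del: of_nat_Suc)
  qed
  define v where "v \<theta> n z = Complex (- (R \<theta> 2 1 0 n z + R \<theta> 0 3 0 n z)) (R \<theta> 3 0 0 n z + R \<theta> 1 2 0 n z)" for \<theta> n z
  define u where "u \<theta> n z = Complex (2 * R \<theta> 1 1 1 n z) (R \<theta> 0 2 1 n z + - R \<theta> 2 0 1 n z)" for \<theta> n z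
  have cv: "continuous_on UNIV (v \<theta> n)" and cu: "continuous_on UNIV (u \<theta> n)" for \<theta> n
    unfolding v_def u_def Complex_eq by (intro continuous_intros cR; simp)+
  have zv: "v \<theta> n z = 0" "u \<theta> n z = 0" if "z \<notin> box a b" for \<theta> n z
    using that by (auto simp: v_def u_def z0 complex_eq_iff)
  note dr = dir_deriv_add dir_deriv_uminus dir_deriv_cmult d1 d2 d3
  have sol: "solenoidal (v \<theta> n) (u \<theta> n)" for \<theta> n
  proof -
    have zs: "bounded (box a b)" by simp
    have "divfree (\<lambda>_. 0) (v \<theta> n)"
      unfolding v_def
    proof (rule divfreeI[where S="box a b"])
      show "dir_deriv (\<lambda>z. - (R \<theta> 2 1 0 n z + R \<theta> 0 3 0 n z)) axis_x1 (\<lambda>z. - (real (Suc n) * R \<theta> (Suc 2) 1 0 n z + real (Suc n) * R \<theta> (Suc 0) 3 0 n z))"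
        "dir_deriv (\<lambda>z. R \<theta> 3 0 0 n z + R \<theta> 1 2 0 n z) axis_x2 (\<lambda>z. real (Suc n) * R \<theta> 3 (Suc 0) 0 n z + real (Suc n) * R \<theta> 1 (Suc 2) 0 n z)"
        by (intro dr; simp)+
      show "dir_deriv (\<lambda>_. 0) axis_t (\<lambda>_. 0)" by (simp add: dir_deriv_def)
    qed (auto simp: z0 numeral_eq_Suc simp del: of_nat_Suc intro!: continuous_intros cR)
    moreover have "divfree (\<lambda>z. Re (v \<theta> n z)) (u \<theta> n)"
      unfolding v_def u_def complex.sel
    proof (rule divfreeI[where S="box a b"])
      show "dir_deriv (\<lambda>z. - (R \<theta> 2 1 0 n z + R \<theta> 0 3 0 n z)) axis_t (\<lambda>z. - (real (Suc n) * R \<theta> 2 1 (Suc 0) n z + real (Suc n) * R \<theta> 0 3 (Suc 0) n z))"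
        "dir_deriv (\<lambda>z. 2 * R \<theta> 1 1 1 n z) axis_x1 (\<lambda>z. 2 * (real (Suc n) * R \<theta> (Suc 1) 1 1 n z))"
        "dir_deriv (\<lambda>z. R \<theta> 0 2 1 n z + - R \<theta> 2 0 1 n z) axis_x2 (\<lambda>z. real (Suc n) * R \<theta> 0 (Suc 2) 1 n z + - (real (Suc n) * R \<theta> 2 (Suc 0) 1 n z))"
        by (intro dr; simp)+
    qed (auto simp: z0 numeral_eq_Suc simp del: of_nat_Suc intro!: continuous_intros cR)
    moreover have "divfree (\<lambda>z. Im (v \<theta> n z)) (\<lambda>z. Complex (R \<theta> 0 2 1 n z + - R \<theta> 2 0 1 n z) (- (2 * R \<theta> 1 1 1 n z)))"
      unfolding v_def complex.sel
    proof (rule divfreeI[where S="box a b"])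
      show "dir_deriv (\<lambda>z. R \<theta> 3 0 0 n z + R \<theta> 1 2 0 n z) axis_t (\<lambda>z. real (Suc n) * R \<theta> 3 0 (Suc 0) n z + real (Suc n) * R \<theta> 1 2 (Suc 0) n z)"
        "dir_deriv (\<lambda>z. - (2 * R \<theta> 1 1 1 n z)) axis_x2 (\<lambda>z. - (2 * (real (Suc n) * R \<theta> 1 (Suc 1) 1 n z)))"
        "dir_deriv (\<lambda>z. R \<theta> 0 2 1 n z + - R \<theta> 2 0 1 n z) axis_x1 (\<lambda>z. real (Suc n) * R \<theta> (Suc 0) 2 1 n z + - (real (Suc n) * R \<theta> (Suc 2) 0 1 n z))"
        by (intro dr; simp)+
    qed (auto simp: z0 numeral_eq_Suc simp del: of_nat_Suc intro!: continuous_intros cR)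
    moreover have "(\<lambda>z. - \<i> * u \<theta> n z) = (\<lambda>z. Complex (R \<theta> 0 2 1 n z + - R \<theta> 2 0 1 n z) (- (2 * R \<theta> 1 1 1 n z)))"
      by (auto simp: u_def fun_eq_iff complex_eq_iff)
    ultimately show ?thesis by (simp add: solenoidal_def)
  qed
  \<comment> \<open>The common real profile of all components: at third order the powers of
    \<open>\<i>\<close> multiply to \<open>- \<i>\<close>, so each leading coefficient is
    \<open>\<i>\<close> times a real number.\<close>
  define \<sigma> where "\<sigma> \<theta> n z = A * Re (\<theta> * (\<i> * (of_real (cut z) * E n z)))" for \<theta> n z
  have asR: "asymp_eq (R \<theta> k1 k2 k3) (\<lambda>n z. r * \<sigma> \<theta> n z)"
    if "k1 \<le> 3" "k2 \<le> 3" "k3 \<le> 3"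
      "(\<i> * of_real \<xi>1)^k1 * (\<i> * of_real \<xi>2)^k2 * (\<i> * of_real \<xi>3)^k3 = \<i> * of_real r" for \<theta> k1 k2 k3 r
  proof -
    have "asymp_eq (\<lambda>n z. A * Re (\<theta> * P k1 k2 k3 n z)) (\<lambda>n z. A * Re (\<theta> * ((\<i> * of_real r) * (of_real (cut z) * E n z))))"
      using asP[OF that(1-3)] unfolding that(4) by (intro asymp_eq_cmult asymp_eq_Re)
    moreover have "A * Re (\<theta> * ((\<i> * of_real r) * (of_real (cut z) * E n z))) = r * \<sigma> \<theta> n z" for n z
    proof -
      have "\<theta> * ((\<i> * of_real r) * (of_real (cut z) * E n z)) = of_real r * (\<theta> * (\<i> * (of_real (cut z) * E n z)))"
        by (simp add: mult_ac)
      moreover have "Re (of_real r * x) = r * Re x" for x by simp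
      ultimately have "Re (\<theta> * ((\<i> * of_real r) * (of_real (cut z) * E n z))) = r * Re (\<theta> * (\<i> * (of_real (cut z) * E n z)))"
        by (simp only:)
      then show ?thesis unfolding \<sigma>_def by (simp only: mult.left_commute)
    qed
    ultimately show ?thesis unfolding R_def by simp
  qed
  \<comment> \<open>The second bound keeps the error energy, \<open>2 * \<eta>'^2\<close> on the
    box, well below the energy of the leading terms.\<close>
  define \<eta>' where "\<eta>' = min \<eta> (A / 2^13)"
  have \<eta>': "\<eta>' > 0" "\<eta>' \<le> \<eta>" "\<eta>' \<le> A / 2^13" using \<eta> A by (auto simp: \<eta>'_def)
  have near: "\<forall>\<^sub>F n in sequentially. \<forall>z. norm (v \<theta> n z - \<sigma> \<theta> n z *\<^sub>R e) \<le> \<eta>' \<and>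
      norm (u \<theta> n z - \<sigma> \<theta> n z *\<^sub>R (\<i> * of_real \<tau> * e\<^sup>2)) \<le> \<eta>'" for \<theta>
  proof -
    have \<delta>: "\<eta>' / 4 > 0" using \<eta>' by simp
    have "\<forall>\<^sub>F n in sequentially. \<forall>z. norm (R \<theta> 2 1 0 n z - (- (\<xi>1\<^sup>2 * \<xi>2)) * \<sigma> \<theta> n z) \<le> \<eta>' / 4"
      "\<forall>\<^sub>F n in sequentially. \<forall>z. norm (R \<theta> 0 3 0 n z - (- (\<xi>2\<^sup>2 * \<xi>2)) * \<sigma> \<theta> n z) \<le> \<eta>' / 4"
      "\<forall>\<^sub>F n in sequentially. \<forall>z. norm (R \<theta> 3 0 0 n z - (- (\<xi>1\<^sup>2 * \<xi>1)) * \<sigma> \<theta> n z) \<le> \<eta>' / 4"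
      "\<forall>\<^sub>F n in sequentially. \<forall>z. norm (R \<theta> 1 2 0 n z - (- (\<xi>2\<^sup>2 * \<xi>1)) * \<sigma> \<theta> n z) \<le> \<eta>' / 4"
      "\<forall>\<^sub>F n in sequentially. \<forall>z. norm (R \<theta> 1 1 1 n z - (- (\<xi>1 * \<xi>2 * \<xi>3)) * \<sigma> \<theta> n z) \<le> \<eta>' / 4"
      "\<forall>\<^sub>F n in sequentially. \<forall>z. norm (R \<theta> 0 2 1 n z - (- (\<xi>2\<^sup>2 * \<xi>3)) * \<sigma> \<theta> n z) \<le> \<eta>' / 4"
      "\<forall>\<^sub>F n in sequentially. \<forall>z. norm (R \<theta> 2 0 1 n z - (- (\<xi>1\<^sup>2 * \<xi>3)) * \<sigma> \<theta> n z) \<le> \<eta>' / 4"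
      by (rule asymp_eq_D[OF asR \<delta>]; simp add: complex_eq_iff power2_eq_square power3_eq_cube mult_ac)+
    then show ?thesis
    proof eventually_elim
      case (elim n)
      show ?case
      proof (intro allI conjI)
        fix z
        let ?s = "\<sigma> \<theta> n z"
        note el = elim(1)[rule_format, of z] elim(2)[rule_format, of z] elim(3)[rule_format, of z] elim(4)[rule_format, of z]
           elim(5)[rule_format, of z] elim(6)[rule_format, of z] elim(7)[rule_format, of z]
        have h2: "\<bar>2 * x\<bar> \<le> \<eta>' / 2" if "norm x \<le> \<eta>' / 4" for x :: real using that by simp
        have hd: "\<bar>x - y\<bar> \<le> \<eta>' / 2" if "norm x \<le> \<eta>' / 4" "norm y \<le> \<eta>' / 4" for x y :: real using that unfolding real_norm_def by linarith
        have i: "(\<xi>1\<^sup>2 * \<xi>2) * ?s + (\<xi>2\<^sup>2 * \<xi>2) * ?s = Re e * ?s" "(\<xi>1\<^sup>2 * \<xi>1) * ?s + (\<xi>2\<^sup>2 * \<xi>1) * ?s = - Im e * ?s"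
          using n1 unfolding \<xi>1_def[symmetric] \<xi>2_def[symmetric]
          by (simp_all add: distrib_right[symmetric])
        have "v \<theta> n z - ?s *\<^sub>R e = Complex (- (R \<theta> 2 1 0 n z + R \<theta> 0 3 0 n z) - ?s * Re e) (R \<theta> 3 0 0 n z + R \<theta> 1 2 0 n z - ?s * Im e)"
          by (simp add: v_def complex_eq_iff)
        also have "norm \<dots> \<le> 2 * (\<eta>' / 2)"
          by (rule norm_Complex_le) (use i el in \<open>simp only: real_norm_def; argo\<close>)+
        finally show "norm (v \<theta> n z - ?s *\<^sub>R e) \<le> \<eta>'" by simp
        have "u \<theta> n z - ?s *\<^sub>R (\<i> * of_real \<tau> * e\<^sup>2) =
          Complex (2 * R \<theta> 1 1 1 n z - ?s * (- 2 * \<xi>1 * \<xi>2 * \<xi>3)) (R \<theta> 0 2 1 n z + - R \<theta> 2 0 1 n z - ?s * (- \<xi>3 * (\<xi>2\<^sup>2 - \<xi>1\<^sup>2)))"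
          by (simp add: u_def complex_eq_iff \<xi>1_def \<xi>2_def \<xi>3_def power2_eq_square algebra_simps)
        also have "norm \<dots> \<le> 2 * (\<eta>' / 2)"
        proof (rule norm_Complex_le)
          have "2 * R \<theta> 1 1 1 n z - ?s * (- 2 * \<xi>1 * \<xi>2 * \<xi>3) = 2 * (R \<theta> 1 1 1 n z - (- (\<xi>1 * \<xi>2 * \<xi>3)) * \<sigma> \<theta> n z)"
            by (simp add: algebra_simps)
          then show "\<bar>2 * R \<theta> 1 1 1 n z - ?s * (- 2 * \<xi>1 * \<xi>2 * \<xi>3)\<bar> \<le> \<eta>' / 2"
            using h2[OF el(5)] by (simp only:)
          have "R \<theta> 0 2 1 n z + - R \<theta> 2 0 1 n z - ?s * (- \<xi>3 * (\<xi>2\<^sup>2 - \<xi>1\<^sup>2)) =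
            (R \<theta> 0 2 1 n z - (- (\<xi>2\<^sup>2 * \<xi>3)) * \<sigma> \<theta> n z) - (R \<theta> 2 0 1 n z - (- (\<xi>1\<^sup>2 * \<xi>3)) * \<sigma> \<theta> n z)"
            by (simp add: algebra_simps)
          then show "\<bar>R \<theta> 0 2 1 n z + - R \<theta> 2 0 1 n z - ?s * (- \<xi>3 * (\<xi>2\<^sup>2 - \<xi>1\<^sup>2))\<bar> \<le> \<eta>' / 2"
            using hd[OF el(6,7)] by (simp only:)
        qed
        finally show "norm (u \<theta> n z - ?s *\<^sub>R (\<i> * of_real \<tau> * e\<^sup>2)) \<le> \<eta>'" by simp
      qed
    qed
  qed
  \<comment> \<open>The phases \<open>1\<close> and \<open>- \<i>\<close> give the two waves in
    quadrature; one \<open>n\<close> serves both.\<close>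
  obtain n where n: "\<And>z. norm (v 1 n z - \<sigma> 1 n z *\<^sub>R e) \<le> \<eta>' \<and> norm (u 1 n z - \<sigma> 1 n z *\<^sub>R (\<i> * of_real \<tau> * e\<^sup>2)) \<le> \<eta>'"
    "\<And>z. norm (v (- \<i>) n z - \<sigma> (- \<i>) n z *\<^sub>R e) \<le> \<eta>' \<and> norm (u (- \<i>) n z - \<sigma> (- \<i>) n z *\<^sub>R (\<i> * of_real \<tau> * e\<^sup>2)) \<le> \<eta>'"
    using eventually_happens'[OF _ eventually_conj[OF near[of 1] near[of "- \<i>"]]] by auto
  have \<sigma>A: "\<bar>\<sigma> \<theta> n z\<bar> \<le> A" if "norm \<theta> = 1" for \<theta> z
  proof -
    have "\<bar>Re (\<theta> * (\<i> * (of_real (cut z) * E n z)))\<bar> \<le> norm (\<theta> * (\<i> * (of_real (cut z) * E n z)))" by (rule abs_Re_le_cmod)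
    also have "\<dots> \<le> 1" using cut01[of z] that nE by (simp add: norm_mult)
    finally show ?thesis using A by (simp add: \<sigma>_def abs_mult)
  qed
  let ?M = "cbox (a + (b - a) /\<^sub>R 4) (b - (b - a) /\<^sub>R 4)"
  have cutM: "1 / 2^9 \<le> cut z" if "z \<in> ?M" for z
  proof -
    have "p1 (fst z $ 1) \<ge> 1/8" "p2 (fst z $ 2) \<ge> 1/8" "p3 (snd z) \<ge> 1/8"
      using that p1(5)[of "fst z $ 1"] p2(5)[of "fst z $ 2"] p3(5)[of "snd z"] unfolding mem_cbox_spacetime by auto
    then have "1/8 * (1/8) * (1/8) \<le> cut z" unfolding cut_def by (intro mult_mono) auto
    then show ?thesis by simp
  qed
  have MB: "z \<in> box a b" if "z \<in> ?M" for z
    using cutM[OF that] p1(4) p2(4) p3(4) unfolding cut_def mem_box_spacetime by fastforce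
  \<comment> \<open>On the middle box the cutoff is at least \<open>8^(-3)\<close>, so the squares
    of the two profiles add up to at least \<open>A^2 / 2^18\<close>; passing from the profile to
    \<open>v\<close> halves this and loses \<open>\<eta>'^2\<close> for each wave.\<close>
  have pw: "indicator ?M z * (A\<^sup>2 / 2^19) - indicator (box a b) z * (2 * \<eta>'\<^sup>2) \<le> (norm (v 1 n z))\<^sup>2 + (norm (v (- \<i>) n z))\<^sup>2" for z
  proof -
    have h: "(\<sigma> \<theta> n z)\<^sup>2 / 2 - \<eta>'\<^sup>2 \<le> (norm (v \<theta> n z))\<^sup>2" if "norm (v \<theta> n z - \<sigma> \<theta> n z *\<^sub>R e) \<le> \<eta>'" for \<theta>
    proof -
      have "norm (\<sigma> \<theta> n z *\<^sub>R e) \<le> norm (v \<theta> n z) + \<eta>'"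
        using that norm_triangle_sub[of "\<sigma> \<theta> n z *\<^sub>R e" "v \<theta> n z"] by (simp add: norm_minus_commute)
      then have "\<bar>\<sigma> \<theta> n z\<bar>\<^sup>2 \<le> (norm (v \<theta> n z) + \<eta>')\<^sup>2" using e by (intro power_mono) auto
      also have "\<dots> \<le> 2 * (norm (v \<theta> n z))\<^sup>2 + 2 * \<eta>'\<^sup>2"
        using sum_squares_bound[of "norm (v \<theta> n z)" \<eta>'] by (simp add: power2_sum)
      finally show ?thesis by simp
    qed
    have "(\<sigma> 1 n z)\<^sup>2 + (\<sigma> (- \<i>) n z)\<^sup>2 = A\<^sup>2 * (cut z)\<^sup>2"
    proof -
      have "(\<sigma> 1 n z)\<^sup>2 + (\<sigma> (- \<i>) n z)\<^sup>2 = A\<^sup>2 * (norm (\<i> * (of_real (cut z) * E n z)))\<^sup>2"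
        unfolding \<sigma>_def Re_mult_minus_ii[symmetric] by (simp only: power_mult_distrib distrib_left mult_1)
      also have "norm (\<i> * (of_real (cut z) * E n z)) = cut z" using cut01[of z] nE by (simp add: norm_mult)
      finally show ?thesis .
    qed
    moreover have "A\<^sup>2 * (cut z)\<^sup>2 \<ge> A\<^sup>2 * (1 / 2^9)\<^sup>2" if "z \<in> ?M"
      using cutM[OF that] by (intro mult_left_mono power_mono) auto
    moreover have "- (2 * \<eta>'\<^sup>2) \<le> (norm (v 1 n z))\<^sup>2 + (norm (v (- \<i>) n z))\<^sup>2"
      using zero_le_power2[of \<eta>'] zero_le_power2[of "norm (v 1 n z)"] zero_le_power2[of "norm (v (- \<i>) n z)"] by linarith
    ultimately show ?thesis
      using h[of 1] h[of "- \<i>"] n[of z] MB[of z] zv[of z]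
      by (cases "z \<in> ?M"; cases "z \<in> box a b") (simp_all add: power_divide)
  qed
  have iv: "integrable lborel (\<lambda>z. (norm (v \<theta> n z))\<^sup>2)" for \<theta>
    by (rule continuous_vanishing_integrable[where S="box a b"]) (auto intro!: continuous_intros cv simp: zv)
  have iM: "integrable lborel (\<lambda>z. indicator ?M z * (A\<^sup>2 / 2^19))" "integrable lborel (\<lambda>z. indicator (box a b) z * (2 * \<eta>'\<^sup>2))"
    by (rule integrable_indicator_bounded; simp)+
  have "measure lborel ?M * (A\<^sup>2 / 2^19) - measure lborel (box a b) * (2 * \<eta>'\<^sup>2) =
     (\<integral>z. indicator ?M z * (A\<^sup>2 / 2^19) - indicator (box a b) z * (2 * \<eta>'\<^sup>2) \<partial>lborel)"
    by (subst Bochner_Integration.integral_diff[OF iM]) simp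
  also have "\<dots> \<le> (\<integral>z. (norm (v 1 n z))\<^sup>2 + (norm (v (- \<i>) n z))\<^sup>2 \<partial>lborel)"
    by (intro integral_mono Bochner_Integration.integrable_diff Bochner_Integration.integrable_add iM iv pw)
  also have "\<dots> = (\<integral>z. (norm (v 1 n z))\<^sup>2 \<partial>lborel) + (\<integral>z. (norm (v (- \<i>) n z))\<^sup>2 \<partial>lborel)"
    by (rule Bochner_Integration.integral_add[OF iv iv])
  finally have tot: "measure lborel ?M * (A\<^sup>2 / 2^19) - measure lborel (box a b) * (2 * \<eta>'\<^sup>2) \<le>
    (\<integral>z. (norm (v 1 n z))\<^sup>2 \<partial>lborel) + (\<integral>z. (norm (v (- \<i>) n z))\<^sup>2 \<partial>lborel)" .
  have "\<eta>'\<^sup>2 \<le> (A / 2^13)\<^sup>2" using \<eta>' by (intro power_mono) auto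
  then have "measure lborel (box a b) * (2 * \<eta>'\<^sup>2) \<le> measure lborel (box a b) * (2 * (A / 2^13)\<^sup>2)"
    by (intro mult_left_mono) auto
  moreover have "measure lborel ?M = measure lborel (box a b) / 8"
    using measure_middle_box[OF ne] by simp
  \<comment> \<open>In units of \<open>A^2 / 2^26\<close> times the volume of the box: the middle
    box, an eighth of the volume, contributes 16, the error takes away 2, and 8 are
    required.\<close>
  moreover have "measure lborel (box a b) / 8 * (A\<^sup>2 / 2^19) - measure lborel (box a b) * (2 * (A / 2^13)\<^sup>2) \<ge> 2 * (A\<^sup>2 / 2^24 * measure lborel (box a b))"
  proof -
    have "measure lborel (box a b) / 8 * (A\<^sup>2 / 2^19) - measure lborel (box a b) * (2 * (A / 2^13)\<^sup>2) - 2 * (A\<^sup>2 / 2^24 * measure lborel (box a b))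
      = (1/2^22 - 2/2^26 - 2/2^24) * (measure lborel (box a b) * A\<^sup>2)"
      by (simp add: power_divide field_simps)
    moreover have "(1/2^22 - 2/2^26 - 2/2^24) * (measure lborel (box a b) * A\<^sup>2) \<ge> 0"
      by (intro mult_nonneg_nonneg) auto
    ultimately show ?thesis by linarith
  qed
  ultimately have "2 * (A\<^sup>2 / 2^24 * measure lborel (box a b)) \<le> (\<integral>z. (norm (v 1 n z))\<^sup>2 \<partial>lborel) + (\<integral>z. (norm (v (- \<i>) n z))\<^sup>2 \<partial>lborel)"
    using tot by (simp only:)
  then consider "A\<^sup>2 / 2^24 * measure lborel (box a b) \<le> (\<integral>z. (norm (v 1 n z))\<^sup>2 \<partial>lborel)"
    | "A\<^sup>2 / 2^24 * measure lborel (box a b) \<le> (\<integral>z. (norm (v (- \<i>) n z))\<^sup>2 \<partial>lborel)" by linarith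
  then show ?thesis
  proof cases
    case 1
    have "norm (v 1 n z - \<sigma> 1 n z *\<^sub>R e) \<le> \<eta>" "norm (u 1 n z - \<sigma> 1 n z *\<^sub>R (\<i> * of_real \<tau> * e\<^sup>2)) \<le> \<eta>" for z
      using n(1)[of z] \<eta>'(2) by linarith+
    note near = this
    show ?thesis
      by (rule that[of "v 1 n" "u 1 n" "\<sigma> 1 n"]) (use cv cu zv sol \<sigma>A[of 1] near 1 in \<open>simp_all\<close>)
  next
    case 2
    have "norm (v (- \<i>) n z - \<sigma> (- \<i>) n z *\<^sub>R e) \<le> \<eta>" "norm (u (- \<i>) n z - \<sigma> (- \<i>) n z *\<^sub>R (\<i> * of_real \<tau> * e\<^sup>2)) \<le> \<eta>" for z
      using n(2)[of z] \<eta>'(2) by linarith+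
    note near = this
    show ?thesis
      by (rule that[of "v (- \<i>) n" "u (- \<i>) n" "\<sigma> (- \<i>) n"]) (use cv cu zv sol \<sigma>A[of "- \<i>"] near 2 in \<open>simp_all\<close>)
  qed
qed

section \<open>Perturbation of strict subsolutions\<close>

text \<open>Equivalent to \<open>V \<otimes> V - u < (C/2) Id\<close>: the eigenvalues of the left-hand side are
  \<open>(|V|\<^sup>2 \<plusminus> |V\<^sup>2 - 2u|) / 2\<close>.\<close>

definition subsol :: "real \<Rightarrow> complex \<Rightarrow> complex \<Rightarrow> bool" where
  "subsol C V u \<longleftrightarrow> (norm V)\<^sup>2 + norm (V\<^sup>2 - 2 * u) < C"

text \<open>With \<open>r = V\<^sup>2 - 2u\<close>, the direction is chosen such that \<open>r = -|r| e\<^sup>2\<close> and \<open>\<tau> = Im (V cnj e)\<close>. Then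
  moving by \<open>s\<close> turns \<open>r\<close> into \<open>(g - |r|) e\<^sup>2\<close> and adds \<open>g\<close> to \<open>|V|\<^sup>2\<close>, where \<open>g = 2 s Re (V cnj e) + s\<^sup>2\<close>.\<close>

lemma subsol_segment:
  assumes "subsol C V u"
  obtains e \<tau> A where "norm e = 1" "A = (C - (norm V)\<^sup>2) / (8 * sqrt C)" "A > 0" "C > 0"
    "\<And>s. \<bar>s\<bar> \<le> A \<Longrightarrow> subsol C (V + s *\<^sub>R e) (u + s *\<^sub>R (\<i> * of_real \<tau> * e\<^sup>2))"
proof -
  define r where "r = V\<^sup>2 - 2 * u"
  define D where "D = C - (norm V)\<^sup>2"
  have rD: "norm r < D" using assms by (simp add: subsol_def r_def D_def)
  then have D: "D > 0" using norm_ge_zero[of r] by linarith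
  have C: "C > 0" "D \<le> C" using D zero_le_power2[of "norm V"] unfolding D_def by linarith+
  \<comment> \<open>A square root of \<open>- r / |r|\<close>; for \<open>r = 0\<close> any unit
    vector would do.\<close>
  define e where "e = (if r = 0 then 1 else csqrt (- r / norm r))"
  have e2: "r = - (of_real (norm r) * e\<^sup>2)" by (auto simp: e_def)
  have "norm (e\<^sup>2) = 1" by (auto simp: e_def norm_divide)
  then have e1: "norm e = 1"
    unfolding norm_power by (metis norm_ge_zero power2_eq_1_iff not_one_le_zero neg_0_le_iff_le order_trans zero_le_one)
  define q \<tau> where "q = Re (V * cnj e)" and "\<tau> = Im (V * cnj e)"
  \<comment> \<open>This length gives \<open>s * q \<le> D / 8\<close> and
    \<open>s^2 \<le> D / 64\<close>, hence \<open>g < D / 2\<close>.\<close>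
  define A where "A = D / (8 * sqrt C)"
  have A: "A > 0" using D C by (simp add: A_def)
  have ee: "cnj e * e = 1" using e1 by (metis complex_norm_square mult.commute of_real_1 one_power2)
  have Ve: "V = Complex q \<tau> * e"
  proof -
    have "Complex q \<tau> = V * cnj e" unfolding q_def \<tau>_def by (rule complex_surj)
    then show ?thesis using ee by (simp add: mult.assoc)
  qed
  have VC: "norm V \<le> sqrt C" using D by (intro real_le_rsqrt) (simp add: D_def)
  have qV: "\<bar>q\<bar> \<le> norm V" using abs_Re_le_cmod[of "V * cnj e"] e1 by (simp add: q_def norm_mult)
  show ?thesis
  proof (rule that[OF e1 _ A C(1)])
    show "A = (C - (norm V)\<^sup>2) / (8 * sqrt C)" by (simp add: A_def D_def)
    fix s :: real assume s: "\<bar>s\<bar> \<le> A"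
    define g where "g = 2 * s * q + s\<^sup>2"
    have "s * q \<le> A * sqrt C"
    proof -
      have "s * q \<le> \<bar>s\<bar> * \<bar>q\<bar>" by (metis abs_ge_self abs_mult)
      also have "\<dots> \<le> A * sqrt C" using s qV VC by (intro mult_mono) auto
      finally show ?thesis .
    qed
    also have "A * sqrt C = D / 8" using C by (simp add: A_def)
    finally have 1: "s * q \<le> D / 8" .
    have "s\<^sup>2 \<le> A\<^sup>2" using s by (metis abs_le_square_iff abs_of_pos A)
    also have "A\<^sup>2 = D * D / (64 * C)" using C by (simp add: A_def power_divide power_mult_distrib power2_eq_square[of D])
    also have "\<dots> \<le> D * C / (64 * C)" using C D by (intro divide_right_mono mult_left_mono) auto
    also have "\<dots> = D / 64" using C by simp
    finally have g: "g < D / 2" using 1 D by (simp add: g_def)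
    have n1: "(norm (V + s *\<^sub>R e))\<^sup>2 = (norm V)\<^sup>2 + g"
    proof -
      have "(Re e)\<^sup>2 + (Im e)\<^sup>2 = 1" using e1 by (simp add: cmod_def)
      moreover have "q = Re V * Re e + Im V * Im e" by (simp add: q_def)
      ultimately show ?thesis
        unfolding cmod_power2 g_def by (simp only: plus_complex.sel scaleR_complex.sel) algebra
    qed
    have "(V + s *\<^sub>R e)\<^sup>2 - 2 * (u + s *\<^sub>R (\<i> * of_real \<tau> * e\<^sup>2)) = r + of_real s * (2 * V * e - 2 * (\<i> * of_real \<tau>) * e\<^sup>2) + (of_real s)\<^sup>2 * e\<^sup>2"
      by (simp add: r_def scaleR_conv_of_real power2_eq_square algebra_simps)
    also have "2 * V * e - 2 * (\<i> * of_real \<tau>) * e\<^sup>2 = 2 * of_real q * e\<^sup>2"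
      by (subst Ve) (simp add: Complex_eq power2_eq_square algebra_simps)
    also have "r + of_real s * (2 * of_real q * e\<^sup>2) + (of_real s)\<^sup>2 * e\<^sup>2 = of_real (g - norm r) * e\<^sup>2"
      by (subst e2) (simp add: g_def algebra_simps)
    finally have "norm ((V + s *\<^sub>R e)\<^sup>2 - 2 * (u + s *\<^sub>R (\<i> * of_real \<tau> * e\<^sup>2))) = \<bar>g - norm r\<bar>"
      using \<open>norm (e\<^sup>2) = 1\<close> by (simp only: norm_mult norm_of_real mult_1_right)
    \<comment> \<open>As long as \<open>g \<le> |r|\<close> the sum keeps its initial value
      \<open>|V|^2 + |r|\<close>; beyond that it equals \<open>|V|^2 + 2 * g - |r|\<close>, which is
      controlled by \<open>2 * g < D\<close>.\<close>
    moreover have "(norm V)\<^sup>2 + g + \<bar>g - norm r\<bar> < C"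
    proof -
      have "x + y + \<bar>y - w\<bar> < C" if "2 * y < C - x" "w < C - x" "0 \<le> w" for x y w :: real
        using that by linarith
      then show ?thesis using g rD norm_ge_zero[of r] by (simp add: D_def)
    qed
    ultimately show "subsol C (V + s *\<^sub>R e) (u + s *\<^sub>R (\<i> * of_real \<tau> * e\<^sup>2))"
      unfolding subsol_def n1 by (simp only:)
  qed
qed

lemma open_subsol: "open {(V, u). subsol C V u}"
proof -
  have "{(V, u). subsol C V u} = {p. (norm (fst p))\<^sup>2 + norm ((fst p)\<^sup>2 - 2 * snd p) < C}"
    by (auto simp: subsol_def)
  also have "open \<dots>" by (intro open_Collect_less continuous_intros)
  finally show ?thesis .
qed

section \<open>Superposition and mean values of solenoidal fields\<close>

lemma divfree_add:
  assumes "divfree q w" "divfree q' w'"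
    and c: "continuous_on UNIV q" "continuous_on UNIV w" "continuous_on UNIV q'" "continuous_on UNIV w'"
    and S: "bounded S" "\<And>z. z \<notin> S \<Longrightarrow> q z = 0 \<and> w z = 0 \<and> q' z = 0 \<and> w' z = 0"
  shows "divfree (\<lambda>z. q z + q' z) (\<lambda>z. w z + w' z)"
  unfolding divfree_def
proof (intro allI impI)
  fix \<psi> :: "spacetime \<Rightarrow> real" and G assume C: "C1_grad \<psi> G"
  have cG: "continuous_on UNIV G" using C by (simp add: C1_grad_def)
  have i: "integrable lborel (\<lambda>z. w z \<bullet> space_part (G z) + q z * snd (G z))" "integrable lborel (\<lambda>z. w' z \<bullet> space_part (G z) + q' z * snd (G z))"
    by (rule continuous_vanishing_integrable[OF _ S(1)]; use c cG S(2) in \<open>auto intro!: continuous_intros\<close>)+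
  have "(\<integral>z. (w z + w' z) \<bullet> space_part (G z) + (q z + q' z) * snd (G z) \<partial>lborel) =
     (\<integral>z. (w z \<bullet> space_part (G z) + q z * snd (G z)) + (w' z \<bullet> space_part (G z) + q' z * snd (G z)) \<partial>lborel)"
    by (intro Bochner_Integration.integral_cong) (auto simp: inner_add_left algebra_simps)
  also have "\<dots> = 0" using assms(1,2) C by (subst Bochner_Integration.integral_add[OF i]) (auto simp: divfree_def)
  finally show "(\<integral>z. (w z + w' z) \<bullet> space_part (G z) + (q z + q' z) * snd (G z) \<partial>lborel) = 0" .
qed

lemma solenoidal_add:
  assumes "solenoidal v u" "solenoidal v' u'"
    and c: "continuous_on UNIV v" "continuous_on UNIV u" "continuous_on UNIV v'" "continuous_on UNIV u'"
    and S: "bounded S" "\<And>z. z \<notin> S \<Longrightarrow> v z = 0 \<and> u z = 0 \<and> v' z = 0 \<and> u' z = 0"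
  shows "solenoidal (\<lambda>z. v z + v' z) (\<lambda>z. u z + u' z)"
proof -
  have "divfree (\<lambda>z. 0 + 0) (\<lambda>z. v z + v' z)"
    by (rule divfree_add[OF _ _ _ _ _ _ S(1)]; use assms in \<open>auto simp: solenoidal_def intro!: continuous_intros\<close>)
  moreover have "divfree (\<lambda>z. Re (v z) + Re (v' z)) (\<lambda>z. u z + u' z)"
    by (rule divfree_add[OF _ _ _ _ _ _ S(1)]; use assms in \<open>auto simp: solenoidal_def intro!: continuous_intros\<close>)
  moreover have "divfree (\<lambda>z. Im (v z) + Im (v' z)) (\<lambda>z. - \<i> * u z + - \<i> * u' z)"
    by (rule divfree_add[OF _ _ _ _ _ _ S(1)]; use assms in \<open>auto simp: solenoidal_def intro!: continuous_intros\<close>)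
  ultimately show ?thesis by (simp add: solenoidal_def algebra_simps)
qed

lemma solenoidal_zero: "solenoidal (\<lambda>_. 0) (\<lambda>_. 0)"
  by (simp add: solenoidal_def divfree_def)

lemma solenoidal_sum:
  assumes "finite D" "\<And>K. K \<in> D \<Longrightarrow> solenoidal (v K) (u K) \<and> continuous_on UNIV (v K) \<and> continuous_on UNIV (u K)"
    and S: "bounded S" "\<And>K z. K \<in> D \<Longrightarrow> z \<notin> S \<Longrightarrow> v K z = 0 \<and> u K z = 0"
  shows "solenoidal (\<lambda>z. \<Sum>K\<in>D. v K z) (\<lambda>z. \<Sum>K\<in>D. u K z)"
  using assms(1,2,4)
proof (induction D)
  case empty
  then show ?case by (simp add: solenoidal_zero)
next
  case (insert K D)
  have "solenoidal (\<lambda>z. v K z + (\<Sum>K\<in>D. v K z)) (\<lambda>z. u K z + (\<Sum>K\<in>D. u K z))"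
    by (rule solenoidal_add[OF _ _ _ _ _ _ S(1)]; use insert in \<open>auto intro!: continuous_intros sum.neutral\<close>)
  then show ?case using insert by simp
qed

text \<open>A linear test function has constant gradient. The vanishing mean makes the pairing of a
  localized field with any continuous function small, as that function is nearly constant on a small
  box.\<close>

lemma solenoidal_integral_inner_const:
  assumes "solenoidal v u"
  shows "(\<integral>z. v z \<bullet> c \<partial>lborel) = 0"
proof -
  define G :: spacetime where "G = (vector [Re c, Im c], 0)"
  have "C1_grad (\<lambda>z. G \<bullet> z) (\<lambda>_. G)"
    by (auto simp: C1_grad_def intro!: derivative_eq_intros)
  with assms have "(\<integral>z. v z \<bullet> space_part G + 0 * snd G \<partial>lborel) = 0"
    unfolding solenoidal_def divfree_def by blast
  then show ?thesis by (simp add: space_part_def G_def)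
qed

text \<open>The constant background \<open>(V0, u0)\<close> is split off so that the fluctuation
  alone carries the support condition and the linear equations.\<close>

definition subsolution :: "real \<Rightarrow> complex \<Rightarrow> complex \<Rightarrow> spacetime set \<Rightarrow> (spacetime \<Rightarrow> complex) \<Rightarrow> (spacetime \<Rightarrow> complex) \<Rightarrow> bool" where
  "subsolution C V0 u0 Q v u \<longleftrightarrow> continuous_on UNIV v \<and> continuous_on UNIV u \<and>
     (\<forall>z. z \<notin> Q \<longrightarrow> v z = 0 \<and> u z = 0) \<and> solenoidal v u \<and> (\<forall>z. subsol C (V0 + v z) (u0 + u z))"

lemma measure_lborel_cbox_box: "measure lborel (cbox a b) = measure lborel (box a (b::'a::euclidean_space))"
  by (simp add: measure_lborel_cbox_eq measure_lborel_box_eq)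

text \<open>The segment from \<open>subsol_segment\<close> at \<open>x\<close> is compact in an open
  set, so a \<open>\<rho>\<close>-neighbourhood of it still consists of strict subsolutions. Near
  \<open>x\<close> the state moves by less than \<open>\<rho> / 4\<close> in each component, and the
  building block deviates from the segment by at most \<open>\<rho> / 4\<close> in each, so the sum
  stays in that neighbourhood. The radius \<open>\<delta>\<close> depends on \<open>x\<close> but
  not on the box \<open>K\<close>.\<close>

lemma local_perturbation:
  fixes x :: spacetime
  assumes cv: "continuous_on UNIV V" and cu: "continuous_on UNIV u" and sub: "\<And>z. subsol C (V z) (u z)"
    and G: "finite G" "\<And>g. g \<in> G \<Longrightarrow> continuous_on UNIV g" and \<eta>: "\<eta> > 0"
  obtains \<delta> where "\<delta> > 0" "\<And>K c d. K = cbox c d \<Longrightarrow> K \<subseteq> ball x \<delta> \<Longrightarrow>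
    \<exists>v' u'. continuous_on UNIV v' \<and> continuous_on UNIV u' \<and> (\<forall>z. z \<notin> interior K \<longrightarrow> v' z = 0 \<and> u' z = 0) \<and>
      solenoidal v' u' \<and> (\<forall>z\<in>K. subsol C (V z + v' z) (u z + u' z)) \<and>
      (\<forall>g\<in>G. \<bar>\<integral>z. v' z \<bullet> g z \<partial>lborel\<bar> \<le> \<eta> * measure lborel K) \<and>
      (\<integral>z. indicator K z * (C - (norm (V z))\<^sup>2)\<^sup>2 \<partial>lborel) / (2^32 * C) \<le> (\<integral>z. (norm (v' z))\<^sup>2 \<partial>lborel)"
proof -
  obtain e \<tau> A where e: "norm e = 1" and A: "A = (C - (norm (V x))\<^sup>2) / (8 * sqrt C)" "A > 0" and C: "C > 0"
    and seg: "\<And>s. \<bar>s\<bar> \<le> A \<Longrightarrow> subsol C (V x + s *\<^sub>R e) (u x + s *\<^sub>R (\<i> * of_real \<tau> * e\<^sup>2))"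
    using subsol_segment[OF sub[of x]] by metis
  define D where "D = C - (norm (V x))\<^sup>2"
  have AD: "A\<^sup>2 = D\<^sup>2 / (64 * C)" using C by (simp add: A D_def power_divide power_mult_distrib)
  have D: "D > 0" using A C by (simp add: D_def zero_less_divide_iff)
  let ?seg = "(\<lambda>s. (V x + s *\<^sub>R e, u x + s *\<^sub>R (\<i> * of_real \<tau> * e\<^sup>2))) ` {-A..A}"
  have "compact ?seg" by (intro compact_continuous_image continuous_intros) auto
  moreover have "?seg \<subseteq> {(V, u). subsol C V u}" using seg by auto
  ultimately obtain \<rho> where \<rho>: "\<rho> > 0" "(\<Union>p\<in>?seg. ball p \<rho>) \<subseteq> {(V, u). subsol C V u}"
    by (rule compact_subset_open_imp_ball_epsilon_subset[OF _ open_subsol])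
  \<comment> \<open>Chosen against the bound \<open>A + \<rho>\<close> for the perturbation, so that
    the pairing with \<open>g - g x\<close> is at most \<open>\<eta>\<close> pointwise.\<close>
  define \<kappa> where "\<kappa> = \<eta> / (A + \<rho>)"
  have \<kappa>: "\<kappa> > 0" using \<eta> A(2) \<rho>(1) by (simp add: \<kappa>_def)
  have iso: "isCont V x" "isCont u x" using cv cu continuous_on_eq_continuous_at[OF open_UNIV] by blast+
  have ev_dist: "\<forall>\<^sub>F y in nhds x. dist (f y) (f x) < r" if "isCont f x" "r > 0" for f :: "spacetime \<Rightarrow> complex" and r
    using that by (intro tendstoD) (simp_all add: isCont_def tendsto_at_iff_tendsto_nhds)
  have "\<forall>\<^sub>F y in nhds x. dist (V y) (V x) < \<rho> / 4 \<and> dist (u y) (u x) < \<rho> / 4 \<and> (\<forall>g\<in>G. dist (g y) (g x) < \<kappa>) \<and> C - (norm (V y))\<^sup>2 < 2 * D"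
  proof (intro eventually_conj eventually_ball_finite G(1) ballI ev_dist iso)
    show "isCont g x" if "g \<in> G" for g using G(2)[OF that] continuous_on_eq_continuous_at[OF open_UNIV] by blast
    have "isCont (\<lambda>y. C - (norm (V y))\<^sup>2) x" using iso by (intro continuous_intros)
    then have "((\<lambda>y. C - (norm (V y))\<^sup>2) \<longlongrightarrow> D) (nhds x)"
      using tendsto_at_iff_tendsto_nhds[of "\<lambda>y. C - (norm (V y))\<^sup>2" x] by (simp only: isCont_def D_def)
    then show "\<forall>\<^sub>F y in nhds x. C - (norm (V y))\<^sup>2 < 2 * D"
      by (rule order_tendstoD(2)) (use D in simp)
  qed (use \<rho> \<kappa> in auto)
  then obtain \<delta> where \<delta>: "\<delta> > 0" "\<And>y. dist y x < \<delta> \<Longrightarrow> dist (V y) (V x) < \<rho> / 4 \<and> dist (u y) (u x) < \<rho> / 4 \<and> (\<forall>g\<in>G. dist (g y) (g x) < \<kappa>) \<and> C - (norm (V y))\<^sup>2 < 2 * D"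
    unfolding eventually_nhds_metric by blast
  show ?thesis
  proof (rule that[OF \<delta>(1)])
    fix K c d assume K: "K = cbox c d" "K \<subseteq> ball x \<delta>"
    have near: "dist (V y) (V x) < \<rho> / 4" "dist (u y) (u x) < \<rho> / 4" "\<And>g. g \<in> G \<Longrightarrow> dist (g y) (g x) < \<kappa>" "C - (norm (V y))\<^sup>2 < 2 * D"
      if "y \<in> K" for y
    proof -
      have "dist y x < \<delta>" using K(2) that by (metis dist_commute mem_ball subsetD)
      from \<delta>(2)[OF this] show "dist (V y) (V x) < \<rho> / 4" "dist (u y) (u x) < \<rho> / 4" "\<And>g. g \<in> G \<Longrightarrow> dist (g y) (g x) < \<kappa>" "C - (norm (V y))\<^sup>2 < 2 * D"
        by blast+
    qed
    have pos: "0 \<le> C - (norm (V y))\<^sup>2" for y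
      using sub[of y] norm_ge_zero[of "(V y)\<^sup>2 - 2 * u y"] unfolding subsol_def by linarith
    have Kb: "bounded K" "K \<in> sets borel" using K by auto
    have "(\<integral>z. indicator K z * (C - (norm (V z))\<^sup>2)\<^sup>2 \<partial>lborel) \<le> (\<integral>z. indicator K z * (2 * D)\<^sup>2 \<partial>lborel)"
    proof (rule integral_mono_AE')
      show "integrable lborel (\<lambda>z. indicator K z * (2 * D)\<^sup>2)" by (rule integrable_indicator_bounded[OF Kb])
      show "AE z in lborel. indicator K z * (C - (norm (V z))\<^sup>2)\<^sup>2 \<le> indicator K z * (2 * D)\<^sup>2"
      proof (intro AE_I2)
        fix z
        have "(C - (norm (V z))\<^sup>2)\<^sup>2 \<le> (2 * D)\<^sup>2" if "z \<in> K"
          using near(4)[OF that] pos[of z] by (intro power_mono) auto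
        then show "indicator K z * (C - (norm (V z))\<^sup>2)\<^sup>2 \<le> indicator K z * (2 * D)\<^sup>2"
          by (cases "z \<in> K") auto
      qed
    qed auto
    also have "\<dots> = measure lborel K * (2 * D)\<^sup>2" using K by simp
    \<comment> \<open>From \<open>A^2 = D^2 / (64 * C)\<close>; together with the factor
      \<open>2^24\<close> lost in \<open>building_block\<close> this accounts for the constant
      \<open>2^32\<close>.\<close>
    also have "\<dots> = 2^8 * C * (measure lborel K * A\<^sup>2)" using C AD by (simp add: power_mult_distrib)
    finally have gain: "(\<integral>z. indicator K z * (C - (norm (V z))\<^sup>2)\<^sup>2 \<partial>lborel) / (2^32 * C) \<le> A\<^sup>2 / 2^24 * measure lborel K"
      using C by (simp add: field_simps)
    have mK: "measure lborel K = measure lborel (box c d)" using K measure_lborel_cbox_box by blast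
    show "\<exists>v' u'. continuous_on UNIV v' \<and> continuous_on UNIV u' \<and> (\<forall>z. z \<notin> interior K \<longrightarrow> v' z = 0 \<and> u' z = 0) \<and>
      solenoidal v' u' \<and> (\<forall>z\<in>K. subsol C (V z + v' z) (u z + u' z)) \<and>
      (\<forall>g\<in>G. \<bar>\<integral>z. v' z \<bullet> g z \<partial>lborel\<bar> \<le> \<eta> * measure lborel K) \<and>
      (\<integral>z. indicator K z * (C - (norm (V z))\<^sup>2)\<^sup>2 \<partial>lborel) / (2^32 * C) \<le> (\<integral>z. (norm (v' z))\<^sup>2 \<partial>lborel)"
    proof (cases "box c d = {}")
      case True
      then have "measure lborel K = 0" using mK by simp
      then show ?thesis using gain sub solenoidal_zero \<eta>
        by (intro exI[of _ "\<lambda>_. 0"]) simp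
    next
      case False
      have \<rho>4: "\<rho> / 4 > 0" using \<rho> by simp
      obtain v' u' s where v': "continuous_on UNIV v'" "continuous_on UNIV u'"
        "\<And>z. z \<notin> box c d \<Longrightarrow> v' z = 0 \<and> u' z = 0" "solenoidal v' u'"
        and s: "\<And>z. \<bar>s z\<bar> \<le> A" "\<And>z. norm (v' z - s z *\<^sub>R e) \<le> \<rho> / 4" "\<And>z. norm (u' z - s z *\<^sub>R (\<i> * of_real \<tau> * e\<^sup>2)) \<le> \<rho> / 4"
        and gv: "A\<^sup>2 / 2^24 * measure lborel (box c d) \<le> (\<integral>z. (norm (v' z))\<^sup>2 \<partial>lborel)"
        using building_block[OF False e A(2) \<rho>4, of \<tau>] by blast
      have "subsol C (V z + v' z) (u z + u' z)" if z: "z \<in> K" for z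
      proof -
        let ?p = "(V x + s z *\<^sub>R e, u x + s z *\<^sub>R (\<i> * of_real \<tau> * e\<^sup>2))"
        have "dist (V x + s z *\<^sub>R e) (V z + v' z) < \<rho> / 2"
        proof -
          have "norm ((V z - V x) + (v' z - s z *\<^sub>R e)) < \<rho> / 2"
            using near(1)[OF z, unfolded dist_norm] s(2)[of z] norm_triangle_ineq[of "V z - V x" "v' z - s z *\<^sub>R e"] by linarith
          also have "(V z - V x) + (v' z - s z *\<^sub>R e) = V z + v' z - (V x + s z *\<^sub>R e)" by simp
          finally show ?thesis unfolding dist_norm by (subst norm_minus_commute)
        qed
        moreover have "dist (u x + s z *\<^sub>R (\<i> * of_real \<tau> * e\<^sup>2)) (u z + u' z) < \<rho> / 2"
        proof -
          have "norm ((u z - u x) + (u' z - s z *\<^sub>R (\<i> * of_real \<tau> * e\<^sup>2))) < \<rho> / 2"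
            using near(2)[OF z, unfolded dist_norm] s(3)[of z] norm_triangle_ineq[of "u z - u x" "u' z - s z *\<^sub>R (\<i> * of_real \<tau> * e\<^sup>2)"] by linarith
          also have "(u z - u x) + (u' z - s z *\<^sub>R (\<i> * of_real \<tau> * e\<^sup>2)) = u z + u' z - (u x + s z *\<^sub>R (\<i> * of_real \<tau> * e\<^sup>2))" by simp
          finally show ?thesis unfolding dist_norm by (subst norm_minus_commute)
        qed
        ultimately have "dist ?p (V z + v' z, u z + u' z) < \<rho>"
          unfolding dist_Pair_Pair using sqrt_sum_squares_le_sum_abs[of "dist (V x + s z *\<^sub>R e) (V z + v' z)" "dist (u x + s z *\<^sub>R (\<i> * of_real \<tau> * e\<^sup>2)) (u z + u' z)"]
          by simp
        moreover have "?p \<in> ?seg" using s(1)[of z] by (intro image_eqI[of _ _ "s z"]) (auto simp: abs_le_iff)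
        ultimately have "(V z + v' z, u z + u' z) \<in> (\<Union>p\<in>?seg. ball p \<rho>)"
          by (meson UN_I mem_ball)
        from subsetD[OF \<rho>(2) this] show ?thesis by simp
      qed
      moreover have "\<bar>\<integral>z. v' z \<bullet> g z \<partial>lborel\<bar> \<le> \<eta> * measure lborel K" if g: "g \<in> G" for g
      proof -
        have cg: "continuous_on UNIV g" using G(2)[OF g] .
        have i: "integrable lborel (\<lambda>z. v' z \<bullet> g z)" "integrable lborel (\<lambda>z. v' z \<bullet> g x)" "integrable lborel (\<lambda>z. v' z \<bullet> (g z - g x))"
          by (rule continuous_vanishing_integrable[of _ "box c d"]; use v' cg in \<open>auto intro!: continuous_intros\<close>)+
        \<comment> \<open>Since \<open>v'\<close> has mean zero, the constant \<open>g x\<close> may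
          be subtracted from \<open>g\<close>.\<close>
        have "(\<integral>z. v' z \<bullet> g z \<partial>lborel) = (\<integral>z. v' z \<bullet> g z \<partial>lborel) - (\<integral>z. v' z \<bullet> g x \<partial>lborel)"
          using solenoidal_integral_inner_const[OF v'(4)] by simp
        also have "\<dots> = (\<integral>z. v' z \<bullet> (g z - g x) \<partial>lborel)"
          by (subst Bochner_Integration.integral_diff[OF i(1,2), symmetric]) (simp add: inner_diff_right)
        finally have eq: "(\<integral>z. v' z \<bullet> g z \<partial>lborel) = (\<integral>z. v' z \<bullet> (g z - g x) \<partial>lborel)" .
        have "\<bar>\<integral>z. v' z \<bullet> (g z - g x) \<partial>lborel\<bar> \<le> (\<integral>z. \<bar>v' z \<bullet> (g z - g x)\<bar> \<partial>lborel)"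
          using integral_norm_bound[of lborel "\<lambda>z. v' z \<bullet> (g z - g x)"] by simp
        also have "\<dots> \<le> (\<integral>z. indicator K z * \<eta> \<partial>lborel)"
        proof (rule integral_mono)
          show "integrable lborel (\<lambda>z. \<bar>v' z \<bullet> (g z - g x)\<bar>)" using i(3) by (rule integrable_abs)
          show "integrable lborel (\<lambda>z. indicator K z * \<eta>)" by (rule integrable_indicator_bounded[OF Kb])
          fix z
          show "\<bar>v' z \<bullet> (g z - g x)\<bar> \<le> indicator K z * \<eta>"
          proof (cases "z \<in> K")
            case True
            have "norm (v' z) \<le> A + \<rho>"
            proof -
              have "norm (v' z) \<le> norm (s z *\<^sub>R e) + norm (v' z - s z *\<^sub>R e)" by (metis norm_triangle_sub)
              also have "\<dots> \<le> A + \<rho> / 4" using s(1,2)[of z] e by simp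
              finally show ?thesis using \<rho>(1) by linarith
            qed
            moreover have "norm (g z - g x) \<le> \<kappa>" using near(3)[OF True g] by (simp add: dist_norm)
            ultimately have "norm (v' z) * norm (g z - g x) \<le> (A + \<rho>) * \<kappa>"
              using A(2) \<rho>(1) by (intro mult_mono) auto
            also have "\<dots> = \<eta>" using A(2) \<rho>(1) by (simp add: \<kappa>_def)
            finally show ?thesis using Cauchy_Schwarz_ineq2[of "v' z" "g z - g x"] True by simp
          next
            case False
            then have "v' z = 0" using v'(3)[of z] K(1) box_subset_cbox[of c d] by blast
            then show ?thesis using False by simp
          qed
        qed
        also have "\<dots> = \<eta> * measure lborel K" using K by simp
        finally show ?thesis using eq by simp
      qed
      ultimately show ?thesis
        using v' gain gv mK K(1) by (intro exI[of _ v'] exI[of _ u']) (auto simp: interior_cbox)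
    qed
  qed
qed

text \<open>The local perturbations are placed on the cells of a division of the box. Their supports
  lie in disjoint interiors, so both the pairings and the squared norms add up over the cells, and
  neither estimate depends on the number of cells.\<close>

lemma perturbation_step:
  fixes a b :: spacetime
  assumes X: "subsolution C V0 u0 (box a b) v u"
    and G: "finite G" "\<And>g. g \<in> G \<Longrightarrow> continuous_on UNIV g" and \<eta>: "\<eta> > 0"
  obtains v' u' where "subsolution C V0 u0 (box a b) v' u'"
    "\<And>g. g \<in> G \<Longrightarrow> \<bar>\<integral>z. (v' z - v z) \<bullet> g z \<partial>lborel\<bar> \<le> \<eta> * measure lborel (cbox a b)"
    "(\<integral>z. indicator (box a b) z * (C - (norm (V0 + v z))\<^sup>2)\<^sup>2 \<partial>lborel) / (2^32 * C) \<le> (\<integral>z. (norm (v' z - v z))\<^sup>2 \<partial>lborel)"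
proof -
  let ?V = "\<lambda>z. V0 + v z" and ?u = "\<lambda>z. u0 + u z"
  have c: "continuous_on UNIV v" "continuous_on UNIV u" and z0: "\<And>z. z \<notin> box a b \<Longrightarrow> v z = 0 \<and> u z = 0"
    and sol: "solenoidal v u" and sub: "\<And>z. subsol C (?V z) (?u z)"
    using X by (auto simp: subsolution_def)
  have cV: "continuous_on UNIV ?V" "continuous_on UNIV ?u" by (auto intro!: continuous_intros c)
  define loc where "loc K v' u' \<longleftrightarrow> continuous_on UNIV v' \<and> continuous_on UNIV u' \<and> (\<forall>z. z \<notin> interior K \<longrightarrow> v' z = 0 \<and> u' z = 0) \<and>
      solenoidal v' u' \<and> (\<forall>z\<in>K. subsol C (?V z + v' z) (?u z + u' z)) \<and>
      (\<forall>g\<in>G. \<bar>\<integral>z. v' z \<bullet> g z \<partial>lborel\<bar> \<le> \<eta> * measure lborel K) \<and>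
      (\<integral>z. indicator K z * (C - (norm (?V z))\<^sup>2)\<^sup>2 \<partial>lborel) / (2^32 * C) \<le> (\<integral>z. (norm (v' z))\<^sup>2 \<partial>lborel)" for K v' u'
  have "\<exists>\<delta>>0. \<forall>K c d. K = cbox c d \<longrightarrow> K \<subseteq> ball x \<delta> \<longrightarrow> (\<exists>v' u'. loc K v' u')" for x
  proof (rule local_perturbation[OF cV sub G \<eta>, of x], goal_cases)
    case (2 \<delta>)
    show ?case
      by (intro exI[of _ \<delta>] conjI allI impI 2(1)) (unfold loc_def, rule 2(2))
  qed
  then obtain \<delta> where \<delta>: "\<And>x. \<delta> x > 0" "\<And>x K c d. K = cbox c d \<Longrightarrow> K \<subseteq> ball x (\<delta> x) \<Longrightarrow> \<exists>v' u'. loc K v' u'"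
    by metis
  \<comment> \<open>The admissible radius varies with the point without a uniform lower bound;
    Cousin's lemma supplies a division adapted to it.\<close>
  have "gauge (\<lambda>x. ball x (\<delta> x))" using \<delta>(1) by (intro gauge_ball_dependent) auto
  then obtain p where p: "p tagged_division_of cbox a b" "(\<lambda>x. ball x (\<delta> x)) fine p"
    by (rule fine_division_exists)
  define D where "D = snd ` p"
  have div: "D division_of cbox a b" using division_of_tagged_division[OF p(1)] by (simp add: D_def)
  have fD: "finite D" using div by (rule division_of_finite)
  have Kbox: "\<exists>c d. K = cbox c d" "K \<subseteq> cbox a b" if "K \<in> D" for K using division_ofD(2,4)[OF div that] by blast+
  have "\<exists>v' u'. loc K v' u'" if K: "K \<in> D" for K
  proof -
    obtain x where "(x, K) \<in> p" using K by (auto simp: D_def)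
    then have "K \<subseteq> ball x (\<delta> x)" using p(2) by (auto simp: fine_def)
    then show ?thesis using \<delta>(2) Kbox(1)[OF K] by metis
  qed
  then obtain w y where w: "\<And>K. K \<in> D \<Longrightarrow> loc K (w K) (y K)" by metis
  have wc: "continuous_on UNIV (w K)" "continuous_on UNIV (y K)" and wz: "\<And>z. z \<notin> interior K \<Longrightarrow> w K z = 0 \<and> y K z = 0"
    and ws: "solenoidal (w K) (y K)" and wsub: "\<And>z. z \<in> K \<Longrightarrow> subsol C (?V z + w K z) (?u z + y K z)"
    and wG: "\<And>g. g \<in> G \<Longrightarrow> \<bar>\<integral>z. w K z \<bullet> g z \<partial>lborel\<bar> \<le> \<eta> * measure lborel K"
    and wgain: "(\<integral>z. indicator K z * (C - (norm (?V z))\<^sup>2)\<^sup>2 \<partial>lborel) / (2^32 * C) \<le> (\<integral>z. (norm (w K z))\<^sup>2 \<partial>lborel)"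
    if "K \<in> D" for K using w[OF that] by (auto simp: loc_def)
  have disj: "z \<notin> interior L" if "z \<in> interior K" "K \<in> D" "L \<in> D" "K \<noteq> L" for z K L
    using division_ofD(5)[OF div] that by blast
  have single: "(\<Sum>K\<in>D. w K z) = w K z \<and> (\<Sum>K\<in>D. y K z) = y K z \<and> (\<Sum>K\<in>D. (norm (w K z))\<^sup>2) = (norm (w K z))\<^sup>2"
    if "z \<in> interior K" "K \<in> D" for z K
  proof -
    have "w L z = 0 \<and> y L z = 0" if "L \<in> D - {K}" for L
      using disj[OF \<open>z \<in> interior K\<close> \<open>K \<in> D\<close>, of L] wz[of L z] that by auto
    then show ?thesis using fD that(2) by (auto simp: sum.remove[of D K] intro!: sum.neutral)
  qed
  have none: "(\<Sum>K\<in>D. w K z) = 0 \<and> (\<Sum>K\<in>D. y K z) = 0 \<and> (\<Sum>K\<in>D. (norm (w K z))\<^sup>2) = 0" if "\<And>K. K \<in> D \<Longrightarrow> z \<notin> interior K" for z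
    using that wz by (auto intro!: sum.neutral)
  have intK: "interior K \<subseteq> box a b" if "K \<in> D" for K
    using interior_mono[OF Kbox(2)[OF that]] by (simp add: interior_cbox)
  have wz': "w K z = 0 \<and> y K z = 0" if "K \<in> D" "z \<notin> box a b" for K z
    using intK[OF that(1)] that(2) wz[OF that(1)] by blast
  show ?thesis
  proof (rule that[of "\<lambda>z. v z + (\<Sum>K\<in>D. w K z)" "\<lambda>z. u z + (\<Sum>K\<in>D. y K z)"])
    have cs: "continuous_on UNIV (\<lambda>z. \<Sum>K\<in>D. w K z)" "continuous_on UNIV (\<lambda>z. \<Sum>K\<in>D. y K z)"
      using wc by (auto intro!: continuous_intros)
    have zs: "(\<Sum>K\<in>D. w K z) = 0" "(\<Sum>K\<in>D. y K z) = 0" if "z \<notin> box a b" for z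
      using wz' that by (auto intro!: sum.neutral)
    have "solenoidal (\<lambda>z. \<Sum>K\<in>D. w K z) (\<lambda>z. \<Sum>K\<in>D. y K z)"
      by (rule solenoidal_sum[OF fD, where S="box a b"]) (use wc ws wz' in auto)
    then have "solenoidal (\<lambda>z. v z + (\<Sum>K\<in>D. w K z)) (\<lambda>z. u z + (\<Sum>K\<in>D. y K z))"
      by (intro solenoidal_add[OF sol _ c cs bounded_box[of a b]]) (auto simp: z0 zs)
    \<comment> \<open>In the interior of a cell exactly one perturbation can act; on the faces
      between cells the old state is unchanged.\<close>
    moreover have "subsol C (V0 + (v z + (\<Sum>K\<in>D. w K z))) (u0 + (u z + (\<Sum>K\<in>D. y K z)))" for z
    proof (cases "\<exists>K\<in>D. z \<in> interior K")
      case True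
      then obtain K where K: "K \<in> D" "z \<in> interior K" by blast
      then show ?thesis using single[OF K(2,1)] wsub[OF K(1), of z] interior_subset[of K] by (auto simp: add.assoc)
    next
      case False
      then show ?thesis using none[of z] sub[of z] by auto
    qed
    ultimately show "subsolution C V0 u0 (box a b) (\<lambda>z. v z + (\<Sum>K\<in>D. w K z)) (\<lambda>z. u z + (\<Sum>K\<in>D. y K z))"
      unfolding subsolution_def using c cs zs z0 by (auto intro!: continuous_intros)
    have iw: "integrable lborel (\<lambda>z. w K z \<bullet> g z)" if "K \<in> D" "continuous_on UNIV g" for K g
      by (rule continuous_vanishing_integrable[of _ "box a b"]) (use that wc wz' in \<open>auto intro!: continuous_intros\<close>)
    show "\<bar>\<integral>z. (v z + (\<Sum>K\<in>D. w K z) - v z) \<bullet> g z \<partial>lborel\<bar> \<le> \<eta> * measure lborel (cbox a b)" if g: "g \<in> G" for g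
    proof -
      have "(\<integral>z. (v z + (\<Sum>K\<in>D. w K z) - v z) \<bullet> g z \<partial>lborel) = (\<Sum>K\<in>D. \<integral>z. w K z \<bullet> g z \<partial>lborel)"
        using iw[OF _ G(2)[OF g]] by (simp add: inner_sum_left)
      also have "\<bar>\<dots>\<bar> \<le> (\<Sum>K\<in>D. \<bar>\<integral>z. w K z \<bullet> g z \<partial>lborel\<bar>)" by (rule sum_abs)
      also have "\<dots> \<le> (\<Sum>K\<in>D. \<eta> * measure lborel K)" by (intro sum_mono wG g)
      also have "\<dots> = \<eta> * measure lborel (cbox a b)"
        using additive_content_division[OF div] by (simp add: sum_distrib_left[symmetric])
      finally show ?thesis .
    qed
    have iK: "integrable lborel (\<lambda>z. indicator K z * (C - (norm (?V z))\<^sup>2)\<^sup>2)" if KD: "K \<in> D" for K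
    proof -
      obtain k l where K: "K = cbox k l" using Kbox(1)[OF KD] by blast
      have "continuous_on UNIV (\<lambda>z. (C - (norm (?V z))\<^sup>2)\<^sup>2)"
        by (intro continuous_on_power continuous_on_diff continuous_on_const continuous_on_norm cV)
      then have "integrable lborel (\<lambda>z. indicator (cbox k l) z *\<^sub>R (C - (norm (?V z))\<^sup>2)\<^sup>2)"
        by (rule borel_integrable_compact[OF compact_cbox continuous_on_subset[OF _ subset_UNIV]])
      then show ?thesis by (simp add: K)
    qed
    have inorm: "integrable lborel (\<lambda>z. (norm (w K z))\<^sup>2)" if "K \<in> D" for K
      by (rule continuous_vanishing_integrable[of _ "box a b"]) (use that wc wz' in \<open>auto intro!: continuous_intros\<close>)
    have "(\<integral>z. indicator (box a b) z * (C - (norm (?V z))\<^sup>2)\<^sup>2 \<partial>lborel) \<le> (\<integral>z. (\<Sum>K\<in>D. indicator K z * (C - (norm (?V z))\<^sup>2)\<^sup>2) \<partial>lborel)"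
    proof (rule integral_mono_AE')
      show "integrable lborel (\<lambda>z. \<Sum>K\<in>D. indicator K z * (C - (norm (?V z))\<^sup>2)\<^sup>2)"
        by (intro Bochner_Integration.integrable_sum iK)
      show "AE z in lborel. indicator (box a b) z * (C - (norm (?V z))\<^sup>2)\<^sup>2 \<le> (\<Sum>K\<in>D. indicator K z * (C - (norm (?V z))\<^sup>2)\<^sup>2)"
      proof (rule AE_I2)
        fix z
        show "indicator (box a b) z * (C - (norm (?V z))\<^sup>2)\<^sup>2 \<le> (\<Sum>K\<in>D. indicator K z * (C - (norm (?V z))\<^sup>2)\<^sup>2)"
        proof (cases "z \<in> box a b")
          case True
          then obtain K where K: "K \<in> D" "z \<in> K" using division_ofD(6)[OF div] box_subset_cbox[of a b] by blast
          have "indicator K z * (C - (norm (?V z))\<^sup>2)\<^sup>2 \<le> (\<Sum>K\<in>D. indicator K z * (C - (norm (?V z))\<^sup>2)\<^sup>2)"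
            by (rule member_le_sum[OF K(1) _ fD]) auto
          then show ?thesis using True K by simp
        next
          case False
          then show ?thesis by (auto intro!: sum_nonneg)
        qed
      qed
    qed (auto intro!: sum_nonneg)
    also have "\<dots> = (\<Sum>K\<in>D. \<integral>z. indicator K z * (C - (norm (?V z))\<^sup>2)\<^sup>2 \<partial>lborel)"
      by (rule Bochner_Integration.integral_sum[OF iK])
    finally have "(\<integral>z. indicator (box a b) z * (C - (norm (?V z))\<^sup>2)\<^sup>2 \<partial>lborel) / (2^32 * C) \<le>
      (\<Sum>K\<in>D. \<integral>z. indicator K z * (C - (norm (?V z))\<^sup>2)\<^sup>2 \<partial>lborel) / (2^32 * C)"
    proof (intro divide_right_mono)
      have "C > 0"
        using sub[of undefined] norm_ge_zero[of "(?V undefined)\<^sup>2 - 2 * ?u undefined"] zero_le_power2[of "norm (?V undefined)"]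
        unfolding subsol_def by linarith
      then show "0 \<le> 2^32 * C" by simp
    qed auto
    also have "\<dots> \<le> (\<Sum>K\<in>D. \<integral>z. (norm (w K z))\<^sup>2 \<partial>lborel)"
      unfolding sum_divide_distrib by (intro sum_mono wgain)
    also have "\<dots> = (\<integral>z. (\<Sum>K\<in>D. (norm (w K z))\<^sup>2) \<partial>lborel)"
      by (rule Bochner_Integration.integral_sum[OF inorm, symmetric])
    also have "\<dots> = (\<integral>z. (norm (v z + (\<Sum>K\<in>D. w K z) - v z))\<^sup>2 \<partial>lborel)"
    proof (rule Bochner_Integration.integral_cong[OF refl])
      fix z
      show "(\<Sum>K\<in>D. (norm (w K z))\<^sup>2) = (norm (v z + (\<Sum>K\<in>D. w K z) - v z))\<^sup>2"
      proof (cases "\<exists>K\<in>D. z \<in> interior K")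
        case True
        then obtain K where K: "K \<in> D" "z \<in> interior K" by blast
        then show ?thesis using single[OF K(2,1)] by simp
      next
        case False
        then show ?thesis using none[of z] by simp
      qed
    qed
    finally show "(\<integral>z. indicator (box a b) z * (C - (norm (?V z))\<^sup>2)\<^sup>2 \<partial>lborel) / (2^32 * C) \<le> (\<integral>z. (norm (v z + (\<Sum>K\<in>D. w K z) - v z))\<^sup>2 \<partial>lborel)" .
  qed
qed

section \<open>Passage to the limit\<close>

lemma divfree_limit:
  fixes q :: "nat \<Rightarrow> spacetime \<Rightarrow> real"
  assumes df: "\<And>i. divfree (q i) (w i)"
    and m: "\<And>i. q i \<in> borel_measurable borel" "\<And>i. w i \<in> borel_measurable borel"
    and m': "q' \<in> borel_measurable borel" "w' \<in> borel_measurable borel"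
    and S: "bounded S" "\<And>i z. z \<notin> S \<Longrightarrow> q i z = 0 \<and> w i z = 0"
    and B: "\<And>i z. \<bar>q i z\<bar> \<le> B \<and> norm (w i z) \<le> B"
    and lim: "AE z in lborel. (\<lambda>i. q i z) \<longlonglongrightarrow> q' z \<and> (\<lambda>i. w i z) \<longlonglongrightarrow> w' z"
  shows "divfree q' w'"
  unfolding divfree_def
proof (intro allI impI)
  fix \<psi> :: "spacetime \<Rightarrow> real" and G assume C: "C1_grad \<psi> G"
  have cG: "continuous_on UNIV G" using C by (simp add: C1_grad_def)
  have mspc: "(\<lambda>z. space_part (G z)) \<in> borel_measurable borel" and msnd: "(\<lambda>z. snd (G z)) \<in> borel_measurable borel"
    by (rule borel_measurable_continuous_onI; intro continuous_intros cG)+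
  obtain R where R: "S \<subseteq> cball 0 R" "R > 0" using S(1) by (meson bounded_subset_ballD subset_trans ball_subset_cball)
  have "compact ((\<lambda>z. norm (space_part (G z)) + \<bar>snd (G z)\<bar>) ` cball 0 R)"
    by (rule compact_continuous_image[OF continuous_on_subset[OF _ subset_UNIV] compact_cball]) (intro continuous_intros cG)
  from compact_imp_bounded[OF this] obtain L where
    L': "L > 0" "\<forall>y\<in>(\<lambda>z. norm (space_part (G z)) + \<bar>snd (G z)\<bar>) ` cball 0 R. norm y \<le> L"
    unfolding bounded_pos by blast
  have L: "norm (space_part (G z)) + \<bar>snd (G z)\<bar> \<le> L" if "z \<in> cball 0 R" for z
    using L'(2)[rule_format, OF imageI[OF that]] by simp
  have "(\<lambda>i. \<integral>z. w i z \<bullet> space_part (G z) + q i z * snd (G z) \<partial>lborel) \<longlonglongrightarrow> (\<integral>z. w' z \<bullet> space_part (G z) + q' z * snd (G z) \<partial>lborel)"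
  proof (rule integral_dominated_convergence[where w="\<lambda>z. indicator (cball 0 R) z * (B * L)"])
    show "integrable lborel (\<lambda>z. indicator (cball 0 R) z * (B * L))" by (rule integrable_indicator_bounded) auto
    show "AE z in lborel. (\<lambda>i. w i z \<bullet> space_part (G z) + q i z * snd (G z)) \<longlonglongrightarrow> w' z \<bullet> space_part (G z) + q' z * snd (G z)"
      using lim by eventually_elim (auto intro!: tendsto_intros)
    show "AE z in lborel. norm (w i z \<bullet> space_part (G z) + q i z * snd (G z)) \<le> indicator (cball 0 R) z * (B * L)" for i
    proof (rule AE_I2)
      fix z
      show "norm (w i z \<bullet> space_part (G z) + q i z * snd (G z)) \<le> indicator (cball 0 R) z * (B * L)"
      proof (cases "z \<in> cball 0 R")
        case True
        have "norm (w i z \<bullet> space_part (G z) + q i z * snd (G z)) \<le> norm (w i z) * norm (space_part (G z)) + \<bar>q i z\<bar> * \<bar>snd (G z)\<bar>"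
          by (intro norm_triangle_mono) (auto simp: Cauchy_Schwarz_ineq2 abs_mult)
        also have "\<dots> \<le> B * norm (space_part (G z)) + B * \<bar>snd (G z)\<bar>"
          using B[of i z] by (intro add_mono mult_right_mono) auto
        also have "\<dots> \<le> B * L"
          unfolding distrib_left[symmetric] using L[OF True] B[of i z] by (intro mult_left_mono) auto
        finally show ?thesis using True by simp
      next
        case False
        then have "z \<notin> S" using R by blast
        then show ?thesis using S(2) False by simp
      qed
    qed
  qed (use m m' mspc msnd in \<open>simp_all add: borel_measurable_add borel_measurable_inner borel_measurable_times\<close>)
  moreover have "(\<integral>z. w i z \<bullet> space_part (G z) + q i z * snd (G z) \<partial>lborel) = 0" for i
    using df C by (auto simp: divfree_def)
  ultimately show "(\<integral>z. w' z \<bullet> space_part (G z) + q' z * snd (G z) \<partial>lborel) = 0"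
    by (simp add: LIMSEQ_const_iff)
qed

text \<open>The pointwise bounds hold everywhere, not only almost everywhere, so that sums of solutions
  on disjoint boxes are again bounded everywhere.\<close>

definition solves :: "real \<Rightarrow> complex \<Rightarrow> complex \<Rightarrow> spacetime set \<Rightarrow> (spacetime \<Rightarrow> complex) \<Rightarrow> (spacetime \<Rightarrow> complex) \<Rightarrow> bool" where
  "solves C V0 u0 Q v u \<longleftrightarrow> v \<in> borel_measurable borel \<and> u \<in> borel_measurable borel \<and>
     (\<forall>z. z \<notin> Q \<longrightarrow> v z = 0 \<and> u z = 0) \<and> solenoidal v u \<and>
     (\<forall>z. norm (V0 + v z) \<le> sqrt C + norm V0 \<and> norm (u0 + u z) \<le> C + (norm V0)\<^sup>2 + norm u0) \<and>
     (AE z in lborel. z \<in> Q \<longrightarrow> (norm (V0 + v z))\<^sup>2 = C \<and> 2 * (u0 + u z) = (V0 + v z)\<^sup>2)"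

lemma subsol_bounds:
  assumes "subsol C V u"
  shows "norm V \<le> sqrt C" "norm u \<le> C" "(norm V)\<^sup>2 \<le> C" "norm (V\<^sup>2 - 2 * u) \<le> C - (norm V)\<^sup>2" "C > 0"
proof -
  have *: "(norm V)\<^sup>2 + norm (V\<^sup>2 - 2 * u) < C" using assms by (simp add: subsol_def)
  then show 1: "(norm V)\<^sup>2 \<le> C" "norm (V\<^sup>2 - 2 * u) \<le> C - (norm V)\<^sup>2" "C > 0"
    using norm_ge_zero[of "V\<^sup>2 - 2 * u"] zero_le_power2[of "norm V"] by linarith+
  show "norm V \<le> sqrt C" using 1(1) by (rule real_le_rsqrt)
  have "norm (2 * u) \<le> norm (V\<^sup>2) + norm (V\<^sup>2 - 2 * u)" by (metis norm_triangle_sub norm_minus_commute)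
  then have "2 * norm u \<le> (norm V)\<^sup>2 + norm (V\<^sup>2 - 2 * u)" by (simp add: norm_mult norm_power)
  then show "norm u \<le> C" using * 1(3) norm_ge_zero[of u] by linarith
qed

text \<open>Integrates the pointwise bound \<open>|f| \<le> e + |f|^2 / e\<close>. It turns the
  \<open>L^2\<close> Cauchy property into an \<open>L^1\<close> one, for which almost everywhere
  convergent subsequences are available.\<close>

lemma integral_norm_le_square:
  fixes f :: "spacetime \<Rightarrow> complex"
  assumes c: "continuous_on UNIV f" and S: "bounded S" "S \<in> sets borel" "\<And>z. z \<notin> S \<Longrightarrow> f z = 0" and e: "e > 0"
  shows "(\<integral>z. norm (f z) \<partial>lborel) \<le> e * measure lborel S + (\<integral>z. (norm (f z))\<^sup>2 \<partial>lborel) / e"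
proof -
  have i: "integrable lborel (\<lambda>z. norm (f z))" "integrable lborel (\<lambda>z. (norm (f z))\<^sup>2)" "integrable lborel (\<lambda>z. indicator S z * e)"
    by (rule continuous_vanishing_integrable[OF _ S(1)] integrable_indicator_bounded[OF S(1,2)]; use c S(3) in \<open>auto intro!: continuous_intros\<close>)+
  have "(\<integral>z. norm (f z) \<partial>lborel) \<le> (\<integral>z. indicator S z * e + (norm (f z))\<^sup>2 / e \<partial>lborel)"
  proof (rule integral_mono[OF i(1)])
    show "integrable lborel (\<lambda>z. indicator S z * e + (norm (f z))\<^sup>2 / e)" using i by simp
    fix z
    show "norm (f z) \<le> indicator S z * e + (norm (f z))\<^sup>2 / e"
    proof (cases "z \<in> S")
      case True
      have "norm (f z) * e \<le> e * e + (norm (f z))\<^sup>2"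
        using sum_squares_bound[of "norm (f z)" e] mult_nonneg_nonneg[OF norm_ge_zero less_imp_le[OF e], of "f z"]
        unfolding power2_eq_square by linarith
      then show ?thesis using True e by (simp add: field_simps)
    qed (simp add: S(3))
  qed
  also have "\<dots> = e * measure lborel S + (\<integral>z. (norm (f z))\<^sup>2 \<partial>lborel) / e"
    using i S by (simp add: mult.commute)
  finally show ?thesis .
qed

text \<open>The near-orthogonality of the increments makes the energies of the sequence almost additive and
  hence the sequence Cauchy in \<open>L\<^sup>2\<close>; then the last inequality forces \<open>|V0 + v|\<^sup>2 = C\<close> in the limit.\<close>

lemma subsolution_sequence:
  fixes a b :: spacetime
  assumes X: "subsolution C V0 u0 (box a b) v0 w0" and g: "continuous_on UNIV g" and \<eta>: "\<eta> > 0"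
  obtains v u where "\<And>n. subsolution C V0 u0 (box a b) (v n) (u n)" "v 0 = v0" "u (0::nat) = w0"
    "\<And>n m. n \<le> m \<Longrightarrow> \<bar>\<integral>z. (v m z - v n z) \<bullet> v n z \<partial>lborel\<bar> \<le> \<eta> * (1 / 2^n - 1 / 2^m)"
    "\<And>m. \<bar>\<integral>z. (v m z - v 0 z) \<bullet> g z \<partial>lborel\<bar> \<le> \<eta>"
    "\<And>n. (\<integral>z. indicator (box a b) z * (C - (norm (V0 + v n z))\<^sup>2)\<^sup>2 \<partial>lborel) / (2^32 * C) \<le> (\<integral>z. (norm (v (Suc n) z - v n z))\<^sup>2 \<partial>lborel)"
proof -
  let ?X = "subsolution C V0 u0 (box a b)"
  \<comment> \<open>The growing set \<open>G\<close> records \<open>g\<close> and all stages so far.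
    Each new increment is nearly orthogonal to every member, so differences between distant stages
    remain nearly orthogonal to the earlier one.\<close>
  let ?P = "\<lambda>n (v, u, G). ?X v u \<and> finite G \<and> (\<forall>h\<in>G. continuous_on UNIV h) \<and> v \<in> G \<and> g \<in> G \<and> (n = (0::nat) \<longrightarrow> v = v0 \<and> u = w0)"
  let ?Q = "\<lambda>n (v, u, G) (v', u', G'). G \<subseteq> G' \<and> (\<forall>h\<in>G. \<bar>\<integral>z. (v' z - v z) \<bullet> h z \<partial>lborel\<bar> \<le> \<eta> / 2^Suc n) \<and>
     (\<integral>z. indicator (box a b) z * (C - (norm (V0 + v z))\<^sup>2)\<^sup>2 \<partial>lborel) / (2^32 * C) \<le> (\<integral>z. (norm (v' z - v z))\<^sup>2 \<partial>lborel)"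
  have "\<exists>f. \<forall>n. ?P n (f n) \<and> ?Q n (f n) (f (Suc n))"
  proof (rule dependent_nat_choice)
    show "\<exists>x. ?P 0 x"
      using X g by (intro exI[of _ "(v0, w0, {v0, g})"]) (auto simp: subsolution_def)
    fix x n assume P: "?P n x"
    obtain v u G where x: "x = (v, u, G)" by (metis prod_cases3)
    let ?M = "measure lborel (cbox a b)"
    \<comment> \<open>The tolerances \<open>\<eta> / 2^Suc n\<close> telescope to
      \<open>\<eta> * (1 / 2^n - 1 / 2^m)\<close>; adding 1 to the volume avoids a division by
      zero.\<close>
    have "\<eta> / 2^Suc n / (?M + 1) > 0" using \<eta> by (intro divide_pos_pos) (auto simp: add_nonneg_pos)
    moreover have Xv: "?X v u" "finite G" "\<And>h. h \<in> G \<Longrightarrow> continuous_on UNIV h" using P x by auto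
    ultimately obtain v' u' where v': "?X v' u'" "\<And>h. h \<in> G \<Longrightarrow> \<bar>\<integral>z. (v' z - v z) \<bullet> h z \<partial>lborel\<bar> \<le> \<eta> / 2^Suc n / (?M + 1) * ?M"
      "(\<integral>z. indicator (box a b) z * (C - (norm (V0 + v z))\<^sup>2)\<^sup>2 \<partial>lborel) / (2^32 * C) \<le> (\<integral>z. (norm (v' z - v z))\<^sup>2 \<partial>lborel)"
      using perturbation_step[OF Xv, of "\<eta> / 2^Suc n / (?M + 1)"] by blast
    have "\<eta> / 2^Suc n / (?M + 1) * ?M \<le> \<eta> / 2^Suc n"
    proof -
      have "?M / (?M + 1) \<le> 1" by (simp add: divide_le_eq_1 add_nonneg_pos)
      then have "\<eta> / 2^Suc n * (?M / (?M + 1)) \<le> \<eta> / 2^Suc n * 1" using \<eta> by (intro mult_left_mono) auto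
      then show ?thesis by simp
    qed
    then have "?Q n x (v', u', insert v' G)" using v' x by (auto intro: order_trans)
    moreover have "?P (Suc n) (v', u', insert v' G)" using v'(1) P x by (auto simp: subsolution_def)
    ultimately show "\<exists>y. ?P (Suc n) y \<and> ?Q n x y" by blast
  qed
  then obtain f where f': "\<forall>n. ?P n (f n) \<and> ?Q n (f n) (f (Suc n))" by (rule exE)
  note f = f'[rule_format, THEN conjunct1] f'[rule_format, THEN conjunct2]
  define v u G where "v n = fst (f n)" and "u n = fst (snd (f n))" and "G n = snd (snd (f n))" for n
  have fe: "f n = (v n, u n, G n)" for n by (simp add: v_def u_def G_def)
  have P: "?X (v n) (u n)" "v n \<in> G n" "g \<in> G n" "\<And>h. h \<in> G n \<Longrightarrow> continuous_on UNIV h" for n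
    using f(1)[of n] by (auto simp: fe)
  have P0: "v 0 = v0" "u 0 = w0" using f(1)[of 0] by (auto simp: fe)
  have Q: "G n \<subseteq> G (Suc n)" "\<And>h. h \<in> G n \<Longrightarrow> \<bar>\<integral>z. (v (Suc n) z - v n z) \<bullet> h z \<partial>lborel\<bar> \<le> \<eta> / 2^Suc n"
    "(\<integral>z. indicator (box a b) z * (C - (norm (V0 + v n z))\<^sup>2)\<^sup>2 \<partial>lborel) / (2^32 * C) \<le> (\<integral>z. (norm (v (Suc n) z - v n z))\<^sup>2 \<partial>lborel)" for n
    using f(2)[of n] by (auto simp: fe)
  have mono: "G n \<subseteq> G m" if "n \<le> m" for n m using lift_Suc_mono_le[of G, OF Q(1) that] .
  have i: "integrable lborel (\<lambda>z. (v m z - v n z) \<bullet> h z)" if "h \<in> G k" for m n h k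
    by (rule continuous_vanishing_integrable[of _ "box a b"]; use P(1)[of m] P(1)[of n] P(4)[OF that] in \<open>auto simp: subsolution_def intro!: continuous_intros\<close>)
  have close: "\<bar>\<integral>z. (v m z - v n z) \<bullet> h z \<partial>lborel\<bar> \<le> \<eta> * (1 / 2^n - 1 / 2^m)" if "n \<le> m" "h \<in> G n" for n m h
    using that
  proof (induction m rule: dec_induct)
    case base
    then show ?case by simp
  next
    case (step m)
    have h: "h \<in> G m" using mono[OF step.hyps(1)] step.prems by blast
    have "(\<integral>z. (v (Suc m) z - v n z) \<bullet> h z \<partial>lborel) = (\<integral>z. (v (Suc m) z - v m z) \<bullet> h z + (v m z - v n z) \<bullet> h z \<partial>lborel)"
      by (intro Bochner_Integration.integral_cong) (auto simp: inner_diff_left)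
    also have "\<dots> = (\<integral>z. (v (Suc m) z - v m z) \<bullet> h z \<partial>lborel) + (\<integral>z. (v m z - v n z) \<bullet> h z \<partial>lborel)"
      by (rule Bochner_Integration.integral_add[OF i[OF h] i[OF h]])
    finally have "\<bar>\<integral>z. (v (Suc m) z - v n z) \<bullet> h z \<partial>lborel\<bar> \<le> \<eta> / 2^Suc m + \<eta> * (1 / 2^n - 1 / 2^m)"
      using Q(2)[OF h] step.IH[OF step.prems] by linarith
    also have "\<dots> = \<eta> * (1 / 2^n - 1 / 2^Suc m)" by (simp add: field_simps)
    finally show ?case .
  qed
  show ?thesis
  proof (rule that[of v u, OF P(1) P0 _ _ Q(3)])
    show "\<bar>\<integral>z. (v m z - v n z) \<bullet> v n z \<partial>lborel\<bar> \<le> \<eta> * (1 / 2^n - 1 / 2^m)" if "n \<le> m" for n m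
      using close[OF that P(2)] .
    show "\<bar>\<integral>z. (v m z - v 0 z) \<bullet> g z \<partial>lborel\<bar> \<le> \<eta>" for m
    proof -
      have "\<eta> * (1 / 2^0 - 1 / 2^m) \<le> \<eta>" using \<eta> by (simp add: algebra_simps)
      then show ?thesis using close[OF _ P(3)[of 0], of m] by linarith
    qed
  qed
qed

lemma integral_square_diff:
  fixes f h :: "spacetime \<Rightarrow> complex"
  assumes c: "continuous_on UNIV f" "continuous_on UNIV h" and S: "bounded S" "\<And>z. z \<notin> S \<Longrightarrow> f z = 0 \<and> h z = 0"
  shows "(\<integral>z. (norm (f z - h z))\<^sup>2 \<partial>lborel) = (\<integral>z. (norm (f z))\<^sup>2 \<partial>lborel) - (\<integral>z. (norm (h z))\<^sup>2 \<partial>lborel)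
     - 2 * (\<integral>z. (f z - h z) \<bullet> h z \<partial>lborel)"
proof -
  have i: "integrable lborel (\<lambda>z. (norm (f z))\<^sup>2)" "integrable lborel (\<lambda>z. (norm (h z))\<^sup>2)" "integrable lborel (\<lambda>z. 2 * ((f z - h z) \<bullet> h z))"
    by (rule continuous_vanishing_integrable[OF _ S(1)]; use c S(2) in \<open>auto intro!: continuous_intros\<close>)+
  have "(norm (f z - h z))\<^sup>2 = (norm (f z))\<^sup>2 - (norm (h z))\<^sup>2 - 2 * ((f z - h z) \<bullet> h z)" for z
    by (simp add: power2_norm_eq_inner inner_diff_left inner_diff_right inner_commute)
  then show ?thesis using i by simp
qed

text \<open>The prescribed pairing with \<open>g\<close> survives the limit; this is what later
  tells solutions with different starting points apart.\<close>

lemma box_solution: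
  fixes a b :: spacetime
  assumes X: "subsolution C V0 u0 (box a b) v0 w0" and g: "continuous_on UNIV g" and \<eta>: "\<eta> > 0"
  obtains v u where "solves C V0 u0 (box a b) v u" "\<bar>\<integral>z. (v z - v0 z) \<bullet> g z \<partial>lborel\<bar> \<le> \<eta>"
proof -
  obtain v u where X': "\<And>n. subsolution C V0 u0 (box a b) (v n) (u n)" and v0: "v 0 = v0" "u (0::nat) = w0"
    and close: "\<And>n m. n \<le> m \<Longrightarrow> \<bar>\<integral>z. (v m z - v n z) \<bullet> v n z \<partial>lborel\<bar> \<le> \<eta> * (1 / 2^n - 1 / 2^m)"
    and closeg: "\<And>m. \<bar>\<integral>z. (v m z - v 0 z) \<bullet> g z \<partial>lborel\<bar> \<le> \<eta>"
    and gain: "\<And>n. (\<integral>z. indicator (box a b) z * (C - (norm (V0 + v n z))\<^sup>2)\<^sup>2 \<partial>lborel) / (2^32 * C) \<le> (\<integral>z. (norm (v (Suc n) z - v n z))\<^sup>2 \<partial>lborel)"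
    using subsolution_sequence[OF X g \<eta>] by blast
  let ?Q = "box a b"
  let ?M = "measure lborel ?Q"
  have c: "continuous_on UNIV (v n)" "continuous_on UNIV (u n)" and z0: "\<And>z. z \<notin> ?Q \<Longrightarrow> v n z = 0 \<and> u n z = 0"
    and sol: "solenoidal (v n) (u n)" and sub: "\<And>z. subsol C (V0 + v n z) (u0 + u n z)" for n
    using X'[of n] by (auto simp: subsolution_def)
  have C: "C > 0" using subsol_bounds(5)[OF sub[of 0 undefined]] .
  define B where "B = sqrt C + norm V0"
  have B: "B > 0" using C by (simp add: B_def add_pos_nonneg)
  have vB: "norm (v n z) \<le> B" for n z
    using subsol_bounds(1)[OF sub[of n z]] norm_triangle_ineq4[of "V0 + v n z" V0] by (simp add: B_def)
  define B' where "B' = C + norm u0 + B"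
  have uB: "norm (u n z) \<le> B'" for n z
    using subsol_bounds(2)[OF sub[of n z]] norm_triangle_ineq4[of "u0 + u n z" u0] B by (simp add: B'_def)
  have BB': "B \<le> B'" using C by (simp add: B'_def)
  have bQ: "bounded ?Q" "?Q \<in> sets borel" by auto
  have iQ: "integrable lborel (\<lambda>z. indicator ?Q z * (k::real))" for k by (rule integrable_indicator_bounded[OF bQ])
  define E where "E n = (\<integral>z. (norm (v n z))\<^sup>2 \<partial>lborel)" for n
  have iE: "integrable lborel (\<lambda>z. (norm (v n z))\<^sup>2)" for n
    by (rule continuous_vanishing_integrable[OF _ bQ(1)]) (auto intro!: continuous_intros c simp: z0)
  have EB: "E n \<le> ?M * B\<^sup>2" for n
  proof -
    have "E n \<le> (\<integral>z. indicator ?Q z * B\<^sup>2 \<partial>lborel)"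
      unfolding E_def
    proof (rule integral_mono[OF iE iQ])
      fix z
      show "(norm (v n z))\<^sup>2 \<le> indicator ?Q z * B\<^sup>2"
        using vB[of n z] z0[of z n] by (cases "z \<in> ?Q") (auto intro!: power_mono)
    qed
    then show ?thesis by simp
  qed
  have sq: "(\<integral>z. (norm (v m z - v n z))\<^sup>2 \<partial>lborel) = E m - E n - 2 * (\<integral>z. (v m z - v n z) \<bullet> v n z \<partial>lborel)" for m n
    unfolding E_def by (rule integral_square_diff[OF c(1) c(1) bQ(1)]) (use z0 in auto)
  have sq': "(\<integral>z. (norm (v m z - v n z))\<^sup>2 \<partial>lborel) \<le> (E m - 2 * \<eta> / 2^m) - (E n - 2 * \<eta> / 2^n)" if "n \<le> m" for m n
  proof -
    have "\<eta> * (1 / 2^n - 1 / 2^m) = \<eta> / 2^n - \<eta> / 2^m" "2 * \<eta> / 2^m = 2 * (\<eta> / 2^m)" "2 * \<eta> / 2^n = 2 * (\<eta> / 2^n)"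
      by (simp_all add: right_diff_distrib)
    then show ?thesis using sq[of m n] close[OF that] by linarith
  qed
  \<comment> \<open>The energies themselves need not be monotone. Subtracting the remaining
    orthogonality defect makes them so, and then the increments of \<open>F\<close> dominate the
    squared \<open>L^2\<close> distances.\<close>
  define F where "F n = E n - 2 * \<eta> / 2^n" for n
  have "convergent F"
  proof -
    have "incseq F"
    proof (rule incseq_SucI)
      fix n
      have "0 \<le> (\<integral>z. (norm (v (Suc n) z - v n z))\<^sup>2 \<partial>lborel)" by simp
      then show "F n \<le> F (Suc n)" using sq'[of n "Suc n"] unfolding F_def by linarith
    qed
    moreover have "F n \<le> ?M * B\<^sup>2" for n
    proof -
      have "0 \<le> 2 * \<eta> / 2^n" using \<eta> by simp
      then show ?thesis using EB[of n] unfolding F_def by linarith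
    qed
    ultimately obtain l where "F \<longlonglongrightarrow> l" using incseq_convergent[of F "?M * B\<^sup>2"] by blast
    then show ?thesis by (rule convergentI)
  qed
  then have CF: "Cauchy F" by (rule convergent_Cauchy)
  have L2: "\<exists>N. \<forall>i\<ge>N. \<forall>j\<ge>N. (\<integral>z. (norm (v i z - v j z))\<^sup>2 \<partial>lborel) < e" if "e > 0" for e
  proof -
    obtain N where N: "\<And>i j. i \<ge> N \<Longrightarrow> j \<ge> N \<Longrightarrow> norm (F i - F j) < e"
      using CauchyD[OF CF \<open>e > 0\<close>] by blast
    have "(\<integral>z. (norm (v i z - v j z))\<^sup>2 \<partial>lborel) < e" if "i \<ge> N" "j \<ge> N" for i j
    proof (cases "j \<le> i")
      case True
      then show ?thesis using sq'[OF True] N[OF that] unfolding F_def by simp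
    next
      case False
      then have "i \<le> j" by simp
      from sq'[OF this] N[OF that] show ?thesis unfolding F_def by (simp add: norm_minus_commute)
    qed
    then show ?thesis by blast
  qed
  have L1: "\<exists>N. \<forall>i\<ge>N. \<forall>j\<ge>N. (\<integral>z. norm (v i z - v j z) \<partial>lborel) < e" if "e > 0" for e
  proof -
    define d where "d = e / (2 * (?M + 1))"
    have M0: "?M + 1 > 0" by (simp add: add_nonneg_pos)
    have d: "d > 0" using \<open>e > 0\<close> M0 by (simp add: d_def)
    have dM: "d * ?M \<le> e / 2"
    proof -
      have "d * ?M \<le> d * (?M + 1)" using d by (intro mult_left_mono) auto
      also have "\<dots> = e / 2" using M0 by (simp add: d_def field_simps)
      finally show ?thesis .
    qed
    have "d * e / 2 > 0" using d \<open>e > 0\<close> by simp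
    from L2[OF this] obtain N where N: "\<And>i j. i \<ge> N \<Longrightarrow> j \<ge> N \<Longrightarrow> (\<integral>z. (norm (v i z - v j z))\<^sup>2 \<partial>lborel) < d * e / 2" by blast
    have "(\<integral>z. norm (v i z - v j z) \<partial>lborel) < e" if "i \<ge> N" "j \<ge> N" for i j
    proof -
      have "(\<integral>z. norm (v i z - v j z) \<partial>lborel) \<le> d * ?M + (\<integral>z. (norm (v i z - v j z))\<^sup>2 \<partial>lborel) / d"
        by (rule integral_norm_le_square[OF _ bQ _ d]) (auto intro!: continuous_intros c simp: z0)
      moreover have "(\<integral>z. (norm (v i z - v j z))\<^sup>2 \<partial>lborel) / d < e / 2"
        using N[OF that] d by (simp add: field_simps)
      ultimately show ?thesis using dM by linarith
    qed
    then show ?thesis by blast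
  qed
  have iv: "integrable lborel (v n)" for n
    by (rule continuous_vanishing_integrable[OF c(1) bQ(1)]) (use z0 in auto)
  obtain r where r: "strict_mono r" "AE z in lborel. Cauchy (\<lambda>i. v (r i) z)"
    using cauchy_L1_AE_cauchy_subseq[OF iv L1] by blast
  have mv[measurable]: "v n \<in> borel_measurable borel" and mu[measurable]: "u n \<in> borel_measurable borel" for n
    using c by (auto intro: borel_measurable_continuous_onI)
  \<comment> \<open>Where the subsequence fails to be Cauchy the value 0 is used, so that the bound
    on \<open>V0 + w\<close> holds everywhere; this is the reason for the summand
    \<open>norm V0\<close> in \<open>solves\<close>.\<close>
  define w where "w z = (if Cauchy (\<lambda>i. v (r i) z) then lim (\<lambda>i. v (r i) z) else 0)" for z
  \<comment> \<open>Defined by the constraint, not as a limit. It is identified with the limit of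
    \<open>u\<close> only after the gap is known to vanish, because
    \<open>norm (V^2 - 2 * u) \<le> C - |V|^2\<close> for every stage.\<close>
  define y where "y z = (if z \<in> ?Q then (V0 + w z)\<^sup>2 / 2 - u0 else 0)" for z
  have mw[measurable]: "w \<in> borel_measurable borel" unfolding w_def by measurable
  have my[measurable]: "y \<in> borel_measurable borel" unfolding y_def by measurable
  have limv: "AE z in lborel. (\<lambda>i. v (r i) z) \<longlonglongrightarrow> w z"
    using r(2) by eventually_elim (auto simp: w_def Cauchy_convergent_iff convergent_LIMSEQ_iff)
  have wz: "w z = 0" if "z \<notin> ?Q" for z
    using z0[OF that] by (auto simp: w_def)
  have limC: "norm (V0 + w z) \<le> sqrt C + norm V0" for z
  proof (cases "Cauchy (\<lambda>i. v (r i) z)")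
    case True
    then have "(\<lambda>i. v (r i) z) \<longlonglongrightarrow> w z" by (simp add: w_def Cauchy_convergent_iff convergent_LIMSEQ_iff)
    then have "(\<lambda>i. norm (V0 + v (r i) z)) \<longlonglongrightarrow> norm (V0 + w z)" by (intro tendsto_intros)
    then have "norm (V0 + w z) \<le> sqrt C" by (rule LIMSEQ_le_const2) (use subsol_bounds(1)[OF sub] in auto)
    then show ?thesis by (simp add: add_increasing2)
  next
    case False
    then show ?thesis using C by (simp add: w_def)
  qed
  have "AE z in lborel. z \<in> ?Q \<longrightarrow> (norm (V0 + w z))\<^sup>2 = C"
  proof -
    \<comment> \<open>The squared gap integral has two limits along the subsequence: that of the
      limit field by dominated convergence, and 0, because it is bounded by a constant times a
      single increment of the convergent sequence \<open>F\<close>.\<close>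
    have "(\<lambda>i. \<integral>z. indicator ?Q z * (C - (norm (V0 + v (r i) z))\<^sup>2)\<^sup>2 \<partial>lborel) \<longlonglongrightarrow> (\<integral>z. indicator ?Q z * (C - (norm (V0 + w z))\<^sup>2)\<^sup>2 \<partial>lborel)"
    proof (rule integral_dominated_convergence[where w="\<lambda>z. indicator ?Q z * C\<^sup>2"])
      show "AE z in lborel. (\<lambda>i. indicator ?Q z * (C - (norm (V0 + v (r i) z))\<^sup>2)\<^sup>2) \<longlonglongrightarrow> indicator ?Q z * (C - (norm (V0 + w z))\<^sup>2)\<^sup>2"
        using limv by eventually_elim (intro tendsto_intros)
      show "AE z in lborel. norm (indicator ?Q z * (C - (norm (V0 + v (r i) z))\<^sup>2)\<^sup>2) \<le> indicator ?Q z * C\<^sup>2" for i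
      proof (rule AE_I2)
        fix z
        have "(C - (norm (V0 + v (r i) z))\<^sup>2)\<^sup>2 \<le> C\<^sup>2"
          using subsol_bounds(3)[OF sub[of "r i" z]] by (intro power_mono) auto
        then show "norm (indicator ?Q z * (C - (norm (V0 + v (r i) z))\<^sup>2)\<^sup>2) \<le> indicator ?Q z * C\<^sup>2"
          by (cases "z \<in> ?Q") auto
      qed
    qed (use iQ in simp_all)
    moreover have "(\<lambda>i. \<integral>z. indicator ?Q z * (C - (norm (V0 + v (r i) z))\<^sup>2)\<^sup>2 \<partial>lborel) \<longlonglongrightarrow> 0"
    proof (rule tendsto_sandwich[of "\<lambda>_. 0" _ _ "\<lambda>i. 2^32 * C * (F (Suc (r i)) - F (r i))"])
      show "\<forall>\<^sub>F i in sequentially. 0 \<le> (\<integral>z. indicator ?Q z * (C - (norm (V0 + v (r i) z))\<^sup>2)\<^sup>2 \<partial>lborel)"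
        by (intro always_eventually allI Bochner_Integration.integral_nonneg) auto
      show "\<forall>\<^sub>F i in sequentially. (\<integral>z. indicator ?Q z * (C - (norm (V0 + v (r i) z))\<^sup>2)\<^sup>2 \<partial>lborel) \<le> 2^32 * C * (F (Suc (r i)) - F (r i))"
      proof (intro always_eventually allI)
        fix i
        have "(\<integral>z. indicator ?Q z * (C - (norm (V0 + v (r i) z))\<^sup>2)\<^sup>2 \<partial>lborel) / (2^32 * C) \<le> F (Suc (r i)) - F (r i)"
          using gain[of "r i"] sq'[of "r i" "Suc (r i)"] unfolding F_def by linarith
        then show "(\<integral>z. indicator ?Q z * (C - (norm (V0 + v (r i) z))\<^sup>2)\<^sup>2 \<partial>lborel) \<le> 2^32 * C * (F (Suc (r i)) - F (r i))"
          using C by (simp add: divide_le_eq mult.commute)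
      qed
      obtain l where l: "F \<longlonglongrightarrow> l" using \<open>convergent F\<close> by (auto simp: convergent_def)
      have "(\<lambda>i. F (r i)) \<longlonglongrightarrow> l" "(\<lambda>i. F (Suc (r i))) \<longlonglongrightarrow> l"
        using LIMSEQ_subseq_LIMSEQ[OF l r(1)] LIMSEQ_subseq_LIMSEQ[OF LIMSEQ_Suc[OF l] r(1)] by (simp_all add: o_def)
      then have "(\<lambda>i. 2^32 * C * (F (Suc (r i)) - F (r i))) \<longlonglongrightarrow> 2^32 * C * (l - l)" by (intro tendsto_intros)
      then show "(\<lambda>i. 2^32 * C * (F (Suc (r i)) - F (r i))) \<longlonglongrightarrow> 0" by simp
    qed simp
    ultimately have int0: "(\<integral>z. indicator ?Q z * (C - (norm (V0 + w z))\<^sup>2)\<^sup>2 \<partial>lborel) = 0"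
      using LIMSEQ_unique by blast
    have "(C - (norm (V0 + w z))\<^sup>2)\<^sup>2 \<le> (C + (sqrt C + norm V0)\<^sup>2)\<^sup>2" for z
    proof -
      have "(norm (V0 + w z))\<^sup>2 \<le> (sqrt C + norm V0)\<^sup>2" using limC by (intro power_mono) auto
      then have "\<bar>C - (norm (V0 + w z))\<^sup>2\<bar> \<le> C + (sqrt C + norm V0)\<^sup>2"
        using C zero_le_power2[of "norm (V0 + w z)"] by linarith
      then show ?thesis by (metis abs_ge_zero power2_abs power_mono)
    qed
    then have "integrable lborel (\<lambda>z. indicator ?Q z * (C - (norm (V0 + w z))\<^sup>2)\<^sup>2)"
      by (intro Bochner_Integration.integrable_bound[OF iQ[of "(C + (sqrt C + norm V0)\<^sup>2)\<^sup>2"]]) (auto simp: indicator_def)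
    then have "AE z in lborel. indicator ?Q z * (C - (norm (V0 + w z))\<^sup>2)\<^sup>2 = 0"
      using integral_nonneg_eq_0_iff_AE[of lborel "\<lambda>z. indicator ?Q z * (C - (norm (V0 + w z))\<^sup>2)\<^sup>2"] int0 by simp
    then show ?thesis by eventually_elim auto
  qed
  moreover have "2 * (u0 + y z) = (V0 + w z)\<^sup>2" if "z \<in> ?Q" for z
    using that by (simp add: y_def)
  ultimately have onQ: "AE z in lborel. z \<in> ?Q \<longrightarrow> (norm (V0 + w z))\<^sup>2 = C \<and> 2 * (u0 + y z) = (V0 + w z)\<^sup>2"
    by simp
  have limu: "AE z in lborel. (\<lambda>i. u (r i) z) \<longlonglongrightarrow> y z"
    using limv onQ
  proof eventually_elim
    case (elim z)
    show ?case
    proof (cases "z \<in> ?Q")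
      case True
      have "(\<lambda>i. C - (norm (V0 + v (r i) z))\<^sup>2) \<longlonglongrightarrow> C - (norm (V0 + w z))\<^sup>2"
        using elim(1) by (intro tendsto_intros)
      then have "(\<lambda>i. C - (norm (V0 + v (r i) z))\<^sup>2) \<longlonglongrightarrow> 0" using elim(2) True by simp
      then have "(\<lambda>i. (V0 + v (r i) z)\<^sup>2 - 2 * (u0 + u (r i) z)) \<longlonglongrightarrow> 0"
        by (rule Lim_null_comparison[rotated]) (use subsol_bounds(4)[OF sub] in auto)
      then have "(\<lambda>i. ((V0 + v (r i) z)\<^sup>2 - ((V0 + v (r i) z)\<^sup>2 - 2 * (u0 + u (r i) z))) / 2 - u0) \<longlonglongrightarrow> ((V0 + w z)\<^sup>2 - 0) / 2 - u0"
        using elim(1) by (intro tendsto_intros) auto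
      moreover have "(k - (k - 2 * (u0 + x))) / 2 - u0 = x" for k x :: complex
        by (simp add: add_divide_distrib)
      ultimately show ?thesis using True by (simp only: y_def if_True diff_zero)
    next
      case False
      then show ?thesis using z0[OF False] by (simp add: y_def)
    qed
  qed
  have yz: "y z = 0" if "z \<notin> ?Q" for z using that by (simp add: y_def)
  have sol': "solenoidal w y"
    unfolding solenoidal_def
  proof (intro conjI)
    have B0: "0 \<le> B'" using BB' B by simp
    have vB': "norm (v n z) \<le> B'" for n z using vB BB' order_trans by blast
    show "divfree (\<lambda>_. 0) w"
      by (rule divfree_limit[of "\<lambda>_ _. 0" "\<lambda>i. v (r i)", OF _ _ _ _ _ bQ(1), of _ _ B'])
        (use sol limv vB' B0 z0 in \<open>auto simp: solenoidal_def\<close>)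
    show "divfree (\<lambda>z. Re (w z)) y"
    proof (rule divfree_limit[of "\<lambda>i z. Re (v (r i) z)" "\<lambda>i. u (r i)", OF _ _ _ _ _ bQ(1), of _ _ B'])
      show "\<bar>Re (v (r i) z)\<bar> \<le> B' \<and> norm (u (r i) z) \<le> B'" for i z
        using vB'[of "r i" z] uB abs_Re_le_cmod order_trans by blast
      show "AE z in lborel. (\<lambda>i. Re (v (r i) z)) \<longlonglongrightarrow> Re (w z) \<and> (\<lambda>i. u (r i) z) \<longlonglongrightarrow> y z"
        using limv limu by eventually_elim (auto intro: tendsto_intros)
    qed (use sol z0 in \<open>auto simp: solenoidal_def\<close>)
    show "divfree (\<lambda>z. Im (w z)) (\<lambda>z. - \<i> * y z)"
    proof (rule divfree_limit[of "\<lambda>i z. Im (v (r i) z)" "\<lambda>i z. - \<i> * u (r i) z", OF _ _ _ _ _ bQ(1), of _ _ B'])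
      show "\<bar>Im (v (r i) z)\<bar> \<le> B' \<and> norm (- \<i> * u (r i) z) \<le> B'" for i z
        using vB'[of "r i" z] uB[of "r i" z] abs_Im_le_cmod[of "v (r i) z"] by (simp add: norm_mult)
      show "AE z in lborel. (\<lambda>i. Im (v (r i) z)) \<longlonglongrightarrow> Im (w z) \<and> (\<lambda>i. - \<i> * u (r i) z) \<longlonglongrightarrow> - \<i> * y z"
        using limv limu by eventually_elim (intro conjI tendsto_intros)
    qed (use sol z0 in \<open>auto simp: solenoidal_def\<close>)
  qed
  have yB: "norm (u0 + y z) \<le> C + (norm V0)\<^sup>2 + norm u0" for z
  proof (cases "z \<in> ?Q")
    case True
    then have "norm (u0 + y z) = (norm (V0 + w z))\<^sup>2 / 2" by (simp add: y_def norm_divide norm_power)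
    also have "\<dots> \<le> (sqrt C + norm V0)\<^sup>2 / 2" using limC[of z] by (intro divide_right_mono power_mono) auto
    also have "\<dots> \<le> C + (norm V0)\<^sup>2"
      using sum_squares_bound[of "sqrt C" "norm V0"] C by (simp add: power2_sum)
    finally show ?thesis by (simp add: add_increasing2)
  next
    case False
    then show ?thesis using C by (simp add: yz)
  qed
  show ?thesis
  proof (rule that[of w y])
    show "solves C V0 u0 (box a b) w y"
      unfolding solves_def using mw my wz yz sol' limC yB onQ by blast
    have mg: "g \<in> borel_measurable borel" using g by (rule borel_measurable_continuous_onI)
    have "continuous_on (cbox a b) (\<lambda>z. norm (g z))" using g by (intro continuous_intros) (auto intro: continuous_on_subset)
    then have "bounded ((\<lambda>z. norm (g z)) ` cbox a b)" by (intro compact_imp_bounded compact_continuous_image compact_cbox)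
    then obtain L where L: "L > 0" "\<forall>y\<in>(\<lambda>z. norm (g z)) ` cbox a b. norm y \<le> L" unfolding bounded_pos by blast
    have gL: "norm (g z) \<le> L" if "z \<in> ?Q" for z
      using L(2)[rule_format, OF imageI[OF subsetD[OF box_subset_cbox that]]] by simp
    have "(\<lambda>i. \<integral>z. (v (r i) z - v0 z) \<bullet> g z \<partial>lborel) \<longlonglongrightarrow> (\<integral>z. (w z - v0 z) \<bullet> g z \<partial>lborel)"
    proof (rule integral_dominated_convergence[where w="\<lambda>z. indicator ?Q z * ((B + B) * L)"])
      show "AE z in lborel. (\<lambda>i. (v (r i) z - v0 z) \<bullet> g z) \<longlonglongrightarrow> (w z - v0 z) \<bullet> g z"
        using limv by eventually_elim (intro tendsto_intros)
      show "AE z in lborel. norm ((v (r i) z - v0 z) \<bullet> g z) \<le> indicator ?Q z * ((B + B) * L)" for i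
      proof (rule AE_I2)
        fix z
        show "norm ((v (r i) z - v0 z) \<bullet> g z) \<le> indicator ?Q z * ((B + B) * L)"
        proof (cases "z \<in> ?Q")
          case True
          have "norm (v (r i) z - v0 z) \<le> B + B"
            using vB[of "r i" z] vB[of 0 z] norm_triangle_ineq4[of "v (r i) z" "v0 z"] unfolding v0(1) by linarith
          then have "norm (v (r i) z - v0 z) * norm (g z) \<le> (B + B) * L"
            using gL[OF True] B by (intro mult_mono) auto
          then show ?thesis using Cauchy_Schwarz_ineq2[of "v (r i) z - v0 z" "g z"] True by simp
        next
          case False
          then show ?thesis using z0[OF False] v0 by (metis (no_types, lifting) diff_zero indicator_simps(2) inner_zero_left lambda_zero mult_zero_left norm_zero order_refl)
        qed
      qed
      show "(\<lambda>z. (w z - v0 z) \<bullet> g z) \<in> borel_measurable lborel"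
        using mw mv[of 0] mg v0 by (simp add: borel_measurable_inner borel_measurable_diff)
      show "(\<lambda>z. (v (r i) z - v0 z) \<bullet> g z) \<in> borel_measurable lborel" for i
        using mv[of "r i"] mv[of 0] mg v0 by (simp add: borel_measurable_inner borel_measurable_diff)
    qed (rule iQ)
    then have "(\<lambda>i. \<bar>\<integral>z. (v (r i) z - v0 z) \<bullet> g z \<partial>lborel\<bar>) \<longlonglongrightarrow> \<bar>\<integral>z. (w z - v0 z) \<bullet> g z \<partial>lborel\<bar>"
      by (rule tendsto_rabs)
    then show "\<bar>\<integral>z. (w z - v0 z) \<bullet> g z \<partial>lborel\<bar> \<le> \<eta>"
      by (rule LIMSEQ_le_const2) (use closeg v0 in auto)
  qed
qed

section \<open>Patching over an unbounded open set\<close>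

text \<open>One perturbation step from 0 produces a nonzero subsolution \<open>h\<close> with energy
  \<open>J\<close>. Solutions are then built from 0 and from \<open>h\<close>, both with pairing
  against \<open>h\<close> preserved up to \<open>J / 4\<close>: the first pairs with
  \<open>h\<close> to at most \<open>J / 4\<close>, the second to at least
  \<open>3 * J / 4\<close>.\<close>

lemma two_box_solutions:
  fixes a b :: spacetime
  assumes sub: "subsol C V0 u0" and ne: "box a b \<noteq> {}"
  obtains v u v' u' where "solves C V0 u0 (box a b) v u" "solves C V0 u0 (box a b) v' u'" "\<not> (AE z in lborel. v z = v' z)"
proof -
  let ?Q = "box a b"
  have C: "C > 0" using subsol_bounds[OF sub] by blast
  have X0: "subsolution C V0 u0 ?Q (\<lambda>_. 0) (\<lambda>_. 0)"
    using sub by (simp add: subsolution_def solenoidal_zero)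
  obtain h y where h: "subsolution C V0 u0 ?Q h y"
    and gain: "(\<integral>z. indicator ?Q z * (C - (norm (V0 + 0))\<^sup>2)\<^sup>2 \<partial>lborel) / (2^32 * C) \<le> (\<integral>z. (norm (h z - 0))\<^sup>2 \<partial>lborel)"
    using perturbation_step[OF X0, of "{}" 1] by auto
  define J where "J = (\<integral>z. (norm (h z))\<^sup>2 \<partial>lborel)"
  have ch: "continuous_on UNIV h" and hz: "\<And>z. z \<notin> ?Q \<Longrightarrow> h z = 0" using h by (auto simp: subsolution_def)
  have "measure lborel ?Q > 0"
    using ne by (auto simp: measure_lborel_box_eq box_ne_empty inner_diff_left intro!: prod_pos less_imp_le)
  moreover have "C - (norm V0)\<^sup>2 > 0" using sub norm_ge_zero[of "V0\<^sup>2 - 2 * u0"] unfolding subsol_def by linarith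
  ultimately have "measure lborel ?Q * (C - (norm V0)\<^sup>2)\<^sup>2 / (2^32 * C) > 0" using C by simp
  moreover have "measure lborel ?Q * (C - (norm V0)\<^sup>2)\<^sup>2 / (2^32 * C) \<le> J"
    using gain by (simp add: J_def)
  ultimately have J: "J > 0" by linarith
  obtain v u where v: "solves C V0 u0 ?Q v u" "\<bar>\<integral>z. (v z - 0) \<bullet> h z \<partial>lborel\<bar> \<le> J / 4"
    using box_solution[OF X0 ch, of "J/4"] J by (metis divide_pos_pos zero_less_numeral)
  obtain v' u' where v': "solves C V0 u0 ?Q v' u'" "\<bar>\<integral>z. (v' z - h z) \<bullet> h z \<partial>lborel\<bar> \<le> J / 4"
    using box_solution[OF h ch, of "J/4"] J by (metis divide_pos_pos zero_less_numeral)
  have "\<not> (AE z in lborel. v z = v' z)"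
  proof
    assume ae: "AE z in lborel. v z = v' z"
    have mv: "v \<in> borel_measurable borel" "v' \<in> borel_measurable borel" using v(1) v'(1) by (auto simp: solves_def)
    have mh: "h \<in> borel_measurable borel" using ch by (rule borel_measurable_continuous_onI)
    have "(\<integral>z. v z \<bullet> h z \<partial>lborel) = (\<integral>z. v' z \<bullet> h z \<partial>lborel)"
      by (rule integral_cong_AE) (use ae mv mh in auto)
    moreover have "(\<integral>z. (v' z - h z) \<bullet> h z \<partial>lborel) = (\<integral>z. v' z \<bullet> h z \<partial>lborel) - J"
    proof -
      obtain L where L: "\<And>z. norm (h z) \<le> L"
        using continuous_vanishing_bounded[OF ch bounded_box hz] by metis
      have i: "integrable lborel (\<lambda>z. v' z \<bullet> h z)"
      proof (rule Bochner_Integration.integrable_bound)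
        show "integrable lborel (\<lambda>z. indicator ?Q z * ((sqrt C + norm V0 + norm V0) * L))"
          by (rule integrable_indicator_bounded) auto
        show "AE z in lborel. norm (v' z \<bullet> h z) \<le> norm (indicator ?Q z * ((sqrt C + norm V0 + norm V0) * L))"
        proof (rule AE_I2)
          fix z
          have "norm (v' z) \<le> norm (V0 + v' z) + norm V0" using norm_triangle_ineq4[of "V0 + v' z" V0] by simp
          also have "norm (V0 + v' z) \<le> sqrt C + norm V0" using v'(1) unfolding solves_def by blast
          finally have "norm (v' z) * norm (h z) \<le> (sqrt C + norm V0 + norm V0) * L" using L[of z] C by (intro mult_mono add_nonneg_nonneg) auto
          then have "\<bar>v' z \<bullet> h z\<bar> \<le> (sqrt C + norm V0 + norm V0) * L" using Cauchy_Schwarz_ineq2 order_trans by blast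
          then show "norm (v' z \<bullet> h z) \<le> norm (indicator ?Q z * ((sqrt C + norm V0 + norm V0) * L))"
            using hz[of z] by (cases "z \<in> ?Q") auto
        qed
      qed (use mv mh in auto)
      have i': "integrable lborel (\<lambda>z. (norm (h z))\<^sup>2)"
        by (rule continuous_vanishing_integrable[OF _ bounded_box]) (use ch hz in \<open>auto intro!: continuous_intros\<close>)
      show ?thesis unfolding J_def
        by (subst Bochner_Integration.integral_diff[OF i i', symmetric]) (simp add: inner_diff_left power2_norm_eq_inner)
    qed
    ultimately show False using v(2) v'(2) J by simp
  qed
  with v(1) v'(1) show ?thesis by (rule that)
qed

text \<open>\<open>covering_lemma\<close> works inside one bounded box, so it is applied in each
  cell of the unit grid; boxes from different cells are separated by the integer parts of their
  points. Unboundedness forces infinitely many boxes.\<close>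

lemma box_tiling:
  fixes \<Omega> :: "spacetime set"
  assumes op: "open \<Omega>" and unb: "\<not> bounded \<Omega>"
  obtains a b :: "nat \<Rightarrow> spacetime" where "\<And>n. box (a n) (b n) \<noteq> {}"
    "\<And>m n. m \<noteq> n \<Longrightarrow> box (a m) (b m) \<inter> box (a n) (b n) = {}" "\<Omega> = (\<Union>n. cbox (a n) (b n))"
proof -
  define lo :: "int \<times> int \<times> int \<Rightarrow> spacetime" where
    "lo k = (vector [of_int (fst k), of_int (fst (snd k))], of_int (snd (snd k)))" for k
  define hi :: "int \<times> int \<times> int \<Rightarrow> spacetime" where
    "hi k = (vector [of_int (fst k) + 1, of_int (fst (snd k)) + 1], of_int (snd (snd k)) + 1)" for k
  define fl where "fl z = (\<lfloor>fst z $ 1\<rfloor>, \<lfloor>fst z $ 2\<rfloor>, \<lfloor>snd z\<rfloor>)" for z :: spacetime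
  have fl1: "z \<in> cbox (lo (fl z)) (hi (fl z))" for z
    unfolding mem_cbox_spacetime lo_def hi_def fl_def by (simp add: less_imp_le)
  have fl2: "fl z = k" if "z \<in> box (lo k) (hi k)" for z k
    using that unfolding mem_box_spacetime lo_def hi_def fl_def by (cases k) (auto intro!: floor_unique)
  have lne: "box (lo k) (hi k) \<noteq> {}" for k
  proof -
    have "lo k + (hi k - lo k) /\<^sub>R 2 \<in> box (lo k) (hi k)"
      unfolding mem_box_spacetime lo_def hi_def by (cases k) simp
    then show ?thesis by blast
  qed
  obtain r where r: "\<And>x. x \<in> \<Omega> \<Longrightarrow> r x > 0 \<and> ball x (r x) \<subseteq> \<Omega>"
    using op unfolding open_contains_ball by metis
  \<comment> \<open>Inside \<open>\<Omega>\<close> the gauge keeps the covering boxes within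
    \<open>\<Omega>\<close>; the radius 1 elsewhere merely makes it total.\<close>
  define \<gamma> where "\<gamma> x = ball x (if x \<in> \<Omega> then r x else 1)" for x
  have g: "gauge \<gamma>" unfolding \<gamma>_def by (rule gauge_ball_dependent) (use r in auto)
  have "\<exists>D. countable D \<and> (\<forall>K\<in>D. K \<subseteq> cbox (lo k) (hi k) \<and> K \<subseteq> \<Omega> \<and> interior K \<noteq> {} \<and> (\<exists>c d. K = cbox c d)) \<and>
    pairwise (\<lambda>A B. interior A \<inter> interior B = {}) D \<and> \<Omega> \<inter> cbox (lo k) (hi k) \<subseteq> \<Union>D" for k
  proof (rule covering_lemma[of "\<Omega> \<inter> cbox (lo k) (hi k)" "lo k" "hi k" \<gamma>], goal_cases)
    case (4 D)
    have "K \<subseteq> \<Omega>" if K: "K \<in> D" for K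
    proof -
      obtain x where "x \<in> \<Omega>" "K \<subseteq> \<gamma> x" using 4(5)[OF K] by auto
      then show ?thesis using r[of x] by (auto simp: \<gamma>_def)
    qed
    then show ?case using 4 by (intro exI[of _ D]) (auto simp: Sup_le_iff)
  qed (use lne g in auto)
  then obtain D where D: "\<And>k. countable (D k)" "\<And>k K. K \<in> D k \<Longrightarrow> K \<subseteq> cbox (lo k) (hi k) \<and> K \<subseteq> \<Omega> \<and> interior K \<noteq> {} \<and> (\<exists>c d. K = cbox c d)"
    "\<And>k. pairwise (\<lambda>A B. interior A \<inter> interior B = {}) (D k)" "\<And>k. \<Omega> \<inter> cbox (lo k) (hi k) \<subseteq> \<Union>(D k)"
    by metis
  define E where "E = (\<Union>k. D k)"
  have cE: "countable E" unfolding E_def using D(1) by auto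
  have un: "\<Union>E = \<Omega>"
  proof
    show "\<Union>E \<subseteq> \<Omega>" using D(2) unfolding E_def by blast
    show "\<Omega> \<subseteq> \<Union>E"
    proof
      fix z assume "z \<in> \<Omega>"
      then have "z \<in> \<Union>(D (fl z))" using D(4)[of "fl z"] fl1[of z] by blast
      then show "z \<in> \<Union>E" unfolding E_def by blast
    qed
  qed
  have "infinite E"
  proof
    assume "finite E"
    moreover have "bounded K" if "K \<in> E" for K
      using D(2) that bounded_cbox unfolding E_def by (metis UN_E)
    ultimately have "bounded (\<Union>E)" using bounded_Union by blast
    then show False using un unb by simp
  qed
  then obtain f :: "nat \<Rightarrow> spacetime set" where f: "bij_betw f UNIV E"
    using cE bij_betw_from_nat_into by blast
  have fE: "f n \<in> E" for n using f by (auto simp: bij_betw_def)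
  then have "\<exists>c d. f n = cbox c d" for n using D(2) unfolding E_def by blast
  then obtain a b where ab: "\<And>n. f n = cbox (a n) (b n)" by metis
  show ?thesis
  proof (rule that[of a b])
    have int: "interior (f n) = box (a n) (b n)" for n by (simp add: ab interior_cbox)
    show "box (a n) (b n) \<noteq> {}" for n
      using fE[of n] D(2) int[of n] unfolding E_def by auto
    show "box (a m) (b m) \<inter> box (a n) (b n) = {}" if "m \<noteq> n" for m n
    proof (rule ccontr)
      assume "box (a m) (b m) \<inter> box (a n) (b n) \<noteq> {}"
      then obtain z where z: "z \<in> interior (f m)" "z \<in> interior (f n)" by (auto simp: int)
      obtain k l where k: "f m \<in> D k" "f n \<in> D l" using fE unfolding E_def by blast
      have "z \<in> box (lo k) (hi k)" "z \<in> box (lo l) (hi l)"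
        using z D(2)[OF k(1)] D(2)[OF k(2)] interior_mono[of "f m" "cbox (lo k) (hi k)"] interior_mono[of "f n" "cbox (lo l) (hi l)"]
        by (auto simp: interior_cbox)
      then have "k = l" using fl2 by metis
      moreover have "f m \<noteq> f n" using f that by (auto simp: bij_betw_def inj_on_def)
      ultimately show False using D(3)[of k] k z unfolding pairwise_def by blast
    qed
    show "\<Omega> = (\<Union>n. cbox (a n) (b n))"
      using un f by (auto simp: ab[symmetric] bij_betw_def)
  qed
qed

text \<open>Fields patched over an unbounded set need not be integrable, hence the restriction to
  gradients of bounded support. Mean zero can no longer be deduced.\<close>

definition local_divfree :: "(spacetime \<Rightarrow> real) \<Rightarrow> (spacetime \<Rightarrow> complex) \<Rightarrow> bool" where
  "local_divfree q w \<longleftrightarrow> (\<forall>\<psi> G. C1_grad \<psi> G \<and> bounded {z. G z \<noteq> 0} \<longrightarrow>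
     (\<integral>z. w z \<bullet> space_part (G z) + q z * snd (G z) \<partial>lborel) = 0)"

text \<open>At each point at most one term is nonzero, so partial sums take only the value 0 or that
  of a single term. This gives the common bound needed for dominated convergence in
  \<open>divfree_patch\<close>.\<close>

lemma disjoint_family_sums:
  fixes f :: "nat \<Rightarrow> 'a \<Rightarrow> 'b::real_normed_vector"
  assumes z0: "\<And>n. z \<notin> Q n \<Longrightarrow> f n z = 0" and disj: "\<And>m n. m \<noteq> n \<Longrightarrow> Q m \<inter> Q n = {}"
  shows "(\<lambda>n. f n z) sums (\<Sum>n. f n z)" "z \<in> Q k \<Longrightarrow> (\<Sum>n. f n z) = f k z"
    "(\<And>n. z \<notin> Q n) \<Longrightarrow> (\<Sum>n. f n z) = 0" "(\<Sum>n<N. f n z) = 0 \<or> (\<exists>k. (\<Sum>n<N. f n z) = f k z)"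
    "(\<Sum>n. f n z) = 0 \<or> (\<exists>k. (\<Sum>n. f n z) = f k z)"
proof -
  have one: "f n z = 0" if "z \<in> Q k" "n \<noteq> k" for n k
    using z0[of n] disj[OF that(2)] that(1) by blast
  have s: "(\<lambda>n. f n z) sums f k z" if "z \<in> Q k" for k
    using sums_finite[of "{k}" "\<lambda>n. f n z"] one[OF that] by simp
  have s0: "(\<lambda>n. f n z) sums 0" if "\<And>n. z \<notin> Q n" using z0 that by simp
  show sm: "(\<lambda>n. f n z) sums (\<Sum>n. f n z)"
    using s s0 by (metis sums_summable summable_sums)
  show eq: "(\<Sum>n. f n z) = f k z" if "z \<in> Q k" for k using sums_unique[OF s[OF that]] by simp
  show eq0: "(\<Sum>n. f n z) = 0" if "\<And>n. z \<notin> Q n" using sums_unique[OF s0[OF that]] by simp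
  show "(\<Sum>n<N. f n z) = 0 \<or> (\<exists>k. (\<Sum>n<N. f n z) = f k z)"
  proof (cases "\<exists>k<N. z \<in> Q k")
    case True
    then obtain k where k: "k < N" "z \<in> Q k" by blast
    then have "(\<Sum>n<N. f n z) = f k z"
      using one[OF k(2)] by (subst sum.remove[of _ k]) (auto intro!: sum.neutral)
    then show ?thesis by blast
  next
    case False
    then have "(\<Sum>n<N. f n z) = 0" using z0 by (intro sum.neutral) auto
    then show ?thesis by blast
  qed
  show "(\<Sum>n. f n z) = 0 \<or> (\<exists>k. (\<Sum>n. f n z) = f k z)" using eq eq0 by blast
qed

lemma divfree_patch:
  fixes q :: "nat \<Rightarrow> spacetime \<Rightarrow> real"
  assumes df: "\<And>n. divfree (q n) (w n)"
    and m: "\<And>i. q i \<in> borel_measurable borel" "\<And>i. w i \<in> borel_measurable borel"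
    and z0: "\<And>n z. z \<notin> Q n \<Longrightarrow> q n z = 0 \<and> w n z = 0" and disj: "\<And>m n. m \<noteq> n \<Longrightarrow> Q m \<inter> Q n = {}"
    and B: "\<And>i z. \<bar>q i z\<bar> \<le> B \<and> norm (w i z) \<le> B"
  shows "local_divfree (\<lambda>z. \<Sum>n. q n z) (\<lambda>z. \<Sum>n. w n z)"
  unfolding local_divfree_def
proof (intro allI impI, elim conjE)
  fix \<psi> :: "spacetime \<Rightarrow> real" and G assume C: "C1_grad \<psi> G" and bG: "bounded {z. G z \<noteq> 0}"
  have cG: "continuous_on UNIV G" using C by (simp add: C1_grad_def)
  have cs: "continuous_on UNIV (\<lambda>z. norm (space_part (G z)) + \<bar>snd (G z)\<bar>)" by (intro continuous_intros cG)
  have mspc: "(\<lambda>z. space_part (G z)) \<in> borel_measurable borel" and msnd: "(\<lambda>z. snd (G z)) \<in> borel_measurable borel"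
    by (rule borel_measurable_continuous_onI; intro continuous_intros cG)+
  have B0: "0 \<le> B" using B abs_ge_zero order_trans by blast
  have spc0: "space_part 0 = 0" by (simp add: space_part_def Complex_eq_0)
  have iG: "integrable lborel (\<lambda>z. B * (norm (space_part (G z)) + \<bar>snd (G z)\<bar>))"
    by (rule continuous_vanishing_integrable[OF _ bG]) (use cs in \<open>auto intro!: continuous_intros simp: spc0\<close>)
  define f where "f n z = w n z \<bullet> space_part (G z) + q n z * snd (G z)" for n z
  have mf: "f n \<in> borel_measurable borel" for n
    unfolding f_def using m mspc msnd by (intro borel_measurable_add borel_measurable_inner borel_measurable_times)
  have fb: "\<bar>f n z\<bar> \<le> B * (norm (space_part (G z)) + \<bar>snd (G z)\<bar>)" for n z
  proof -
    have "\<bar>f n z\<bar> \<le> norm (w n z) * norm (space_part (G z)) + \<bar>q n z\<bar> * \<bar>snd (G z)\<bar>"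
      unfolding f_def using Cauchy_Schwarz_ineq2[of "w n z" "space_part (G z)"] abs_triangle_ineq[of "w n z \<bullet> space_part (G z)" "q n z * snd (G z)"]
      by (simp add: abs_mult)
    also have "\<dots> \<le> B * norm (space_part (G z)) + B * \<bar>snd (G z)\<bar>"
      using B[of n z] by (intro add_mono mult_right_mono) auto
    finally show ?thesis by (simp add: distrib_left)
  qed
  have f0: "z \<notin> Q n \<Longrightarrow> f n z = 0" for n z using z0 by (simp add: f_def)
  have i: "integrable lborel (f n)" for n
  proof (rule Bochner_Integration.integrable_bound[OF iG])
    show "AE z in lborel. norm (f n z) \<le> norm (B * (norm (space_part (G z)) + \<bar>snd (G z)\<bar>))"
      using fb[of n] B0 by (intro AE_I2) (simp add: abs_mult)
  qed (use mf in simp)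
  have "(\<lambda>N. \<integral>z. (\<Sum>n<N. f n z) \<partial>lborel) \<longlonglongrightarrow> (\<integral>z. (\<Sum>n. f n z) \<partial>lborel)"
  proof (rule integral_dominated_convergence[OF _ _ iG])
    show "AE z in lborel. (\<lambda>N. \<Sum>n<N. f n z) \<longlonglongrightarrow> (\<Sum>n. f n z)"
      using disjoint_family_sums(1)[where f=f and Q=Q, OF f0 disj] by (intro AE_I2) (simp add: sums_def)
    show "AE z in lborel. norm (\<Sum>n<N. f n z) \<le> B * (norm (space_part (G z)) + \<bar>snd (G z)\<bar>)" for N
    proof (rule AE_I2)
      fix z
      show "norm (\<Sum>n<N. f n z) \<le> B * (norm (space_part (G z)) + \<bar>snd (G z)\<bar>)"
        using disjoint_family_sums(4)[where f=f and Q=Q and z=z and N=N, OF f0 disj] fb[of _ z] B0 by (auto intro!: mult_nonneg_nonneg add_nonneg_nonneg)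
    qed
    show "(\<lambda>z. \<Sum>n. f n z) \<in> borel_measurable lborel" using mf by (simp add: borel_measurable_suminf)
    show "(\<lambda>z. \<Sum>n<N. f n z) \<in> borel_measurable lborel" for N using mf by (simp add: borel_measurable_sum)
  qed
  moreover have "(\<integral>z. (\<Sum>n<N. f n z) \<partial>lborel) = 0" for N
  proof -
    have "(\<integral>z. f n z \<partial>lborel) = 0" for n using df[of n] C unfolding f_def divfree_def by blast
    then show ?thesis by (simp add: Bochner_Integration.integral_sum i)
  qed
  ultimately have "(\<integral>z. (\<Sum>n. f n z) \<partial>lborel) = 0" by (simp add: LIMSEQ_const_iff)
  moreover have "(\<Sum>n. f n z) = (\<Sum>n. w n z) \<bullet> space_part (G z) + (\<Sum>n. q n z) * snd (G z)" for z
  proof (cases "\<exists>k. z \<in> Q k")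
    case True
    then obtain k where k: "z \<in> Q k" by blast
    have "(\<Sum>n. f n z) = f k z" "(\<Sum>n. w n z) = w k z" "(\<Sum>n. q n z) = q k z"
      by (rule disjoint_family_sums(2)[where Q=Q, OF _ disj k]; use f0 z0 in blast)+
    then show ?thesis by (simp add: f_def)
  next
    case False
    then have "f n z = 0" "w n z = 0" "q n z = 0" for n using f0 z0 by blast+
    then show ?thesis by simp
  qed
  ultimately show "(\<integral>z. (\<Sum>n. w n z) \<bullet> space_part (G z) + (\<Sum>n. q n z) * snd (G z) \<partial>lborel) = 0" by simp
qed

text \<open>The counterpart of \<open>solves\<close> on an unbounded set: the bound is unspecified
  and the equations are tested locally.\<close>

definition wild :: "real \<Rightarrow> complex \<Rightarrow> complex \<Rightarrow> spacetime set \<Rightarrow> (spacetime \<Rightarrow> complex) \<Rightarrow> (spacetime \<Rightarrow> complex) \<Rightarrow> bool" where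
  "wild C V0 u0 \<Omega> v u \<longleftrightarrow> v \<in> borel_measurable borel \<and> u \<in> borel_measurable borel \<and>
     (\<forall>z. z \<notin> \<Omega> \<longrightarrow> v z = 0 \<and> u z = 0) \<and> (\<exists>B. \<forall>z. norm (v z) \<le> B \<and> norm (u z) \<le> B) \<and>
     local_divfree (\<lambda>_. 0) v \<and> local_divfree (\<lambda>z. Re (v z)) u \<and> local_divfree (\<lambda>z. Im (v z)) (\<lambda>z. - \<i> * u z) \<and>
     (AE z in lborel. z \<in> \<Omega> \<longrightarrow> (norm (V0 + v z))\<^sup>2 = C \<and> 2 * (u0 + u z) = (V0 + v z)\<^sup>2)"

lemma AE_box_of_cbox: "AE z in lborel. z \<in> cbox a b \<longrightarrow> z \<in> box a (b::'a::euclidean_space)"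
proof -
  have "negligible (cbox a b - box a b)" by (rule negligible_frontier_interval)
  then have "cbox a b - box a b \<in> null_sets lborel"
    by (simp add: negligible_iff_null_sets null_sets_completion_iff)
  from AE_not_in[OF this] show ?thesis by eventually_elim auto
qed

text \<open>The \<open>m\<close>-th field uses the first of two distinct solutions on the boxes \<open>n < m\<close> of a tiling, and the second
  one on all others.\<close>

lemma wild_family:
  fixes \<Omega> :: "spacetime set"
  assumes sub: "subsol C V0 u0" and op: "open \<Omega>" and unb: "\<not> bounded \<Omega>"
  obtains v u :: "nat \<Rightarrow> spacetime \<Rightarrow> complex" where
    "\<And>m. wild C V0 u0 \<Omega> (v m) (u m)" "\<And>m n. m \<noteq> n \<Longrightarrow> \<not> (AE z in lborel. v m z = v n z)"
proof -
  obtain a b :: "nat \<Rightarrow> spacetime" where ne: "\<And>n. box (a n) (b n) \<noteq> {}"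
    and disj: "\<And>m n. m \<noteq> n \<Longrightarrow> box (a m) (b m) \<inter> box (a n) (b n) = {}" and un: "\<Omega> = (\<Union>n. cbox (a n) (b n))"
    using box_tiling[OF op unb] by blast
  let ?Q = "\<lambda>n. box (a n) (b n)"
  define pair where "pair n t \<longleftrightarrow> (case t of (v, u, v', u') \<Rightarrow> solves C V0 u0 (?Q n) v u \<and> solves C V0 u0 (?Q n) v' u' \<and> \<not> (AE z in lborel. v z = v' z))" for n t
  have "\<exists>t. pair n t" for n
    by (rule two_box_solutions[OF sub ne[of n]]) (auto simp: pair_def)
  then obtain t where t: "\<And>n. pair n (t n)" by metis
  define p p' q q' where "p n = fst (t n)" and "p' n = fst (snd (t n))" and "q n = fst (snd (snd (t n)))" and "q' n = snd (snd (snd (t n)))" for n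
  have pq: "solves C V0 u0 (?Q n) (p n) (p' n)" "solves C V0 u0 (?Q n) (q n) (q' n)"
    "\<not> (AE z in lborel. p n z = q n z)" for n
    using t[of n] by (auto simp: pair_def p_def p'_def q_def q'_def split: prod.splits)
  define x where "x m n = (if n < m then p n else q n)" for m n :: nat
  define y where "y m n = (if n < m then p' n else q' n)" for m n :: nat
  have s: "solves C V0 u0 (?Q n) (x m n) (y m n)" for m n using pq by (simp add: x_def y_def)
  have mx: "x m n \<in> borel_measurable borel" "y m n \<in> borel_measurable borel" and z0: "\<And>z. z \<notin> ?Q n \<Longrightarrow> x m n z = 0 \<and> y m n z = 0"
    and sol: "solenoidal (x m n) (y m n)" and bd: "\<And>z. norm (V0 + x m n z) \<le> sqrt C + norm V0" "\<And>z. norm (u0 + y m n z) \<le> C + (norm V0)\<^sup>2 + norm u0"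
    and ae: "AE z in lborel. z \<in> ?Q n \<longrightarrow> (norm (V0 + x m n z))\<^sup>2 = C \<and> 2 * (u0 + y m n z) = (V0 + x m n z)\<^sup>2" for m n
    using s[of n m] unfolding solves_def by blast+
  define v where "v m z = (\<Sum>n. x m n z)" for m z
  define u where "u m z = (\<Sum>n. y m n z)" for m z
  define B where "B = (sqrt C + norm V0 + norm V0) + (C + (norm V0)\<^sup>2 + norm u0 + norm u0)"
  have C: "C > 0" using subsol_bounds[OF sub] by blast
  have xB: "norm (x m n z) \<le> B" "norm (y m n z) \<le> B" for m n z
  proof -
    have "norm (x m n z) \<le> sqrt C + norm V0 + norm V0"
      using bd(1)[of m n z] norm_triangle_ineq4[of "V0 + x m n z" V0] by simp
    moreover have "norm (y m n z) \<le> C + (norm V0)\<^sup>2 + norm u0 + norm u0"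
      using bd(2)[of m n z] norm_triangle_ineq4[of "u0 + y m n z" u0] by simp
    moreover have "0 \<le> sqrt C + norm V0 + norm V0" "0 \<le> C + (norm V0)\<^sup>2 + norm u0 + norm u0" using C by simp_all
    ultimately show "norm (x m n z) \<le> B" "norm (y m n z) \<le> B" unfolding B_def by linarith+
  qed
  have B0: "0 \<le> B" using xB norm_ge_zero order_trans by blast
  have vk: "v m z = x m k z" "u m z = y m k z" if "z \<in> ?Q k" for m z k
    unfolding v_def u_def by (rule disjoint_family_sums(2)[where Q="?Q", OF _ disj that]; use z0 in blast)+
  have v0: "v m z = 0 \<and> u m z = 0" if "\<And>k. z \<notin> ?Q k" for m z
    using z0[OF that] by (simp add: v_def u_def)
  have vcase: "(v m z = 0 \<and> u m z = 0) \<or> (\<exists>k. v m z = x m k z \<and> u m z = y m k z)" for m z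
    using vk v0 by metis
  have part: "Re (v m z) = (\<Sum>n. Re (x m n z))" "Im (v m z) = (\<Sum>n. Im (x m n z))" "- \<i> * u m z = (\<Sum>n. - \<i> * y m n z)" for m z
  proof -
    have sm: "(\<lambda>n. x m n z) sums v m z" "(\<lambda>n. y m n z) sums u m z"
      unfolding v_def u_def by (rule disjoint_family_sums(1)[where Q="?Q", OF _ disj]; use z0 in blast)+
    show "Re (v m z) = (\<Sum>n. Re (x m n z))" "Im (v m z) = (\<Sum>n. Im (x m n z))" "- \<i> * u m z = (\<Sum>n. - \<i> * y m n z)"
      using sums_Re[OF sm(1)] sums_Im[OF sm(1)] sums_mult[OF sm(2), of "- \<i>"] by (metis sums_unique)+
  qed
  show ?thesis
  proof (rule that[of v u])
    fix m
    have "local_divfree (\<lambda>z. \<Sum>n. 0) (v m)"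
      unfolding v_def
      by (rule divfree_patch[where Q="?Q" and B=B]) (use sol mx z0 disj xB B0 in \<open>auto simp: solenoidal_def\<close>)
    moreover have "local_divfree (\<lambda>z. Re (v m z)) (u m)"
      unfolding part u_def
    proof (rule divfree_patch[where Q="?Q" and B=B])
      show "\<bar>Re (x m i z)\<bar> \<le> B \<and> norm (y m i z) \<le> B" for i z
        using xB[of m i z] abs_Re_le_cmod[of "x m i z"] by simp
    qed (use sol mx z0 disj in \<open>auto simp: solenoidal_def\<close>)
    moreover have "local_divfree (\<lambda>z. Im (v m z)) (\<lambda>z. - \<i> * u m z)"
      unfolding part
    proof (rule divfree_patch[where Q="?Q" and B=B])
      show "\<bar>Im (x m i z)\<bar> \<le> B \<and> norm (- \<i> * y m i z) \<le> B" for i z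
        using xB[of m i z] abs_Im_le_cmod[of "x m i z"] by (simp add: norm_mult)
    qed (use sol mx z0 disj in \<open>auto simp: solenoidal_def\<close>)
    moreover have "AE z in lborel. z \<in> \<Omega> \<longrightarrow> (norm (V0 + v m z))\<^sup>2 = C \<and> 2 * (u0 + u m z) = (V0 + v m z)\<^sup>2"
    proof -
      have "AE z in lborel. \<forall>n. z \<in> cbox (a n) (b n) \<longrightarrow> z \<in> ?Q n"
        by (simp add: AE_all_countable AE_box_of_cbox)
      moreover have "AE z in lborel. \<forall>n. z \<in> ?Q n \<longrightarrow> (norm (V0 + x m n z))\<^sup>2 = C \<and> 2 * (u0 + y m n z) = (V0 + x m n z)\<^sup>2"
        using ae by (simp add: AE_all_countable)
      ultimately show ?thesis
      proof eventually_elim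
        case (elim z)
        show ?case
        proof
          assume "z \<in> \<Omega>"
          then obtain n where "z \<in> ?Q n" using elim(1) un by blast
          then show "(norm (V0 + v m z))\<^sup>2 = C \<and> 2 * (u0 + u m z) = (V0 + v m z)\<^sup>2"
            using elim(2) vk by metis
        qed
      qed
    qed
    moreover have "v m z = 0 \<and> u m z = 0" if "z \<notin> \<Omega>" for z
      using that box_subset_cbox by (intro v0) (auto simp: un subset_iff)
    moreover have "norm (v m z) \<le> B \<and> norm (u m z) \<le> B" for z
      using vcase[of m z] xB(1)[of m _ z] xB(2)[of m _ z] B0 by auto
    moreover have "v m \<in> borel_measurable borel" "u m \<in> borel_measurable borel"
      unfolding v_def u_def using mx by (simp_all add: borel_measurable_suminf)
    ultimately show "wild C V0 u0 \<Omega> (v m) (u m)" unfolding wild_def by auto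
  next
    \<comment> \<open>On box \<open>m\<close> the field \<open>v m\<close> already uses
      \<open>q m\<close> while \<open>v n\<close> still uses \<open>p m\<close>; off that box both
      of these vanish, so equality of the fields would make them equal almost everywhere.\<close>
    have *: "\<not> (AE z in lborel. v m z = v n z)" if "m < n" for m n
    proof
      assume "AE z in lborel. v m z = v n z"
      then have "AE z in lborel. p m z = q m z"
      proof eventually_elim
        case (elim z)
        show ?case
        proof (cases "z \<in> ?Q m")
          case True
          then show ?thesis using elim vk(1)[OF True, of m] vk(1)[OF True, of n] that by (simp add: x_def)
        next
          case False
          then show ?thesis using pq(1,2)[of m] unfolding solves_def by metis
        qed
      qed
      then show False using pq(3) by blast
    qed
    fix m n :: nat assume "m \<noteq> n"
    then consider "m < n" | "n < m" by linarith
    then show "\<not> (AE z in lborel. v m z = v n z)"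
      using *[of m n] *[of n m] by cases (auto simp: eq_commute)
  qed
qed

section \<open>Fan subsolutions near a shock\<close>

text \<open>Only the \<open>x\<^sub>2\<close>-components of the outer velocities enter. As both outer states have the same
  \<open>x\<^sub>1\<close>-component \<open>\<alpha>\<close>, the terms with \<open>\<alpha>\<close> in the energy conditions cancel by mass conservation.\<close>

definition fan :: "real \<Rightarrow> real \<Rightarrow> real \<Rightarrow> real \<Rightarrow> real \<Rightarrow> bool" where
  "fan \<gamma> rm vm rp vp \<longleftrightarrow> (\<exists>r \<beta> \<epsilon>1 \<epsilon>2 \<mu> \<nu>. r > 0 \<and> \<epsilon>1 > 0 \<and> \<epsilon>2 > 0 \<and> \<mu> < \<nu> \<and>
     \<mu> * (rm - r) = rm * vm - r * \<beta> \<and>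
     \<mu> * (rm * vm - r * \<beta>) = rm * vm\<^sup>2 + pressure \<gamma> rm - (r * \<beta>\<^sup>2 + r * \<epsilon>1 + pressure \<gamma> r) \<and>
     \<nu> * (r - rp) = r * \<beta> - rp * vp \<and>
     \<nu> * (r * \<beta> - rp * vp) = r * \<beta>\<^sup>2 + r * \<epsilon>1 + pressure \<gamma> r - (rp * vp\<^sup>2 + pressure \<gamma> rp) \<and>
     \<mu> * (rm * internal_energy \<gamma> rm + rm * vm\<^sup>2 / 2 - (r * internal_energy \<gamma> r + r * (\<beta>\<^sup>2 + \<epsilon>1 + \<epsilon>2) / 2))
       \<le> (rm * internal_energy \<gamma> rm + rm * vm\<^sup>2 / 2 + pressure \<gamma> rm) * vm
        - (r * internal_energy \<gamma> r + r * (\<beta>\<^sup>2 + \<epsilon>1 + \<epsilon>2) / 2 + pressure \<gamma> r) * \<beta> \<and>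
     \<nu> * (r * internal_energy \<gamma> r + r * (\<beta>\<^sup>2 + \<epsilon>1 + \<epsilon>2) / 2 - (rp * internal_energy \<gamma> rp + rp * vp\<^sup>2 / 2))
       \<le> (r * internal_energy \<gamma> r + r * (\<beta>\<^sup>2 + \<epsilon>1 + \<epsilon>2) / 2 + pressure \<gamma> r) * \<beta>
        - (rp * internal_energy \<gamma> rp + rp * vp\<^sup>2 / 2 + pressure \<gamma> rp) * vp)"

text \<open>The reflection of \<open>x2\<close>: velocities and line speeds change sign, the two
  lines swap, and the middle density and both fluctuation parameters are kept.\<close>

lemma fan_reflect:
  assumes "fan \<gamma> rp (- vp) rm (- vm)"
  shows "fan \<gamma> rm vm rp vp"
proof -
  obtain r \<beta> \<epsilon>1 \<epsilon>2 \<mu> \<nu> where *: "r > 0" "\<epsilon>1 > 0" "\<epsilon>2 > 0" "\<mu> < \<nu>"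
     "\<mu> * (rp - r) = rp * - vp - r * \<beta>"
     "\<mu> * (rp * - vp - r * \<beta>) = rp * (- vp)\<^sup>2 + pressure \<gamma> rp - (r * \<beta>\<^sup>2 + r * \<epsilon>1 + pressure \<gamma> r)"
     "\<nu> * (r - rm) = r * \<beta> - rm * - vm"
     "\<nu> * (r * \<beta> - rm * - vm) = r * \<beta>\<^sup>2 + r * \<epsilon>1 + pressure \<gamma> r - (rm * (- vm)\<^sup>2 + pressure \<gamma> rm)"
     "\<mu> * (rp * internal_energy \<gamma> rp + rp * (- vp)\<^sup>2 / 2 - (r * internal_energy \<gamma> r + r * (\<beta>\<^sup>2 + \<epsilon>1 + \<epsilon>2) / 2))
       \<le> (rp * internal_energy \<gamma> rp + rp * (- vp)\<^sup>2 / 2 + pressure \<gamma> rp) * - vp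
        - (r * internal_energy \<gamma> r + r * (\<beta>\<^sup>2 + \<epsilon>1 + \<epsilon>2) / 2 + pressure \<gamma> r) * \<beta>"
     "\<nu> * (r * internal_energy \<gamma> r + r * (\<beta>\<^sup>2 + \<epsilon>1 + \<epsilon>2) / 2 - (rm * internal_energy \<gamma> rm + rm * (- vm)\<^sup>2 / 2))
       \<le> (r * internal_energy \<gamma> r + r * (\<beta>\<^sup>2 + \<epsilon>1 + \<epsilon>2) / 2 + pressure \<gamma> r) * \<beta>
        - (rm * internal_energy \<gamma> rm + rm * (- vm)\<^sup>2 / 2 + pressure \<gamma> rm) * - vm"
    using assms unfolding fan_def by blast
  have aux1: "- m * (X - Y) \<le> (X + q) * w - (Y + p) * - b" if "m * (Y - X) \<le> (Y + p) * b - (X + q) * - w" for m X Y p q b w :: real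
    using that by (simp add: algebra_simps)
  have aux2: "- m * (Y - X) \<le> (Y + p) * - b - (X + q) * w" if "m * (X - Y) \<le> (X + q) * - w - (Y + p) * b" for m X Y p q b w :: real
    using that by (simp add: algebra_simps)
  show ?thesis
    unfolding fan_def
    apply (rule exI[of _ r], rule exI[of _ "- \<beta>"], rule exI[of _ \<epsilon>1], rule exI[of _ \<epsilon>2], rule exI[of _ "- \<nu>"], rule exI[of _ "- \<mu>"])
    apply (intro conjI)
    subgoal using *(1) .
    subgoal using *(2) .
    subgoal using *(3) .
    subgoal using *(4) by simp
    subgoal using *(7) by (simp add: algebra_simps)
    subgoal using *(8) by (simp add: algebra_simps)
    subgoal using *(5) by (simp add: algebra_simps)
    subgoal using *(6) by (simp add: algebra_simps)
    subgoal using aux1[OF *(10)] by (simp only: power2_minus)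
    subgoal using aux2[OF *(9)] by (simp only: power2_minus)
    done
qed

text \<open>In the specific volume \<open>t = 1 / \<rho>\<close> the pressure is the convex function
  \<open>t powr (- \<gamma>)\<close>, and it is minus the derivative of the internal energy.\<close>

lemma pressure_inverse_derivs:
  assumes "\<gamma> > 1" "t > (0::real)"
  shows "((\<lambda>t. pressure \<gamma> (1 / t)) has_real_derivative - \<gamma> * t powr (- \<gamma> - 1)) (at t)"
    "((\<lambda>t. internal_energy \<gamma> (1 / t)) has_real_derivative - pressure \<gamma> (1 / t)) (at t)"
proof -
  have ev: "\<forall>\<^sub>F t in nhds t. t > 0"
    using assms(2) eventually_nhds_in_open[of "{0<..}" t] by auto
  have "((\<lambda>t. t powr (- \<gamma>)) has_real_derivative - \<gamma> * t powr (- \<gamma> - 1)) (at t)"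
    using assms by (auto intro!: derivative_eq_intros)
  moreover have "\<forall>\<^sub>F t in nhds t. pressure \<gamma> (1 / t) = t powr (- \<gamma>)"
    using ev by eventually_elim (simp add: pressure_def powr_divide powr_minus_divide)
  ultimately show "((\<lambda>t. pressure \<gamma> (1 / t)) has_real_derivative - \<gamma> * t powr (- \<gamma> - 1)) (at t)"
    by (subst DERIV_cong_ev[OF refl _ refl, where g="\<lambda>t. t powr (- \<gamma>)"])
  have "((\<lambda>t. t powr (1 - \<gamma>) / (\<gamma> - 1)) has_real_derivative (1 - \<gamma>) * t powr (1 - \<gamma> - 1) / (\<gamma> - 1)) (at t)"
    using assms by (intro DERIV_cdivide has_real_derivative_powr) auto
  moreover have "(1 - \<gamma>) * t powr (1 - \<gamma> - 1) / (\<gamma> - 1) = - pressure \<gamma> (1 / t)"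
  proof -
    have "1 - \<gamma> = - (\<gamma> - 1)" by simp
    then have "(1 - \<gamma>) * t powr (1 - \<gamma> - 1) / (\<gamma> - 1) = - (t powr (- \<gamma>))" using assms by (simp add: field_simps)
    then show ?thesis using assms by (simp add: pressure_def powr_divide powr_minus_divide)
  qed
  moreover have "\<forall>\<^sub>F t in nhds t. internal_energy \<gamma> (1 / t) = t powr (1 - \<gamma>) / (\<gamma> - 1)"
    using ev
  proof eventually_elim
    case (elim t)
    have "(1 / t) powr (\<gamma> - 1) = t powr (- (\<gamma> - 1))" using elim by (simp only: powr_divide powr_minus_divide powr_one_eq_one)
    then show ?case by (simp add: internal_energy_def)
  qed
  ultimately show "((\<lambda>t. internal_energy \<gamma> (1 / t)) has_real_derivative - pressure \<gamma> (1 / t)) (at t)"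
    by (subst DERIV_cong_ev[OF refl _ refl, where g="\<lambda>t. t powr (1 - \<gamma>) / (\<gamma> - 1)"]) simp_all
qed

text \<open>The energy gap is the integral of the pressure over the specific volume, and the
  trapezoidal rule overestimates the integral of a strictly convex function. Physically, a
  compressive shock dissipates a positive amount of energy per unit of mass.\<close>

lemma energy_gap_less_trapezoid:
  assumes g: "\<gamma> > 1" and st: "0 < s" "s < (t::real)"
  shows "internal_energy \<gamma> (1 / s) - internal_energy \<gamma> (1 / t) < (pressure \<gamma> (1 / s) + pressure \<gamma> (1 / t)) / 2 * (t - s)"
proof -
  let ?q = "\<lambda>t. pressure \<gamma> (1 / t)" and ?q' = "\<lambda>t. - \<gamma> * t powr (- \<gamma> - 1)" and ?e = "\<lambda>t. internal_energy \<gamma> (1 / t)"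
  note dq = pressure_inverse_derivs(1)[OF g] and de = pressure_inverse_derivs(2)[OF g]
  \<comment> \<open>The excess of the trapezoid, zero at \<open>x = s\<close>. Its derivative is
    positive because the chord from \<open>s\<close> to \<open>x\<close> is steeper downwards than
    the tangent at \<open>x\<close>.\<close>
  define \<Phi> where "\<Phi> x = (?q s + ?q x) / 2 * (x - s) - (?e s - ?e x)" for x
  have d: "(\<Phi> has_real_derivative (?q s - ?q x + ?q' x * (x - s)) / 2) (at x)" if "x > 0" for x
    unfolding \<Phi>_def
    by (rule DERIV_cong, (rule DERIV_diff DERIV_mult DERIV_cdivide DERIV_add DERIV_const DERIV_ident dq[OF that] de[OF that])+) (simp add: field_simps)
  have "\<Phi> s < \<Phi> t"
  proof (rule DERIV_pos_imp_increasing_open[OF st(2)])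
    show "continuous_on {s..t} \<Phi>"
      by (intro continuous_at_imp_continuous_on ballI DERIV_isCont[OF d]) (use st in auto)
    fix x assume x: "s < x" "x < t"
    have "\<exists>z>s. z < x \<and> ?q x - ?q s = (x - s) * ?q' z"
      using x st by (intro MVT2 dq) auto
    then obtain z where z: "s < z" "z < x" "?q x - ?q s = (x - s) * ?q' z" by blast
    have "x powr (- \<gamma> - 1) < z powr (- \<gamma> - 1)" using z st g by (intro powr_less_mono2_neg) auto
    then have "?q' z < ?q' x" using g by simp
    then have "(x - s) * ?q' z < (x - s) * ?q' x" by (rule mult_strict_left_mono) (use x in simp)
    then have "0 < (?q s - ?q x + ?q' x * (x - s)) / 2" using z(3) by (simp add: mult.commute)
    then show "\<exists>y. (\<Phi> has_real_derivative y) (at x) \<and> 0 < y" using d[of x] x st by auto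
  qed
  then show ?thesis by (simp add: \<Phi>_def)
qed

text \<open>Here \<open>k\<close> and \<open>l\<close> are the mass fluxes through the two lines.\<close>

lemma fan_lagrangian:
  assumes pos: "r > 0" "\<epsilon>1 > 0" "\<epsilon>2 > 0" "\<mu> < \<nu>"
    and m: "rm * (\<mu> - vm) = k" "r * (\<mu> - \<beta>) = k" "r * (\<nu> - \<beta>) = l" "rp * (\<nu> - vp) = l"
    and f: "k * (vm - \<beta>) = pressure \<gamma> rm - (r * \<epsilon>1 + pressure \<gamma> r)" "l * (\<beta> - vp) = (r * \<epsilon>1 + pressure \<gamma> r) - pressure \<gamma> rp"
    and e: "k * (internal_energy \<gamma> rm + vm\<^sup>2 / 2 - (internal_energy \<gamma> r + (\<beta>\<^sup>2 + \<epsilon>1 + \<epsilon>2) / 2)) \<le> pressure \<gamma> rm * vm - pressure \<gamma> r * \<beta>"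
      "l * (internal_energy \<gamma> r + (\<beta>\<^sup>2 + \<epsilon>1 + \<epsilon>2) / 2 - (internal_energy \<gamma> rp + vp\<^sup>2 / 2)) \<le> pressure \<gamma> r * \<beta> - pressure \<gamma> rp * vp"
  shows "fan \<gamma> rm vm rp vp"
proof -
  define E where "E = internal_energy \<gamma> r + (\<beta>\<^sup>2 + \<epsilon>1 + \<epsilon>2) / 2"
  define Em where "Em = internal_energy \<gamma> rm + vm\<^sup>2 / 2"
  define Ep where "Ep = internal_energy \<gamma> rp + vp\<^sup>2 / 2"
  have rE: "r * internal_energy \<gamma> r + r * (\<beta>\<^sup>2 + \<epsilon>1 + \<epsilon>2) / 2 = r * E" "rm * internal_energy \<gamma> rm + rm * vm\<^sup>2 / 2 = rm * Em"
    "rp * internal_energy \<gamma> rp + rp * vp\<^sup>2 / 2 = rp * Ep" by (simp_all add: E_def Em_def Ep_def distrib_left)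
  have 1: "\<mu> * (rm - r) = rm * vm - r * \<beta>" using m(1,2) by (simp add: algebra_simps)
  have 2: "\<mu> * (rm * vm - r * \<beta>) = rm * vm\<^sup>2 + pressure \<gamma> rm - (r * \<beta>\<^sup>2 + r * \<epsilon>1 + pressure \<gamma> r)"
  proof -
    have "\<mu> * (rm * vm - r * \<beta>) = rm * (\<mu> - vm) * vm - r * (\<mu> - \<beta>) * \<beta> + rm * vm\<^sup>2 - r * \<beta>\<^sup>2" by algebra
    then show ?thesis using f(1) unfolding m by (simp add: algebra_simps)
  qed
  have 3: "\<nu> * (r - rp) = r * \<beta> - rp * vp" using m(3,4) by (simp add: algebra_simps)
  have 4: "\<nu> * (r * \<beta> - rp * vp) = r * \<beta>\<^sup>2 + r * \<epsilon>1 + pressure \<gamma> r - (rp * vp\<^sup>2 + pressure \<gamma> rp)"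
  proof -
    have "\<nu> * (r * \<beta> - rp * vp) = r * (\<nu> - \<beta>) * \<beta> - rp * (\<nu> - vp) * vp + r * \<beta>\<^sup>2 - rp * vp\<^sup>2" by algebra
    then show ?thesis using f(2) unfolding m by (simp add: algebra_simps)
  qed
  have 5: "\<mu> * (rm * Em - r * E) \<le> (rm * Em + pressure \<gamma> rm) * vm - (r * E + pressure \<gamma> r) * \<beta>"
  proof -
    have "\<mu> * (rm * Em - r * E) = rm * (\<mu> - vm) * Em - r * (\<mu> - \<beta>) * E + rm * Em * vm - r * E * \<beta>" by algebra
    also have "\<dots> = k * (Em - E) + rm * Em * vm - r * E * \<beta>" unfolding m by algebra
    also have "\<dots> \<le> pressure \<gamma> rm * vm - pressure \<gamma> r * \<beta> + rm * Em * vm - r * E * \<beta>"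
      using e(1) unfolding E_def[symmetric] Em_def[symmetric] by simp
    finally show ?thesis by (simp add: algebra_simps)
  qed
  have 6: "\<nu> * (r * E - rp * Ep) \<le> (r * E + pressure \<gamma> r) * \<beta> - (rp * Ep + pressure \<gamma> rp) * vp"
  proof -
    have "\<nu> * (r * E - rp * Ep) = r * (\<nu> - \<beta>) * E - rp * (\<nu> - vp) * Ep + r * E * \<beta> - rp * Ep * vp" by algebra
    also have "\<dots> = l * (E - Ep) + r * E * \<beta> - rp * Ep * vp" unfolding m by algebra
    also have "\<dots> \<le> pressure \<gamma> r * \<beta> - pressure \<gamma> rp * vp + r * E * \<beta> - rp * Ep * vp"
      using e(2) unfolding E_def[symmetric] Ep_def[symmetric] by simp
    finally show ?thesis by (simp add: algebra_simps)
  qed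
  show ?thesis
    unfolding fan_def
    apply (rule exI[of _ r], rule exI[of _ \<beta>], rule exI[of _ \<epsilon>1], rule exI[of _ \<epsilon>2], rule exI[of _ \<mu>], rule exI[of _ \<nu>])
    unfolding rE using pos 1 2 3 4 5 6 by (intro conjI)
qed

text \<open>The function \<open>w\<close> prescribes the right velocity in terms of the velocity jump \<open>d\<close>. A constant \<open>w\<close> suffices for
  \<open>rm < rp\<close>; after the reflection used for \<open>rm > rp\<close> the left velocity is the given one, so that \<open>w\<close> must
  vary with \<open>d\<close>.\<close>

lemma fan_exists_less:
  fixes w :: "real \<Rightarrow> real"
  assumes g: "\<gamma> > 1" and r: "0 < rm" "rm < rp" and w: "\<And>x. isCont w x"
  shows "\<exists>V. V < sqrt ((rp - rm) * (pressure \<gamma> rp - pressure \<gamma> rm) / (rp * rm)) \<and>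
    (\<forall>d. V < d \<and> d < sqrt ((rp - rm) * (pressure \<gamma> rp - pressure \<gamma> rm) / (rp * rm)) \<longrightarrow> fan \<gamma> rm (w d + d) rp (w d))"
proof -
  let ?q = "\<lambda>t. pressure \<gamma> (1 / t)" and ?e = "\<lambda>t. internal_energy \<gamma> (1 / t)"
  \<comment> \<open>Specific volumes of the outer states; \<open>T\<close> and
    \<open>\<Delta>\<close> are the jumps of specific volume and pressure, and \<open>S\<close>, the
    square root of \<open>\<Delta> * T\<close>, is the critical velocity jump.\<close>
  define a where "a = 1 / rp"
  define b where "b = 1 / rm"
  define T where "T = b - a"
  define \<Delta> where "\<Delta> = ?q a - ?q b"
  define S where "S = sqrt \<Delta> * sqrt T"
  have ab: "0 < a" "a < b" "1 / a = rp" "1 / b = rm" using r by (auto simp: a_def b_def field_simps)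
  have T: "T > 0" using ab by (simp add: T_def)
  have \<Delta>: "\<Delta> > 0" using r g by (simp add: \<Delta>_def ab(3,4) pressure_def powr_less_mono2)
  have "(rp - rm) * (pressure \<gamma> rp - pressure \<gamma> rm) / (rp * rm) = \<Delta> * T"
    using r by (simp add: \<Delta>_def T_def ab(3,4)) (simp add: a_def b_def field_simps)
  then have S: "sqrt ((rp - rm) * (pressure \<gamma> rp - pressure \<gamma> rm) / (rp * rm)) = S"
    by (simp add: S_def real_sqrt_mult)
  \<comment> \<open>Minus the slope of the pressure at \<open>a\<close>, the squared sound speed in
    mass coordinates.\<close>
  define \<kappa> where "\<kappa> = \<gamma> * a powr (- \<gamma> - 1)"
  have \<kappa>: "\<kappa> > 0" using g ab by (simp add: \<kappa>_def)
  \<comment> \<open>The mass flux through the pure shock: its square is minus the slope of the chord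
    of the pressure between \<open>a\<close> and \<open>b\<close>.\<close>
  define N0 where "N0 = sqrt (\<Delta> / T)"
  have N0: "N0 > 0" using \<Delta> T by (simp add: N0_def)
  \<comment> \<open>\<open>M\<close> is the mass flux through the right line. Below
    \<open>sqrt \<kappa>\<close> it makes \<open>\<epsilon>1\<close> positive for small
    \<open>h\<close>; below \<open>N0\<close> it opens the wedge and keeps the velocity jump under
    \<open>S\<close>.\<close>
  define M where "M = min N0 (sqrt \<kappa>) / 2"
  have M: "M > 0" "M < N0" using N0 \<kappa> by (auto simp: M_def min_def)
  have M\<kappa>: "M\<^sup>2 < \<kappa>"
  proof -
    have "M < sqrt \<kappa>" using N0 \<kappa> by (auto simp: M_def min_def)
    then have "M\<^sup>2 < (sqrt \<kappa>)\<^sup>2" using M by (intro power_strict_mono) auto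
    then show ?thesis using \<kappa> by simp
  qed
  have N0T: "N0\<^sup>2 * T = \<Delta>" "N0 * sqrt T = sqrt \<Delta>" "N0 * T = S" using \<Delta> T by (auto simp: N0_def S_def real_sqrt_divide field_simps)
  \<comment> \<open>the energy dissipated by the pure shock per unit of mass; the fluctuations inside the wedge consume half of it\<close>
  define \<epsilon>2 where "\<epsilon>2 = (?q a + ?q b) / 2 * T - (?e a - ?e b)"
  have \<epsilon>2: "\<epsilon>2 > 0" using energy_gap_less_trapezoid[OF g ab(1,2)] by (simp add: \<epsilon>2_def T_def)
  \<comment> \<open>With middle specific volume \<open>a + h\<close>, momentum balance on the right
    line fixes the normal stress \<open>P\<close>, the middle pressure plus
    \<open>r * \<epsilon>1\<close>; balance on the left line then fixes the mass flux
    \<open>N\<close>. On each line the velocity jump is mass flux times volume jump, and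
    \<open>F\<close> is their sum. \<open>LE\<close> and \<open>RE\<close> are the slacks of the two
    energy inequalities.\<close>
  define P where "P h = ?q a - M\<^sup>2 * h" for h
  define N where "N h = sqrt ((P h - ?q b) / (T - h))" for h
  define F where "F h = N h * (T - h) + M * h" for h
  define \<epsilon>1 where "\<epsilon>1 h = (P h - ?q (a + h)) * (a + h)" for h
  define W where "W h = w (F h)" for h
  define \<beta> where "\<beta> h = W h + M * h" for h
  define LE where "LE h = ?q b * (W h + F h) - ?q (a + h) * \<beta> h
     + N h * (?e b + (W h + F h)\<^sup>2 / 2 - (?e (a + h) + ((\<beta> h)\<^sup>2 + \<epsilon>1 h + \<epsilon>2) / 2))" for h
  define RE where "RE h = ?q (a + h) * \<beta> h - ?q a * W h
     + M * (?e (a + h) + ((\<beta> h)\<^sup>2 + \<epsilon>1 h + \<epsilon>2) / 2 - (?e a + (W h)\<^sup>2 / 2))" for h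
  have cont: "isCont (\<lambda>h. ?q (a + h)) h" "isCont (\<lambda>h. ?e (a + h)) h" if "h \<ge> 0" for h
  proof -
    have h: "a + h > 0" using ab that by simp
    have "isCont (\<lambda>h. a + h) h" by (intro continuous_intros)
    with h show "isCont (\<lambda>h. ?q (a + h)) h" "isCont (\<lambda>h. ?e (a + h)) h"
      using isCont_o2[where f="\<lambda>h. a + h" and g="?q"] isCont_o2[where f="\<lambda>h. a + h" and g="?e"] pressure_inverse_derivs[OF g h] by (auto dest: DERIV_isCont)
  qed
  have cP: "isCont P h" for h unfolding P_def by (intro continuous_intros)
  have cN: "isCont N h" if "h < T" for h
    unfolding N_def using that by (intro continuous_intros cP) auto
  have cF: "isCont F h" if "h < T" for h
    unfolding F_def using that by (intro continuous_intros cN) auto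
  have cW: "isCont W h" if "h < T" for h
    unfolding W_def using isCont_o2[OF cF[OF that] w] .
  have c\<epsilon>: "isCont \<epsilon>1 0" unfolding \<epsilon>1_def by (intro continuous_intros cont cP) simp
  have cLE: "isCont LE 0" and cRE: "isCont RE 0"
    unfolding LE_def RE_def \<beta>_def using T by (intro continuous_intros cont cN cF cW c\<epsilon>; simp)+
  have N00: "N 0 = N0" by (simp add: N_def N0_def P_def \<Delta>_def)
  have F0: "F 0 = S" using N0T by (simp add: F_def N00)
  have z: "\<epsilon>1 0 = 0" "\<beta> 0 = W 0" by (simp_all add: \<epsilon>1_def P_def \<beta>_def)
  \<comment> \<open>Fluid enters the wedge through the left line and leaves it through the right
    one. At \<open>h = 0\<close> the left line is the pure shock, which spares half of its
    dissipation for the fluctuations; their energy, \<open>\<epsilon>2 / 2\<close> per unit of mass,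
    is given up on the right line, so that \<open>RE 0\<close> is positive as well.\<close>
  have LE0: "LE 0 > 0"
  proof -
    have "LE 0 = ?q b * (W 0 + N0 * T) - ?q a * W 0 + N0 * (?e b + (W 0 + N0 * T)\<^sup>2 / 2 - (?e a + ((W 0)\<^sup>2 + \<epsilon>2) / 2))"
      by (simp add: LE_def z F0 N00 N0T(3))
    also have "\<dots> = N0 * (?q b * T + ?e b - ?e a - \<epsilon>2 / 2) - \<Delta> * W 0 + (N0\<^sup>2 * T) * (W 0 + N0 * T / 2)"
      by (simp add: \<Delta>_def power2_eq_square field_simps)
    also have "\<dots> = N0 * ((?q a + ?q b) / 2 * T - (?e a - ?e b) - \<epsilon>2 / 2)"
      unfolding N0T(1) by (simp add: \<Delta>_def field_simps)
    also have "\<dots> = N0 * (\<epsilon>2 / 2)" unfolding \<epsilon>2_def[symmetric] by simp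
    finally have "LE 0 = N0 * (\<epsilon>2 / 2)" .
    moreover have "N0 * (\<epsilon>2 / 2) > 0" using N0 \<epsilon>2 by simp
    ultimately show ?thesis by linarith
  qed
  have RE0: "RE 0 > 0" using M \<epsilon>2 by (simp add: RE_def z)
  have ev_pos: "\<forall>\<^sub>F h in at_right 0. f h > 0" if "isCont f 0" "f 0 > 0" for f :: "real \<Rightarrow> real"
  proof -
    have "(f \<longlongrightarrow> f 0) (at_right 0)" using that(1) unfolding isCont_def by (rule filterlim_mono) (auto simp: at_within_le_at)
    then show ?thesis using that(2) by (rule order_tendstoD(1))
  qed
  \<comment> \<open>Near \<open>a\<close> the pressure falls with slope close to
    \<open>- \<kappa>\<close>, hence faster than the line \<open>P\<close> of slope
    \<open>- M^2\<close>.\<close>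
  have ev1: "\<forall>\<^sub>F h in at_right 0. P h - ?q (a + h) > 0"
  proof -
    have "((\<lambda>h. (?q (a + h) - ?q a) / h) \<longlongrightarrow> - \<kappa>) (at 0)"
      using pressure_inverse_derivs(1)[OF g ab(1)] unfolding DERIV_def \<kappa>_def by simp
    then have "((\<lambda>h. (?q (a + h) - ?q a) / h) \<longlongrightarrow> - \<kappa>) (at_right 0)"
      by (rule filterlim_mono) (auto simp: at_within_le_at)
    then have "\<forall>\<^sub>F h in at_right 0. (?q (a + h) - ?q a) / h < - M\<^sup>2"
      by (rule order_tendstoD(2)) (use M\<kappa> in simp)
    moreover have "\<forall>\<^sub>F h in at_right (0::real). h > 0" by (simp add: eventually_at_filter)
    ultimately show ?thesis
      by eventually_elim (simp add: P_def divide_less_eq algebra_simps)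
  qed
  \<comment> \<open>The difference of the two line speeds; at \<open>h = 0\<close> it equals
    \<open>(N0 - M) * a\<close>.\<close>
  have ev2: "\<forall>\<^sub>F h in at_right 0. (W h - M * a) - (W h + F h - N h * b) > 0"
  proof (rule ev_pos)
    show "isCont (\<lambda>h. (W h - M * a) - (W h + F h - N h * b)) 0" using T by (intro continuous_intros cF cN cW) auto
    have "(W 0 - M * a) - (W 0 + F 0 - N 0 * b) = (N0 - M) * a"
      unfolding F0 N00 N0T(3)[symmetric] by (simp add: T_def algebra_simps)
    then show "(W 0 - M * a) - (W 0 + F 0 - N 0 * b) > 0" using M ab by simp
  qed
  have ev3: "\<forall>\<^sub>F h in at_right 0. h < T \<and> h * M\<^sup>2 < \<Delta> \<and> M * h < S"
  proof -
    have "\<forall>\<^sub>F h in at_right 0. T - h > 0" "\<forall>\<^sub>F h in at_right 0. \<Delta> - h * M\<^sup>2 > 0" "\<forall>\<^sub>F h in at_right 0. S - M * h > 0"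
      by (rule ev_pos; use T \<Delta> in \<open>auto intro!: continuous_intros simp: S_def\<close>)+
    then show ?thesis by eventually_elim auto
  qed
  have "\<forall>\<^sub>F h in at_right 0. P h - ?q (a + h) > 0 \<and> (W h - M * a) - (W h + F h - N h * b) > 0 \<and>
     (h < T \<and> h * M\<^sup>2 < \<Delta> \<and> M * h < S) \<and> LE h > 0 \<and> RE h > 0"
    by (intro eventually_conj ev1 ev2 ev3 ev_pos cLE cRE LE0 RE0)
  then obtain h1 where h1: "h1 > 0" and good: "\<And>h. 0 < h \<Longrightarrow> h < h1 \<Longrightarrow> P h - ?q (a + h) > 0 \<and> (W h - M * a) - (W h + F h - N h * b) > 0 \<and>
     (h < T \<and> h * M\<^sup>2 < \<Delta> \<and> M * h < S) \<and> LE h > 0 \<and> RE h > 0"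
    unfolding eventually_at_right_field by blast
  have N2: "(N h)\<^sup>2 * (T - h) = P h - ?q b" "N h > 0" if "0 < h" "h < h1" for h
  proof -
    have pos: "P h - ?q b > 0" "T - h > 0" using good[OF that] by (auto simp: P_def \<Delta>_def algebra_simps)
    then show "(N h)\<^sup>2 * (T - h) = P h - ?q b" "N h > 0" by (auto simp: N_def)
  qed
  \<comment> \<open>Completing the square: \<open>(\<Delta> - M^2 * h) * (T - h)\<close> falls short
    of \<open>(S - M * h)^2\<close> by exactly \<open>h * (sqrt \<Delta> - M * sqrt T)^2\<close>,
    which is positive because \<open>N0 * sqrt T = sqrt \<Delta>\<close> and
    \<open>M < N0\<close>.\<close>
  have FS: "F h < S" if h: "0 < h" "h < h1" for h
  proof -
    have "(N h * (T - h))\<^sup>2 = (P h - ?q b) * (T - h)" using N2(1)[OF h] by (simp add: power_mult_distrib power2_eq_square[of "T - h"] mult.assoc[symmetric])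
    also have "\<dots> = (\<Delta> - M\<^sup>2 * h) * (T - h)" by (simp add: P_def \<Delta>_def)
    also have "\<dots> = (S - M * h)\<^sup>2 - h * (sqrt \<Delta> - M * sqrt T)\<^sup>2"
    proof -
      have "(sqrt \<Delta>)\<^sup>2 = \<Delta>" "(sqrt T)\<^sup>2 = T" using \<Delta> T by simp_all
      then have "(\<Delta> - M\<^sup>2 * h) * (T - h) = ((sqrt \<Delta>)\<^sup>2 - M\<^sup>2 * h) * ((sqrt T)\<^sup>2 - h)" by simp
      also have "\<dots> = (sqrt \<Delta> * sqrt T - M * h)\<^sup>2 - h * (sqrt \<Delta> - M * sqrt T)\<^sup>2"
        by (simp add: power2_eq_square algebra_simps)
      finally show ?thesis by (simp add: S_def)
    qed
    also have "\<dots> < (S - M * h)\<^sup>2"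
    proof -
      have "M * sqrt T < N0 * sqrt T" using M T by simp
      then have "(sqrt \<Delta> - M * sqrt T)\<^sup>2 > 0" unfolding N0T(2) by simp
      then show ?thesis using h by simp
    qed
    finally have "N h * (T - h) < S - M * h" by (rule power2_less_imp_less) (use good[OF h] in simp)
    then show ?thesis by (simp add: F_def)
  qed
  have fan: "fan \<gamma> rm (W h + F h) rp (W h)" if h: "0 < h" "h < h1" for h
  proof -
    note gd = good[OF h]
    have ah: "a + h > 0" using ab h by simp
    have e1: "(1 / (a + h)) * \<epsilon>1 h = P h - ?q (a + h)" using ah by (simp add: \<epsilon>1_def)
    show ?thesis
    proof (rule fan_lagrangian[where r="1 / (a + h)" and ?\<epsilon>1.0="\<epsilon>1 h" and ?\<epsilon>2.0=\<epsilon>2 and \<mu>="W h + F h - N h * b" and \<nu>="W h - M * a"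
          and \<beta>="\<beta> h" and k="- N h" and l="- M"])
      show "1 / (a + h) > 0" "\<epsilon>2 > 0" using ah \<epsilon>2 by auto
      show "\<epsilon>1 h > 0" using gd ah by (simp add: \<epsilon>1_def)
      show "W h + F h - N h * b < W h - M * a" using gd by simp
      show "rm * (W h + F h - N h * b - (W h + F h)) = - N h" using r by (simp add: b_def)
      show "rp * (W h - M * a - W h) = - M" using r by (simp add: a_def)
      have "W h + F h - N h * b - \<beta> h = - N h * (a + h)" by (simp add: F_def \<beta>_def T_def algebra_simps)
      then show "1 / (a + h) * (W h + F h - N h * b - \<beta> h) = - N h" using ah by simp
      have "W h - M * a - \<beta> h = - M * (a + h)" by (simp add: \<beta>_def algebra_simps)
      then show "1 / (a + h) * (W h - M * a - \<beta> h) = - M" using ah by simp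
      have "- N h * (W h + F h - \<beta> h) = - ((N h)\<^sup>2 * (T - h))" by (simp add: F_def \<beta>_def power2_eq_square)
      then show "- N h * (W h + F h - \<beta> h) = pressure \<gamma> rm - (1 / (a + h) * \<epsilon>1 h + ?q (a + h))"
        unfolding e1 N2(1)[OF h] by (simp add: ab)
      show "- M * (\<beta> h - W h) = 1 / (a + h) * \<epsilon>1 h + ?q (a + h) - pressure \<gamma> rp"
        unfolding e1 by (simp add: \<beta>_def P_def ab power2_eq_square)
      show "- N h * (internal_energy \<gamma> rm + (W h + F h)\<^sup>2 / 2 - (?e (a + h) + ((\<beta> h)\<^sup>2 + \<epsilon>1 h + \<epsilon>2) / 2)) \<le> pressure \<gamma> rm * (W h + F h) - ?q (a + h) * \<beta> h"
        using gd unfolding LE_def ab by simp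
      show "- M * (?e (a + h) + ((\<beta> h)\<^sup>2 + \<epsilon>1 h + \<epsilon>2) / 2 - (internal_energy \<gamma> rp + (W h)\<^sup>2 / 2)) \<le> ?q (a + h) * \<beta> h - pressure \<gamma> rp * W h"
        using gd unfolding RE_def ab by simp
    qed
  qed
  define h0 where "h0 = h1 / 2"
  have h0: "0 < h0" "h0 < h1" using h1 by (auto simp: h0_def)
  show ?thesis
    unfolding S
  proof (intro exI[of _ "F h0"] conjI allI impI)
    show "F h0 < S" by (rule FS[OF h0])
    fix d assume d: "F h0 < d \<and> d < S"
    \<comment> \<open>\<open>F\<close> starts from the critical value \<open>S\<close> at
      \<open>h = 0\<close>; as \<open>d < S\<close>, the value found is a genuine
      perturbation.\<close>
    have "\<exists>h\<ge>0. h \<le> h0 \<and> F h = d"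
    proof (rule IVT2)
      show "F h0 \<le> d" "d \<le> F 0" "0 \<le> h0" using d h0 by (auto simp: F0)
      show "\<forall>h. 0 \<le> h \<and> h \<le> h0 \<longrightarrow> isCont F h"
      proof (intro allI impI cF)
        fix h assume "0 \<le> h \<and> h \<le> h0"
        then show "h < T" using good[OF h0] by linarith
      qed
    qed
    then obtain h where h: "0 \<le> h" "h \<le> h0" "F h = d" by blast
    have "h \<noteq> 0" using h(3) d F0 by auto
    then have "fan \<gamma> rm (W h + F h) rp (W h)" using h h0 by (intro fan) auto
    then show "fan \<gamma> rm (w d + d) rp (w d)" by (simp add: W_def h(3))
  qed
qed

lemma fan_exists:
  assumes g: "\<gamma> > 1" and r: "0 < rm" "0 < rp" "rm \<noteq> rp"
  shows "\<exists>V. V < sqrt ((rp - rm) * (pressure \<gamma> rp - pressure \<gamma> rm) / (rp * rm)) \<and>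
    (\<forall>vm. V < vm - vp \<and> vm - vp < sqrt ((rp - rm) * (pressure \<gamma> rp - pressure \<gamma> rm) / (rp * rm)) \<longrightarrow> fan \<gamma> rm vm rp vp)"
proof -
  let ?S = "sqrt ((rp - rm) * (pressure \<gamma> rp - pressure \<gamma> rm) / (rp * rm))"
  consider "rm < rp" | "rp < rm" using r by linarith
  then show ?thesis
  proof cases
    case 1
    obtain V where V: "V < ?S" "\<forall>d. V < d \<and> d < ?S \<longrightarrow> fan \<gamma> rm (vp + d) rp vp"
      using fan_exists_less[OF g r(1) 1, of "\<lambda>_. vp"] continuous_const by blast
    have "fan \<gamma> rm vm rp vp" if "V < vm - vp \<and> vm - vp < ?S" for vm
      using V(2)[rule_format, OF that] by simp
    with V(1) show ?thesis by blast
  next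
    case 2
    have eq: "(rm - rp) * (pressure \<gamma> rm - pressure \<gamma> rp) / (rm * rp) = (rp - rm) * (pressure \<gamma> rp - pressure \<gamma> rm) / (rp * rm)"
      by (simp add: algebra_simps)
    have c: "isCont (\<lambda>d. - vp - d) x" for x by (intro continuous_intros)
    obtain V where V: "V < ?S" "\<forall>d. V < d \<and> d < ?S \<longrightarrow> fan \<gamma> rp (- vp - d + d) rm (- vp - d)"
      using fan_exists_less[OF g r(2) 2 c] unfolding eq by blast
    have "fan \<gamma> rm vm rp vp" if "V < vm - vp \<and> vm - vp < ?S" for vm
      by (rule fan_reflect) (use V(2)[rule_format, OF that] in simp)
    with V(1) show ?thesis by blast
  qed
qed

section \<open>Integrals over a wedge\<close>

lemma integrable_bounded_support:
  fixes f :: "'a::euclidean_space \<Rightarrow> real"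
  assumes "f \<in> borel_measurable borel" "\<And>z. \<bar>f z\<bar> \<le> B" "bounded S" "\<And>z. z \<notin> S \<Longrightarrow> f z = 0"
  shows "integrable lborel f"
proof -
  obtain M where M: "\<And>z. z \<in> S \<Longrightarrow> norm z \<le> M" using assms(3) unfolding bounded_iff by blast
  show ?thesis
  proof (rule Bochner_Integration.integrable_bound)
    show "integrable lborel (\<lambda>z. indicator (cball 0 M) z * B)" by (rule integrable_indicator_bounded) auto
    show "AE z in lborel. norm (f z) \<le> norm (indicator (cball 0 M :: 'a set) z * B)"
    proof (rule AE_I2)
      fix z
      show "norm (f z) \<le> norm (indicator (cball 0 M :: 'a set) z * B)"
        using assms(2)[of z] assms(4)[of z] M[of z] by (cases "z \<in> S") auto
    qed
  qed (use assms(1) in simp)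
qed

text \<open>On every time slice the map is a translation of the plane. Boundedness and bounded
  support give the integrability that Fubini needs before and after the shear.\<close>

lemma integral_shear:
  fixes F :: "spacetime \<Rightarrow> real" and c :: "real^2"
  assumes m[measurable]: "F \<in> borel_measurable borel" and B: "\<And>z. \<bar>F z\<bar> \<le> B" and S: "bounded S" "\<And>z. z \<notin> S \<Longrightarrow> F z = 0"
  shows "(\<integral>z. F z \<partial>lborel) = (\<integral>z. F (fst z + snd z *\<^sub>R c, snd z) \<partial>lborel)"
    "integrable lborel (\<lambda>z. F (fst z + snd z *\<^sub>R c, snd z))"
proof -
  let ?F' = "\<lambda>z::spacetime. F (fst z + snd z *\<^sub>R c, snd z)"
  have sh: "(\<lambda>z::spacetime. (fst z + snd z *\<^sub>R c, snd z)) \<in> borel_measurable borel"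
    by (intro borel_measurable_continuous_onI continuous_intros)
  have m': "?F' \<in> borel_measurable borel" using measurable_compose[OF sh m] by simp
  obtain M where M: "\<And>z. z \<in> S \<Longrightarrow> norm z \<le> M" "M \<ge> 0" using S(1) unfolding bounded_pos by (metis less_imp_le)
  have i: "integrable lborel F" by (rule integrable_bounded_support[OF m B S])
  show i': "integrable lborel ?F'"
  proof (rule integrable_bounded_support[OF m' B, of "cball 0 (M + M * norm c + M)"])
    fix z :: spacetime assume z: "z \<notin> cball 0 (M + M * norm c + M)"
    have "(fst z + snd z *\<^sub>R c, snd z) \<notin> S"
    proof
      assume "(fst z + snd z *\<^sub>R c, snd z) \<in> S"
      from M(1)[OF this] have n: "norm (fst z + snd z *\<^sub>R c) \<le> M" "\<bar>snd z\<bar> \<le> M"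
        using norm_fst_le[of "fst z + snd z *\<^sub>R c" "snd z"] norm_snd_le[of "snd z" "fst z + snd z *\<^sub>R c"] by auto
      have "norm (fst z) \<le> norm (fst z + snd z *\<^sub>R c) + norm (snd z *\<^sub>R c)"
        using norm_triangle_ineq4[of "fst z + snd z *\<^sub>R c" "snd z *\<^sub>R c"] by simp
      also have "\<dots> \<le> M + M * norm c" using n by (auto intro!: add_mono mult_right_mono)
      finally have "norm z \<le> M + M * norm c + M"
        using n(2) norm_Pair_le[of "fst z" "snd z"] by simp
      with z show False by simp
    qed
    then show "?F' z = 0" using S(2) by simp
  qed simp
  have "(\<integral>z. F z \<partial>lborel) = (\<integral>t. (\<integral>x. F (x, t) \<partial>lborel) \<partial>lborel)"
    using lborel_pair.integral_snd[of "\<lambda>x t. F (x, t)"] i by (simp add: lborel_prod case_prod_beta')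
  also have "\<dots> = (\<integral>t. (\<integral>x. ?F' (x, t) \<partial>lborel) \<partial>lborel)"
  proof (rule Bochner_Integration.integral_cong[OF refl])
    fix t :: real
    have "(\<lambda>x::real^2. (x, t)) \<in> borel_measurable borel" by (intro borel_measurable_continuous_onI continuous_intros)
    from measurable_compose[OF this m] have "(\<lambda>x. F (x, t)) \<in> borel_measurable borel" by simp
    from integral_translate[OF this, of "t *\<^sub>R c"] show "(\<integral>x. F (x, t) \<partial>lborel) = (\<integral>x. ?F' (x, t) \<partial>lborel)" by simp
  qed
  also have "\<dots> = (\<integral>z. ?F' z \<partial>lborel)"
    using lborel_pair.integral_snd[of "\<lambda>x t. ?F' (x, t)"] i' by (simp add: lborel_prod case_prod_beta')
  finally show "(\<integral>z. F z \<partial>lborel) = (\<integral>z. ?F' z \<partial>lborel)" .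
qed

lemma integral_halfline_deriv:
  fixes f f' :: "real \<Rightarrow> real"
  assumes d: "\<And>t. (f has_real_derivative f' t) (at t)" and c: "continuous_on UNIV f'" and z: "\<And>t. t \<ge> T \<Longrightarrow> f t = 0 \<and> f' t = 0"
  shows "(\<integral>t. indicator {0..} t * f' t \<partial>lborel) = - f 0"
proof -
  define T' where "T' = max T 0"
  have T': "0 \<le> T'" "T \<le> T'" by (auto simp: T'_def)
  have "has_bochner_integral lborel (\<lambda>t. f' t * indicator {0..T'} t) (f T' - f 0)"
    by (rule has_bochner_integral_FTC_Icc_real) (use T' d c in \<open>auto simp: continuous_on_eq_continuous_at\<close>)
  then have "(\<integral>t. indicator {0..T'} t * f' t \<partial>lborel) = f T' - f 0" by (simp add: has_bochner_integral_iff mult.commute)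
  moreover have "indicator {0..T'} t * f' t = indicator {0..} t * f' t" for t
    using z[of t] T' by (cases "t \<le> T'") (auto simp: indicator_def)
  ultimately show ?thesis using z[OF T'(2)] by simp
qed

text \<open>The integrand is the derivative along the straight lines with velocity \<open>c\<close>.
  The shear makes them vertical, and the fundamental theorem of calculus on each half-line leaves
  only the value at time 0.\<close>

lemma integral_transport:
  fixes A :: "(real^2) set" and c :: "real^2"
  assumes C: "C1_grad \<psi> G" and S: "bounded S" "\<And>z. z \<notin> S \<Longrightarrow> \<psi> z = 0 \<and> G z = 0" and A: "A \<in> sets borel"
  shows "(\<integral>z. indicator {z. snd z \<ge> 0 \<and> fst z - snd z *\<^sub>R c \<in> A} z * (G z \<bullet> (c, 1)) \<partial>lborel)
    = - (\<integral>x. indicator A x * \<psi> (x, 0) \<partial>lborel)"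
proof -
  let ?R = "{z::spacetime. snd z \<ge> 0 \<and> fst z - snd z *\<^sub>R c \<in> A}"
  let ?F = "\<lambda>z. indicator ?R z * (G z \<bullet> (c, 1))"
  have cG: "continuous_on UNIV G" using C by (simp add: C1_grad_def)
  have cg: "continuous_on UNIV (\<lambda>z. G z \<bullet> (c, 1))" by (intro continuous_intros cG)
  have mR: "?R \<in> sets borel"
  proof -
    have "(\<lambda>z::spacetime. fst z - snd z *\<^sub>R c) \<in> borel_measurable borel" by (intro borel_measurable_continuous_onI continuous_intros)
    from measurable_sets[OF this A] have "{z::spacetime. fst z - snd z *\<^sub>R c \<in> A} \<in> sets borel" by (simp add: vimage_def)
    moreover have "{z::spacetime. snd z \<ge> 0} \<in> sets borel"
      by (intro borel_closed closed_Collect_le continuous_intros)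
    ultimately have "{z::spacetime. snd z \<ge> 0} \<inter> {z. fst z - snd z *\<^sub>R c \<in> A} \<in> sets borel" by (rule sets.Int[rotated])
    then show ?thesis by (simp add: Collect_conj_eq)
  qed
  have mF: "?F \<in> borel_measurable borel"
    by (intro borel_measurable_times borel_measurable_indicator mR borel_measurable_continuous_onI cg)
  obtain B where B: "B > 0" "\<And>z. norm (G z \<bullet> (c, 1)) \<le> B"
    using continuous_vanishing_bounded[OF cg S(1)] S(2) by auto
  have FB: "\<bar>?F z\<bar> \<le> B" for z using B(2)[of z] B(1) by (auto simp: indicator_def)
  have F0: "?F z = 0" if "z \<notin> S" for z using S(2)[OF that] by simp
  note sh = integral_shear[OF mF FB S(1) F0, of c]
  obtain M where M: "\<And>z. z \<in> S \<Longrightarrow> norm z \<le> M" using S(1) unfolding bounded_iff by blast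
  have "(\<integral>z. ?F z \<partial>lborel) = (\<integral>z. ?F (fst z + snd z *\<^sub>R c, snd z) \<partial>lborel)" by (rule sh(1))
  also have "\<dots> = (\<integral>x. (\<integral>t. ?F (x + t *\<^sub>R c, t) \<partial>lborel) \<partial>lborel)"
    using lborel_pair.integral_fst'[of "\<lambda>z. ?F (fst z + snd z *\<^sub>R c, snd z)"] sh(2) by (simp add: lborel_prod)
  also have "\<dots> = (\<integral>x. - (indicator A x * \<psi> (x, 0)) \<partial>lborel)"
  proof (rule Bochner_Integration.integral_cong[OF refl])
    fix x :: "real^2"
    have "(\<integral>t. indicator {0..} t * (G (x + t *\<^sub>R c, t) \<bullet> (c, 1)) \<partial>lborel) = - \<psi> (x + 0 *\<^sub>R c, 0)"
    proof (rule integral_halfline_deriv[where T="M + 1"])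
      fix t :: real
      have "dir_deriv \<psi> (c, 1) (\<lambda>z. G z \<bullet> (c, 1))" by (rule C1_grad_dir_deriv[OF C])
      from dir_deriv_line[OF this, of "(x, 0)" t]
      show "((\<lambda>t. \<psi> (x + t *\<^sub>R c, t)) has_real_derivative G (x + t *\<^sub>R c, t) \<bullet> (c, 1)) (at t)" by simp
      show "continuous_on UNIV (\<lambda>t. G (x + t *\<^sub>R c, t) \<bullet> (c, 1))"
        by (intro continuous_intros continuous_on_compose2[OF cG]) auto
      assume t: "M + 1 \<le> t"
      have "(x + t *\<^sub>R c, t) \<notin> S"
      proof
        assume "(x + t *\<^sub>R c, t) \<in> S"
        from M[OF this] have "\<bar>t\<bar> \<le> M" using norm_snd_le[of t "x + t *\<^sub>R c"] by simp
        with t show False by simp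
      qed
      from S(2)[OF this] show "\<psi> (x + t *\<^sub>R c, t) = 0 \<and> G (x + t *\<^sub>R c, t) \<bullet> (c, 1) = 0" by simp
    qed
    moreover have "?F (x + t *\<^sub>R c, t) = indicator A x * (indicator {0..} t * (G (x + t *\<^sub>R c, t) \<bullet> (c, 1)))" for t
      by (auto simp: indicator_def)
    ultimately show "(\<integral>t. ?F (x + t *\<^sub>R c, t) \<partial>lborel) = - (indicator A x * \<psi> (x, 0))"
      by (simp only: Bochner_Integration.integral_mult_right_zero) simp
  qed
  finally show ?thesis by simp
qed

text \<open>The integral is a limit of differences \<open>\<integral> (1\<^sub>R(z - h e) - 1\<^sub>R(z)) \<psi>(z) / h\<close>, whose sign is clear
  from the monotonicity of \<open>R\<close> along \<open>e\<close>; no surface integral is needed.\<close>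

lemma integral_dir_deriv_sign:
  fixes \<psi> :: "spacetime \<Rightarrow> real"
  assumes C: "C1_grad \<psi> G" and S: "bounded S" "\<And>z. z \<notin> S \<Longrightarrow> \<psi> z = 0 \<and> G z = 0" and R: "R \<in> sets borel"
  shows "(\<And>z h. h > 0 \<Longrightarrow> z \<in> R \<Longrightarrow> z - h *\<^sub>R e \<in> R) \<Longrightarrow> (\<And>z h. h > 0 \<Longrightarrow> z - h *\<^sub>R e \<in> R \<Longrightarrow> z \<in> R \<or> \<psi> z \<ge> 0)
      \<Longrightarrow> (\<integral>z. indicator R z * (G z \<bullet> e) \<partial>lborel) \<ge> 0"
    "(\<And>z h. h > 0 \<Longrightarrow> z - h *\<^sub>R e \<in> R \<Longrightarrow> z \<in> R) \<Longrightarrow> (\<And>z h. h > 0 \<Longrightarrow> z \<in> R \<Longrightarrow> z - h *\<^sub>R e \<in> R \<or> \<psi> z \<ge> 0)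
      \<Longrightarrow> (\<integral>z. indicator R z * (G z \<bullet> e) \<partial>lborel) \<le> 0"
proof -
  have cG: "continuous_on UNIV (\<lambda>z. G z \<bullet> e)" using C by (auto simp: C1_grad_def intro!: continuous_intros)
  have c\<psi>: "continuous_on UNIV \<psi>" using C1_grad_continuous[OF C] .
  have m\<psi>: "\<psi> \<in> borel_measurable borel" using c\<psi> by (rule borel_measurable_continuous_onI)
  have i\<psi>: "integrable lborel \<psi>" by (rule continuous_vanishing_integrable[OF c\<psi> S(1)]) (use S(2) in auto)
  define Rh where "Rh n = {z. z - e /\<^sub>R real (Suc n) \<in> R}" for n
  have mRh: "Rh n \<in> sets borel" for n
  proof -
    have "(\<lambda>z::spacetime. z - e /\<^sub>R real (Suc n)) \<in> borel_measurable borel" by (intro borel_measurable_continuous_onI continuous_intros)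
    from measurable_sets[OF this R] show ?thesis by (simp add: vimage_def Rh_def)
  qed
  have iR: "integrable lborel (\<lambda>z. indicator Q z * \<psi> z)" if "Q \<in> sets borel" for Q
    using integrable_mult_indicator[of Q lborel \<psi>] that i\<psi> by simp
  have lim: "(\<lambda>n. real (Suc n) * ((\<integral>z. indicator R z * \<psi> (z + e /\<^sub>R real (Suc n)) \<partial>lborel) - (\<integral>z. indicator R z * \<psi> z \<partial>lborel)))
      \<longlonglongrightarrow> (\<integral>z. indicator R z * (G z \<bullet> e) \<partial>lborel)"
    by (rule difference_quotient_limit[OF C1_grad_dir_deriv[OF C] cG c\<psi> S(1) _ _ R]) (use S(2) in auto)
  have dif: "(\<integral>z. indicator R z * \<psi> (z + e /\<^sub>R real (Suc n)) \<partial>lborel) - (\<integral>z. indicator R z * \<psi> z \<partial>lborel)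
      = (\<integral>z. (indicator (Rh n) z - indicator R z) * \<psi> z \<partial>lborel)" for n
  proof -
    have "(\<integral>z. indicator (Rh n) (z + e /\<^sub>R real (Suc n)) * \<psi> (z + e /\<^sub>R real (Suc n)) \<partial>lborel) = (\<integral>z. indicator (Rh n) z * \<psi> z \<partial>lborel)"
      by (rule integral_translate[of "\<lambda>z. indicator (Rh n) z * \<psi> z"]) (use mRh m\<psi> in \<open>intro borel_measurable_times borel_measurable_indicator\<close>)
    moreover have "indicator (Rh n) (z + e /\<^sub>R real (Suc n)) = (indicator R z :: real)" for z by (simp add: Rh_def indicator_def)
    ultimately show ?thesis
      using Bochner_Integration.integral_diff[OF iR[OF mRh[of n]] iR[OF R]] by (simp add: left_diff_distrib)
  qed
  have inv: "inverse (real (Suc n)) > 0" for n by simp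
  show "(\<integral>z. indicator R z * (G z \<bullet> e) \<partial>lborel) \<ge> 0"
    if "\<And>z h. h > 0 \<Longrightarrow> z \<in> R \<Longrightarrow> z - h *\<^sub>R e \<in> R" "\<And>z h. h > 0 \<Longrightarrow> z - h *\<^sub>R e \<in> R \<Longrightarrow> z \<in> R \<or> \<psi> z \<ge> 0"
  proof (rule LIMSEQ_le_const[OF lim], intro exI allI impI)
    fix n
    have "(indicator (Rh n) z - indicator R z) * \<psi> z \<ge> 0" for z
      using that(1)[OF inv[of n], of z] that(2)[OF inv[of n], of z] by (auto simp: indicator_def Rh_def)
    then have "0 \<le> (\<integral>z. (indicator (Rh n) z - indicator R z) * \<psi> z \<partial>lborel)" by (rule Bochner_Integration.integral_nonneg)
    then show "0 \<le> real (Suc n) * ((\<integral>z. indicator R z * \<psi> (z + e /\<^sub>R real (Suc n)) \<partial>lborel) - (\<integral>z. indicator R z * \<psi> z \<partial>lborel))"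
      unfolding dif by simp
  qed
  show "(\<integral>z. indicator R z * (G z \<bullet> e) \<partial>lborel) \<le> 0"
    if "\<And>z h. h > 0 \<Longrightarrow> z - h *\<^sub>R e \<in> R \<Longrightarrow> z \<in> R" "\<And>z h. h > 0 \<Longrightarrow> z \<in> R \<Longrightarrow> z - h *\<^sub>R e \<in> R \<or> \<psi> z \<ge> 0"
  proof (rule LIMSEQ_le_const2[OF lim], intro exI allI impI)
    fix n
    have "0 \<le> - ((indicator (Rh n) z - indicator R z) * \<psi> z)" for z
      using that(1)[OF inv[of n], of z] that(2)[OF inv[of n], of z] by (auto simp: indicator_def Rh_def)
    then have "0 \<le> (\<integral>z. - ((indicator (Rh n) z - indicator R z) * \<psi> z) \<partial>lborel)" by (rule Bochner_Integration.integral_nonneg)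
    then have "(\<integral>z. (indicator (Rh n) z - indicator R z) * \<psi> z \<partial>lborel) \<le> 0" by simp
    then show "real (Suc n) * ((\<integral>z. indicator R z * \<psi> (z + e /\<^sub>R real (Suc n)) \<partial>lborel) - (\<integral>z. indicator R z * \<psi> z \<partial>lborel)) \<le> 0"
      unfolding dif by (intro mult_nonneg_nonpos) auto
  qed
qed

text \<open>With the left comparison strict and the right one not, the middle sector is empty at
  time 0, and the outer values agree there with \<open>riemann_data\<close>. Only times
  \<open>t \<ge> 0\<close> matter.\<close>

definition sectorwise :: "real \<Rightarrow> real \<Rightarrow> 'a \<Rightarrow> 'a \<Rightarrow> 'a \<Rightarrow> spacetime \<Rightarrow> 'a" where
  "sectorwise \<mu> \<nu> a b c z = (if fst z $ 2 < \<mu> * snd z then a else if fst z $ 2 \<ge> \<nu> * snd z then c else b)"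

text \<open>The numbers \<open>bm\<close> and \<open>-bp\<close> are the integrals of \<open>\<psi>\<close> over the interfaces \<open>x\<^sub>2 = \<mu> t\<close> and \<open>x\<^sub>2 = \<nu> t\<close>
  with respect to \<open>(x\<^sub>1, t)\<close>, and their factors are the Rankine--Hugoniot defects there.\<close>

lemma fan_identity:
  fixes \<psi> :: "spacetime \<Rightarrow> real"
  assumes C: "C1_grad \<psi> G" and S: "bounded S" "\<And>z. z \<notin> S \<Longrightarrow> \<psi> z = 0 \<and> G z = 0" and \<mu>\<nu>: "\<mu> < \<nu>"
  obtains bm bp where
    "(\<And>z. snd z \<ge> 0 \<Longrightarrow> \<psi> z \<ge> 0) \<Longrightarrow> bm \<ge> 0 \<and> bp \<le> 0"
    "\<And>k l. integrable lborel (\<lambda>x. (if x $ 2 < 0 then k else l) * \<psi> (x, 0))"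
    "\<And>fm f1 fp gm g1 gp q w B. \<lbrakk>local_divfree q w; q \<in> borel_measurable borel; w \<in> borel_measurable borel;
       \<And>z. \<bar>q z\<bar> \<le> B \<and> norm (w z) \<le> B; \<And>z. snd z < 0 \<Longrightarrow> q z = 0 \<and> w z = 0\<rbrakk> \<Longrightarrow>
      integrable lborel (\<lambda>z. indicator {z. snd z \<ge> 0} z * ((sectorwise \<mu> \<nu> fm f1 fp z + q z) * snd (G z) + (sectorwise \<mu> \<nu> gm g1 gp z + w z) \<bullet> space_part (G z))) \<and>
      (\<integral>z. indicator {z. snd z \<ge> 0} z * ((sectorwise \<mu> \<nu> fm f1 fp z + q z) * snd (G z) + (sectorwise \<mu> \<nu> gm g1 gp z + w z) \<bullet> space_part (G z)) \<partial>lborel)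
       + (\<integral>x. (if x $ 2 < 0 then fm else fp) * \<psi> (x, 0) \<partial>lborel)
      = bm * (\<mu> * (f1 - fm) + Im gm - Im g1) + bp * (\<nu> * (f1 - fp) + Im gp - Im g1)"
proof -
  let ?H = "{z::spacetime. snd z \<ge> 0}"
  let ?Pm = "{z::spacetime. snd z \<ge> 0 \<and> fst z $ 2 < \<mu> * snd z}"
  let ?Pp = "{z::spacetime. snd z \<ge> 0 \<and> fst z $ 2 \<ge> \<nu> * snd z}"
  have cG: "continuous_on UNIV G" using C by (simp add: C1_grad_def)
  have sets: "?H \<in> sets borel" "?Pm \<in> sets borel" "?Pp \<in> sets borel"
  proof -
    show H: "?H \<in> sets borel" by (intro borel_closed closed_Collect_le continuous_intros)
    have "{z::spacetime. fst z $ 2 < \<mu> * snd z} \<in> sets borel" "{z::spacetime. fst z $ 2 \<ge> \<nu> * snd z} \<in> sets borel"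
      by (intro borel_open open_Collect_less borel_closed closed_Collect_le continuous_intros)+
    from sets.Int[OF H this(1)] sets.Int[OF H this(2)] show "?Pm \<in> sets borel" "?Pp \<in> sets borel"
      by (simp_all add: Collect_conj_eq)
  qed
  have ci: "integrable lborel (\<lambda>z. G z \<bullet> e)" for e
    by (rule continuous_vanishing_integrable[OF _ S(1)]) (use cG S(2) in \<open>auto intro!: continuous_intros\<close>)
  have ri: "integrable lborel (\<lambda>z. indicator R z * (G z \<bullet> e))" if "R \<in> sets borel" for R e
    using integrable_mult_indicator[OF _ ci[of e], of R] that by simp
  define J where "J R e = (\<integral>z. indicator R z * (G z \<bullet> e) \<partial>lborel)" for R e
  define Jm where "Jm = (\<integral>x. indicator {x. x $ 2 < 0} x * \<psi> (x :: real^2, 0) \<partial>lborel)"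
  define Jp where "Jp = (\<integral>x. indicator {x. x $ 2 \<ge> 0} x * \<psi> (x :: real^2, 0) \<partial>lborel)"
  \<comment> \<open>A sector bounded by a line of slope \<open>k\<close> is swept out by
    transporting its initial slice with velocity \<open>(0, k)\<close>. So
    \<open>integral_transport\<close> expresses the time derivative by the \<open>x2\<close>
    derivative and the data at time 0.\<close>
  have tr: "J R axis_t + k * J R axis_x2 = - (\<integral>x. indicator A x * \<psi> (x, 0) \<partial>lborel)"
    if R: "R = {z. snd z \<ge> 0 \<and> fst z - snd z *\<^sub>R vector [0, k] \<in> A}" "R \<in> sets borel" and A: "A \<in> sets borel" for R A k
  proof -
    have "G z \<bullet> (vector [0, k], 1) = G z \<bullet> axis_t + k * (G z \<bullet> axis_x2)" for z
      by (subst inner_prod_def) (simp add: inner_vec_def sum_2)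
    then have "(\<integral>z. indicator R z * (G z \<bullet> axis_t) + k * (indicator R z * (G z \<bullet> axis_x2)) \<partial>lborel) = - (\<integral>x. indicator A x * \<psi> (x, 0) \<partial>lborel)"
      using integral_transport[OF C S A, of "vector [0, k]"] unfolding R(1) by (simp add: algebra_simps)
    then show ?thesis
      unfolding J_def using ri[OF R(2)] by (simp add: Bochner_Integration.integral_add del: inner_axes)
  qed
  have sA: "{x::real^2. x $ 2 < 0} \<in> sets borel" "{x::real^2. x $ 2 \<ge> 0} \<in> sets borel"
    by (intro borel_open open_Collect_less borel_closed closed_Collect_le continuous_intros)+
  have am: "J ?Pm axis_t + \<mu> * J ?Pm axis_x2 = - Jm" unfolding Jm_def
    by (rule tr[OF _ sets(2) sA(1)]) (simp add: algebra_simps)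
  have ap: "J ?Pp axis_t + \<nu> * J ?Pp axis_x2 = - Jp" unfolding Jp_def
    by (rule tr[OF _ sets(3) sA(2)]) (simp add: algebra_simps)
  have ip: "integrable lborel (\<lambda>x::real^2. \<psi> (x, 0))"
  proof (rule continuous_vanishing_integrable[of _ "fst ` S"])
    show "continuous_on UNIV (\<lambda>x::real^2. \<psi> (x, 0))"
      by (rule continuous_on_compose2[OF C1_grad_continuous[OF C]]) (auto intro!: continuous_intros)
    show "bounded (fst ` S)" using S(1) by (rule bounded_fst)
    show "\<psi> (x, 0) = 0" if "x \<notin> fst ` S" for x
      using S(2)[of "(x, 0)"] that by (metis fst_conv image_eqI)
  qed
  have iA: "integrable lborel (\<lambda>x::real^2. indicator A x * \<psi> (x, 0))" if "A \<in> sets borel" for A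
    using integrable_mult_indicator[OF _ ip, of A] that by simp
  have initi: "integrable lborel (\<lambda>x. (if x $ 2 < 0 then k else l) * \<psi> (x, 0))" for k l
  proof -
    have "integrable lborel (\<lambda>x. k * (indicator {x. x $ 2 < 0} x * \<psi> (x, 0)) + l * (indicator {x. x $ 2 \<ge> 0} x * \<psi> (x, 0)))"
      using iA[OF sA(1)] iA[OF sA(2)] by simp
    moreover have "k * (indicator {x. x $ 2 < 0} x * \<psi> (x, 0)) + l * (indicator {x. x $ 2 \<ge> 0} x * \<psi> (x, 0)) = (if x $ 2 < 0 then k else l) * \<psi> (x, 0)" for x
      by (auto simp: indicator_def)
    ultimately show ?thesis by simp
  qed
  have init: "(\<integral>x. (if x $ 2 < 0 then k else l) * \<psi> (x, 0) \<partial>lborel) = k * Jm + l * Jp" for k l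
  proof -
    have "(\<integral>x. (if x $ 2 < 0 then k else l) * \<psi> (x, 0) \<partial>lborel) =
      (\<integral>x. k * (indicator {x. x $ 2 < 0} x * \<psi> (x, 0)) + l * (indicator {x. x $ 2 \<ge> 0} x * \<psi> (x, 0)) \<partial>lborel)"
      by (rule Bochner_Integration.integral_cong) (auto simp: indicator_def)
    also have "\<dots> = k * Jm + l * Jp"
      unfolding Jm_def Jp_def using iA[OF sA(1)] iA[OF sA(2)] by (simp add: Bochner_Integration.integral_add)
    finally show ?thesis .
  qed
  have "J ?H axis_t + 0 * J ?H axis_x2 = - (\<integral>x. indicator UNIV x * \<psi> (x, 0) \<partial>lborel)"
    by (rule tr[OF _ sets(1)]) auto
  then have aH: "J ?H axis_t = - (Jm + Jp)" using init[of 1 1] by simp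
  \<comment> \<open>A region invariant under translations along \<open>e\<close> meets both sign
    conditions of \<open>integral_dir_deriv_sign\<close>.\<close>
  have zero: "J R e = 0" if "R \<in> sets borel" "\<And>z h. z - h *\<^sub>R e \<in> R \<longleftrightarrow> z \<in> R" for R e
    using integral_dir_deriv_sign[OF C S that(1), of e] that(2) unfolding J_def by (simp add: order_antisym)
  have e0: "J ?Pm axis_x1 = 0" "J ?Pp axis_x1 = 0" "J ?H axis_x1 = 0" "J ?H axis_x2 = 0"
    by (rule zero; use sets in \<open>simp add: axis_def\<close>)+
  show ?thesis
  proof (rule that[of "J ?Pm axis_x2" "J ?Pp axis_x2"])
    assume pos: "\<And>z. snd z \<ge> 0 \<Longrightarrow> \<psi> z \<ge> 0"
    have "J ?Pm axis_x2 \<ge> 0" unfolding J_def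
      by (rule integral_dir_deriv_sign(1)[OF C S sets(2)]) (use pos in \<open>auto simp: axis_def\<close>)
    moreover have "J ?Pp axis_x2 \<le> 0" unfolding J_def
      by (rule integral_dir_deriv_sign(2)[OF C S sets(3)]) (use pos in \<open>auto simp: axis_def\<close>)
    ultimately show "J ?Pm axis_x2 \<ge> 0 \<and> J ?Pp axis_x2 \<le> 0" by simp
  next
    show "integrable lborel (\<lambda>x. (if x $ 2 < 0 then k else l) * \<psi> (x, 0))" for k l by (rule initi)
  next
    fix fm f1 fp :: real and gm g1 gp :: complex and q w and B :: real
    assume cd: "local_divfree q w" and mq: "q \<in> borel_measurable borel" and mw: "w \<in> borel_measurable borel"
      and qB: "\<And>z. \<bar>q z\<bar> \<le> B \<and> norm (w z) \<le> B" and q0: "\<And>z. snd z < 0 \<Longrightarrow> q z = 0 \<and> w z = 0"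
    define K where "K R f g z = f * (indicator R z * (G z \<bullet> axis_t)) + Re g * (indicator R z * (G z \<bullet> axis_x1)) + Im g * (indicator R z * (G z \<bullet> axis_x2))" for R f g z
    have Ki: "integrable lborel (K R f g)" "(\<integral>z. K R f g z \<partial>lborel) = f * J R axis_t + Re g * J R axis_x1 + Im g * J R axis_x2"
      if "R \<in> sets borel" for R f g
      unfolding K_def J_def using ri[OF that, of axis_t] ri[OF that, of axis_x1] ri[OF that, of axis_x2]
      by (auto simp: Bochner_Integration.integral_add simp del: inner_axes)
    define X where "X z = w z \<bullet> space_part (G z) + q z * snd (G z)" for z
    have cs: "continuous_on UNIV (\<lambda>z. B * (norm (space_part (G z)) + \<bar>snd (G z)\<bar>))" by (intro continuous_intros cG)
    have spc0: "space_part 0 = 0" by (simp add: space_part_def Complex_eq_0)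
    have mspc: "(\<lambda>z. space_part (G z)) \<in> borel_measurable borel" and msnd: "(\<lambda>z. snd (G z)) \<in> borel_measurable borel"
      by (rule borel_measurable_continuous_onI; intro continuous_intros cG)+
    have B0: "0 \<le> B" using qB[of undefined] by linarith
    have Xi: "integrable lborel X"
    proof (rule Bochner_Integration.integrable_bound)
      show "integrable lborel (\<lambda>z. B * (norm (space_part (G z)) + \<bar>snd (G z)\<bar>))"
        by (rule continuous_vanishing_integrable[OF cs S(1)]) (use S(2) in \<open>simp add: spc0\<close>)
      show "X \<in> borel_measurable lborel"
        unfolding X_def using mq mw mspc msnd by (simp add: borel_measurable_add borel_measurable_inner borel_measurable_times)
      show "AE z in lborel. norm (X z) \<le> norm (B * (norm (space_part (G z)) + \<bar>snd (G z)\<bar>))"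
      proof (rule AE_I2)
        fix z
        have "\<bar>X z\<bar> \<le> norm (w z) * norm (space_part (G z)) + \<bar>q z\<bar> * \<bar>snd (G z)\<bar>"
          unfolding X_def using Cauchy_Schwarz_ineq2[of "w z" "space_part (G z)"] abs_triangle_ineq[of "w z \<bullet> space_part (G z)" "q z * snd (G z)"]
          by (simp add: abs_mult)
        also have "\<dots> \<le> B * norm (space_part (G z)) + B * \<bar>snd (G z)\<bar>"
          using qB[of z] by (intro add_mono mult_right_mono) auto
        finally show "norm (X z) \<le> norm (B * (norm (space_part (G z)) + \<bar>snd (G z)\<bar>))" using B0 by (simp add: abs_mult distrib_left)
      qed
    qed
    have bS: "bounded {z. G z \<noteq> 0}" using S by (meson bounded_subset mem_Collect_eq subsetI)
    have X0: "(\<integral>z. X z \<partial>lborel) = 0" using cd C bS unfolding local_divfree_def X_def by blast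
    \<comment> \<open>The field is split into the middle state on the whole half-space, the
      deviations of the outer states on their sectors, and the oscillation, whose integral vanishes.
      This avoids integrating over the wedge itself.\<close>
    have pw: "indicator ?H z * ((sectorwise \<mu> \<nu> fm f1 fp z + q z) * snd (G z) + (sectorwise \<mu> \<nu> gm g1 gp z + w z) \<bullet> space_part (G z))
      = K ?Pm (fm - f1) (gm - g1) z + K ?Pp (fp - f1) (gp - g1) z + K ?H f1 g1 z + X z" for z
    proof (cases "snd z \<ge> 0")
      case True
      have "\<mu> * snd z \<le> \<nu> * snd z" using \<mu>\<nu> True by (intro mult_right_mono) auto
      then consider "fst z $ 2 < \<mu> * snd z" "\<not> fst z $ 2 \<ge> \<nu> * snd z" | "\<not> fst z $ 2 < \<mu> * snd z" "fst z $ 2 \<ge> \<nu> * snd z"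
        | "\<not> fst z $ 2 < \<mu> * snd z" "\<not> fst z $ 2 \<ge> \<nu> * snd z" by linarith
      then show ?thesis
        using True by cases (simp_all add: K_def X_def sectorwise_def space_part_def inner_complex_def algebra_simps)
    next
      case False
      then show ?thesis using q0[of z] by (simp add: K_def X_def)
    qed
    have int: "integrable lborel (\<lambda>z. indicator ?H z * ((sectorwise \<mu> \<nu> fm f1 fp z + q z) * snd (G z) + (sectorwise \<mu> \<nu> gm g1 gp z + w z) \<bullet> space_part (G z)))"
      unfolding pw using Ki(1)[OF sets(1)] Ki(1)[OF sets(2)] Ki(1)[OF sets(3)] Xi by simp
    have "(\<integral>z. indicator ?H z * ((sectorwise \<mu> \<nu> fm f1 fp z + q z) * snd (G z) + (sectorwise \<mu> \<nu> gm g1 gp z + w z) \<bullet> space_part (G z)) \<partial>lborel)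
      = (fm - f1) * J ?Pm axis_t + Im (gm - g1) * J ?Pm axis_x2 + ((fp - f1) * J ?Pp axis_t + Im (gp - g1) * J ?Pp axis_x2) + f1 * J ?H axis_t"
      unfolding pw using Ki[OF sets(1)] Ki[OF sets(2)] Ki[OF sets(3)] Xi X0 e0 by (simp add: Bochner_Integration.integral_add)
    also have "\<dots> = (fm - f1) * (- Jm - \<mu> * J ?Pm axis_x2) + Im (gm - g1) * J ?Pm axis_x2 + ((fp - f1) * (- Jp - \<nu> * J ?Pp axis_x2) + Im (gp - g1) * J ?Pp axis_x2) + f1 * (- (Jm + Jp))"
    proof -
      have "J ?Pm axis_t = - Jm - \<mu> * J ?Pm axis_x2" "J ?Pp axis_t = - Jp - \<nu> * J ?Pp axis_x2" using am ap by linarith+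
      then show ?thesis by (simp only: aH)
    qed
    finally have "(\<integral>z. indicator ?H z * ((sectorwise \<mu> \<nu> fm f1 fp z + q z) * snd (G z) + (sectorwise \<mu> \<nu> gm g1 gp z + w z) \<bullet> space_part (G z)) \<partial>lborel)
       + (\<integral>x. (if x $ 2 < 0 then fm else fp) * \<psi> (x, 0) \<partial>lborel)
      = J ?Pm axis_x2 * (\<mu> * (f1 - fm) + Im gm - Im g1) + J ?Pp axis_x2 * (\<nu> * (f1 - fp) + Im gp - Im g1)"
      unfolding init by (simp add: algebra_simps)
    with int show "integrable lborel (\<lambda>z. indicator ?H z * ((sectorwise \<mu> \<nu> fm f1 fp z + q z) * snd (G z) + (sectorwise \<mu> \<nu> gm g1 gp z + w z) \<bullet> space_part (G z))) \<and>
      (\<integral>z. indicator ?H z * ((sectorwise \<mu> \<nu> fm f1 fp z + q z) * snd (G z) + (sectorwise \<mu> \<nu> gm g1 gp z + w z) \<bullet> space_part (G z)) \<partial>lborel)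
       + (\<integral>x. (if x $ 2 < 0 then fm else fp) * \<psi> (x, 0) \<partial>lborel)
      = J ?Pm axis_x2 * (\<mu> * (f1 - fm) + Im gm - Im g1) + J ?Pp axis_x2 * (\<nu> * (f1 - fp) + Im gp - Im g1)" by blast
  qed
qed

section \<open>Admissible weak solutions\<close>

lemma test_function_derivative:
  assumes "test_function \<phi>"
  shows "(\<phi> has_derivative frechet_derivative \<phi> (at z)) (at z)"
    "continuous_on UNIV (\<lambda>z. frechet_derivative \<phi> (at z) h)" "compact (closure {z. \<phi> z \<noteq> 0})"
    "continuous_on UNIV \<phi>"
proof -
  have "class_C (Suc 0) \<phi>" using assms by (auto simp: test_function_def smooth_def)
  then have "(\<forall>z. \<phi> differentiable (at z)) \<and> (\<forall>h. continuous_on UNIV (\<lambda>z. frechet_derivative \<phi> (at z) h))"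
    unfolding class_C.simps .
  then have *: "\<phi> differentiable (at z)" "continuous_on UNIV (\<lambda>z. frechet_derivative \<phi> (at z) h)" for z h by blast+
  then show "(\<phi> has_derivative frechet_derivative \<phi> (at z)) (at z)" by (simp add: frechet_derivative_works)
  show "continuous_on UNIV (\<lambda>z. frechet_derivative \<phi> (at z) h)" by (rule *(2))
  show "compact (closure {z. \<phi> z \<noteq> 0})" using assms by (simp add: test_function_def)
  show "continuous_on UNIV \<phi>"
    using *(1) by (intro continuous_at_imp_continuous_on ballI differentiable_imp_continuous_within)
qed

lemma time_deriv_eq:
  assumes "test_function \<phi>"
  shows "time_deriv \<phi> z = frechet_derivative \<phi> (at z) axis_t"
proof -
  obtain x t where z: "z = (x, t)" by (cases z)
  let ?D = "frechet_derivative \<phi> (at (x, t))"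
  have D: "(\<phi> has_derivative ?D) (at (x, t))" by (rule test_function_derivative[OF assms])
  have "((\<lambda>s. (x, s)) has_derivative (\<lambda>s. (0, s))) (at t)"
    by (intro has_derivative_Pair has_derivative_const has_derivative_ident)
  from has_derivative_compose[OF this D]
  have D': "((\<lambda>s. \<phi> (x, s)) has_derivative (\<lambda>s. ?D (0, s))) (at t)" .
  have sc: "?D (0, s) = s *\<^sub>R ?D axis_t" for s
  proof -
    have "?D (s *\<^sub>R axis_t) = s *\<^sub>R ?D axis_t" using has_derivative_linear[OF D] by (rule linear_scale)
    then show ?thesis by simp
  qed
  have "((\<lambda>s. \<phi> (x, s)) has_vector_derivative ?D axis_t) (at t)"
    unfolding has_vector_derivative_def sc[symmetric] by (rule D')
  from vector_derivative_at[OF this] show ?thesis by (simp add: time_deriv_def z)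
qed

lemma space_frechet_eq:
  assumes "test_function \<phi>"
  shows "frechet_derivative (\<lambda>y. \<phi> (y, t)) (at x) h = frechet_derivative \<phi> (at (x, t)) (h, 0)"
proof -
  let ?D = "frechet_derivative \<phi> (at (x, t))"
  have D: "(\<phi> has_derivative ?D) (at (x, t))" by (rule test_function_derivative[OF assms])
  have "((\<lambda>y. (y, t)) has_derivative (\<lambda>y. (y, 0))) (at x)"
    by (intro has_derivative_Pair has_derivative_const has_derivative_ident)
  from has_derivative_compose[OF this D]
  have "((\<lambda>y. \<phi> (y, t)) has_derivative (\<lambda>y. ?D (y, 0))) (at x)" .
  from frechet_derivative_at[OF this] show ?thesis by (metis)
qed

text \<open>The functional \<open>L\<close> allows scalar test functions and the components of
  vector-valued ones to be treated alike.\<close>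

lemma test_function_C1:
  fixes L :: "'b::real_normed_vector \<Rightarrow> real"
  assumes t: "test_function \<phi>" and L: "bounded_linear L"
  obtains G S where "C1_grad (\<lambda>z. L (\<phi> z)) G" "bounded S" "\<And>z. z \<notin> S \<Longrightarrow> L (\<phi> z) = 0 \<and> G z = 0"
    "\<And>z h. G z \<bullet> h = L (frechet_derivative \<phi> (at z) h)"
proof -
  let ?D = "\<lambda>z. frechet_derivative \<phi> (at z)"
  note d = test_function_derivative[OF t]
  define G :: "spacetime \<Rightarrow> spacetime" where "G z = (\<Sum>b\<in>Basis. L (?D z b) *\<^sub>R b)" for z
  interpret L: bounded_linear L by (rule L)
  have lin: "linear (\<lambda>h. L (?D z h))" for z
    using has_derivative_linear[OF d(1)] L.linear_axioms linear_compose[of "?D z" L] by (simp add: o_def)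
  have G: "G z \<bullet> h = L (?D z h)" for z h
  proof -
    have "L (?D z h) = L (?D z (\<Sum>b\<in>Basis. (h \<bullet> b) *\<^sub>R b))" by (simp add: euclidean_representation)
    also have "\<dots> = (\<Sum>b\<in>Basis. (h \<bullet> b) * L (?D z b))"
      by (simp only: linear_sum[OF lin] linear_scale[OF lin] real_scaleR_def)
    also have "\<dots> = G z \<bullet> h" unfolding G_def inner_sum_left by (simp add: inner_commute mult.commute)
    finally show ?thesis by simp
  qed
  have "C1_grad (\<lambda>z. L (\<phi> z)) G"
    unfolding C1_grad_def G
  proof (intro conjI allI)
    show "((\<lambda>z. L (\<phi> z)) has_derivative (\<lambda>h. L (?D z h))) (at z)" for z
      by (rule L.has_derivative[OF d(1)])
    show "continuous_on UNIV G"
      unfolding G_def by (intro continuous_intros L.continuous_on d(2))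
  qed
  moreover have "bounded (closure {z. \<phi> z \<noteq> 0})" using d(3) by (rule compact_imp_bounded)
  moreover have "L (\<phi> z) = 0 \<and> G z = 0" if z: "z \<notin> closure {z. \<phi> z \<noteq> 0}" for z
  proof
    have "\<phi> z = 0" using z closure_subset[of "{z. \<phi> z \<noteq> 0}"] by auto
    then show "L (\<phi> z) = 0" by simp
    have "((\<lambda>_. 0) has_derivative (\<lambda>_. 0)) (at z)" by (rule has_derivative_const)
    then have "(\<phi> has_derivative (\<lambda>_. 0)) (at z)"
      by (rule has_derivative_transform_within_open[where s="- closure {z. \<phi> z \<noteq> 0}"])
        (use z closure_subset[of "{z. \<phi> z \<noteq> 0}"] in \<open>auto simp: open_Compl\<close>)
    then have "?D z = (\<lambda>_. 0)" using frechet_derivative_at by metis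
    then show "G z = 0" by (simp add: G_def)
  qed
  ultimately show ?thesis using G by (rule that)
qed

section \<open>Transfer from the half-space measure to Borel integrals\<close>

lemma AE_half_space_lborel: "(AE z in half_space. Q z) \<Longrightarrow> AE z in lborel. snd z \<ge> 0 \<longrightarrow> Q z"
proof -
  assume a: "AE z in half_space. Q z"
  have e: "(UNIV::(real^2) set) \<times> {0..} = {z. snd z \<ge> (0::real)}" by auto
  have "{z::spacetime. snd z \<ge> 0} \<in> sets lborel"
    unfolding sets_lborel by (intro borel_closed closed_Collect_le continuous_intros)
  then have "AE z in lebesgue. snd z \<ge> 0 \<longrightarrow> Q z"
    using a unfolding half_space_def e by (subst (asm) AE_restrict_space_iff) auto
  then show ?thesis by (simp add: AE_completion_iff)
qed

lemma half_space_measurable: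
  fixes f :: "spacetime \<Rightarrow> 'b::{second_countable_topology, t2_space}"
  assumes "f \<in> borel_measurable borel"
  shows "f \<in> borel_measurable half_space"
  unfolding half_space_def by (rule measurable_restrict_space1[OF measurable_completion]) (use assms in simp)

lemma half_space_integral:
  fixes f g :: "spacetime \<Rightarrow> real"
  assumes m: "f \<in> borel_measurable borel" "g \<in> borel_measurable borel" and ae: "AE z in lborel. snd z \<ge> 0 \<longrightarrow> f z = g z"
  shows "(\<integral>z. f z \<partial>half_space) = (\<integral>z. indicator {z. snd z \<ge> 0} z * g z \<partial>lborel)"
proof -
  have e: "(UNIV::(real^2) set) \<times> {0..} = {z. snd z \<ge> (0::real)}" by auto
  have H: "{z::spacetime. snd z \<ge> 0} \<in> sets borel"
    by (intro borel_closed closed_Collect_le continuous_intros)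
  have "(\<integral>z. f z \<partial>half_space) = (\<integral>z. indicator {z. snd z \<ge> 0} z *\<^sub>R f z \<partial>lebesgue)"
    unfolding half_space_def e using H by (subst integral_restrict_space) auto
  also have "\<dots> = (\<integral>z. indicator {z. snd z \<ge> 0} z * f z \<partial>lborel)"
    using m H by (subst integral_completion) auto
  also have "\<dots> = (\<integral>z. indicator {z. snd z \<ge> 0} z * g z \<partial>lborel)"
  proof (rule integral_cong_AE)
    show "AE z in lborel. indicator {z. snd z \<ge> 0} z * f z = indicator {z. snd z \<ge> 0} z * g z"
      using ae by eventually_elim (auto simp: indicator_def)
  qed (use m H in auto)
  finally show ?thesis .
qed

text \<open>Unlike the middle sector of \<open>sectorwise\<close> it omits the left bounding line,
  so that it is open and can be tiled by boxes.\<close>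

definition wedge :: "real \<Rightarrow> real \<Rightarrow> spacetime set" where
  "wedge \<mu> \<nu> = {z. snd z > 0 \<and> \<mu> * snd z < fst z $ 2 \<and> fst z $ 2 < \<nu> * snd z}"

lemma open_wedge: "open (wedge \<mu> \<nu>)"
  unfolding wedge_def by (intro open_Collect_conj open_Collect_less continuous_intros)

lemma unbounded_wedge:
  assumes "\<mu> < \<nu>"
  shows "\<not> bounded (wedge \<mu> \<nu>)"
proof
  assume "bounded (wedge \<mu> \<nu>)"
  then obtain M where M: "\<And>z. z \<in> wedge \<mu> \<nu> \<Longrightarrow> norm z \<le> M" unfolding bounded_iff by blast
  let ?z = "(vector [\<bar>M\<bar> + 1, (\<mu> + \<nu>) / 2], 1) :: spacetime"
  have "?z \<in> wedge \<mu> \<nu>" using assms by (simp add: wedge_def)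
  then have "norm ?z \<le> M" by (rule M)
  moreover have "\<bar>fst ?z $ 1\<bar> \<le> norm ?z"
    using component_le_norm_cart[of "fst ?z" 1] norm_fst_le[of "fst ?z" "snd ?z"] by simp
  ultimately show False by simp
qed

lemma borel_measurable_sectorwise:
  fixes a b c :: "spacetime \<Rightarrow> 'b::{second_countable_topology, t2_space}"
  assumes "a \<in> borel_measurable borel" "b \<in> borel_measurable borel" "c \<in> borel_measurable borel"
  shows "(\<lambda>z. sectorwise \<mu> \<nu> (a z) (b z) (c z) z) \<in> borel_measurable borel"
proof -
  have "{z::spacetime. fst z $ 2 < \<mu> * snd z} \<in> sets borel" "{z::spacetime. fst z $ 2 \<ge> \<nu> * snd z} \<in> sets borel"
    by (intro borel_open open_Collect_less borel_closed closed_Collect_le continuous_intros)+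
  then show ?thesis unfolding sectorwise_def using assms by (intro measurable_If) auto
qed

lemma local_divfree_scale: "local_divfree q w \<Longrightarrow> local_divfree (\<lambda>z. k * q z) (\<lambda>z. k *\<^sub>R w z)"
proof -
  assume a: "local_divfree q w"
  have "(k *\<^sub>R w z) \<bullet> space_part (G z) + k * q z * snd (G z) = k * (w z \<bullet> space_part (G z) + q z * snd (G z))" for z and G :: "spacetime \<Rightarrow> spacetime"
    by (simp add: algebra_simps)
  note eq = this
  show ?thesis
    unfolding local_divfree_def eq
  proof (intro allI impI)
    fix \<psi> :: "spacetime \<Rightarrow> real" and G assume "C1_grad \<psi> G \<and> bounded {z. G z \<noteq> 0}"
    then have "(\<integral>z. w z \<bullet> space_part (G z) + q z * snd (G z) \<partial>lborel) = 0" using a unfolding local_divfree_def by blast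
    then show "(\<integral>z. k * (w z \<bullet> space_part (G z) + q z * snd (G z)) \<partial>lborel) = 0" by simp
  qed
qed

lemma inner_axis_Pair: "z \<bullet> (axis i 1, 0) = fst z $ i" for z :: spacetime
  by (simp add: inner_prod_def inner_axis)

lemma C1_grad_measurable:
  assumes "C1_grad \<psi> G"
  shows "(\<lambda>z::spacetime. snd (G z :: spacetime)) \<in> borel_measurable borel" "(\<lambda>z. fst (G z) $ i) \<in> borel_measurable borel"
    "(\<lambda>z. space_part (G z)) \<in> borel_measurable borel"
  by (rule borel_measurable_continuous_onI; use assms in \<open>auto simp: C1_grad_def intro!: continuous_intros\<close>)+

lemma lebesgue_integral_lborel:
  fixes f g :: "'a::euclidean_space \<Rightarrow> real"
  assumes "integrable lborel g" "\<And>x. f x = g x"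
  shows "(\<integral>x. f x \<partial>lebesgue) = (\<integral>x. g x \<partial>lborel)"
  using integral_completion[of g lborel] borel_measurable_integrable[OF assms(1)] assms(2) by simp

text \<open>Replaces the quadratic entries of the flux by quantities that are linear in the field
  \<open>u\<close>, with the factors grouped by component of the test function.\<close>

lemma momentum_flux_identity:
  fixes a b :: real
  assumes "a * a = P" "b * b = Q" "a * b = R"
  shows "r * (a * s1 + b * s2) + r * (a * a * g11 + a * b * g12 + b * a * g21 + b * b * g22) + k * (g11 + g22)
    = (r * a) * s1 + ((r * P + k) * g11 + r * R * g12) + ((r * b) * s2 + (r * R * g21 + (r * Q + k) * g22))"
  unfolding assms[symmetric] by algebra

text \<open>The line of speed \<open>\<mu>\<close> belongs to the middle sector but not to
  \<open>wedge\<close>, where the constraint is known; it must be discarded as a null set.\<close>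

lemma AE_off_line: "AE z::spacetime in lborel. fst z $ 2 \<noteq> \<mu> * snd z"
proof -
  let ?a = "(axis 2 1, - \<mu>) :: spacetime"
  have "?a \<noteq> 0" by (simp add: zero_prod_def axis_eq_0_iff)
  then have "negligible {z. ?a \<bullet> z = 0}" by (intro negligible_hyperplane) simp
  moreover have "{z. ?a \<bullet> z = 0} \<in> sets borel" by (intro borel_closed closed_Collect_eq continuous_intros)
  ultimately have "{z. ?a \<bullet> z = 0} \<in> null_sets lborel"
    by (simp add: negligible_iff_null_sets null_sets_completion_iff)
  from AE_not_in[OF this] show ?thesis
    by eventually_elim (auto simp: inner_prod_def inner_axis' )
qed

definition fan_density :: "real \<Rightarrow> real \<Rightarrow> real \<Rightarrow> real \<Rightarrow> real \<Rightarrow> spacetime \<Rightarrow> real" where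
  "fan_density \<mu> \<nu> rm r rp z = sectorwise \<mu> \<nu> rm r rp z"

definition fan_velocity :: "real \<Rightarrow> real \<Rightarrow> real \<Rightarrow> real \<Rightarrow> real \<Rightarrow> real \<Rightarrow> (spacetime \<Rightarrow> complex) \<Rightarrow> spacetime \<Rightarrow> real^2" where
  "fan_velocity \<mu> \<nu> \<alpha> vm \<beta> vp v z = sectorwise \<mu> \<nu> (vector [\<alpha>, vm]) (vector [\<alpha> + Re (v z), \<beta> + Im (v z)]) (vector [\<alpha>, vp]) z"

text \<open>The averaged momentum matrix is the tensor square of \<open>(\<alpha>, \<beta>)\<close>
  plus the diagonal matrix with entries \<open>\<epsilon>2\<close>, \<open>\<epsilon>1\<close>;
  \<open>C\<close> is its trace and \<open>u0\<close> its traceless part. In the wedge the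
  constraint turns \<open>v \<otimes> v\<close> into \<open>C / 2\<close> times the identity plus
  \<open>u0 + u\<close>, so the momentum fluctuations are divergence-free. Energy density is
  constant there, and the energy flux is a constant times the velocity, so its fluctuation is
  divergence-free too.\<close>

lemma fan_admissible:
  fixes p \<epsilon> :: "real \<Rightarrow> real"
  assumes pos: "rm > 0" "rp > 0" "r > 0" and \<mu>\<nu>: "\<mu> < \<nu>"
    and C: "C = \<alpha>\<^sup>2 + \<beta>\<^sup>2 + \<epsilon>1 + \<epsilon>2"
    and u0: "u0 = Complex (C / 2 - \<beta>\<^sup>2 - \<epsilon>1) (\<alpha> * \<beta>)"
    and w: "wild C (Complex \<alpha> \<beta>) u0 (wedge \<mu> \<nu>) v u"
    and m1: "\<mu> * (rm - r) = rm * vm - r * \<beta>"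
    and f1: "\<mu> * (rm * vm - r * \<beta>) = rm * vm\<^sup>2 + p rm - (r * \<beta>\<^sup>2 + r * \<epsilon>1 + p r)"
    and m2: "\<nu> * (r - rp) = r * \<beta> - rp * vp"
    and f2: "\<nu> * (r * \<beta> - rp * vp) = r * \<beta>\<^sup>2 + r * \<epsilon>1 + p r - (rp * vp\<^sup>2 + p rp)"
    and e1: "\<mu> * (rm * \<epsilon> rm + rm * vm\<^sup>2 / 2 - (r * \<epsilon> r + r * (\<beta>\<^sup>2 + \<epsilon>1 + \<epsilon>2) / 2))
       \<le> (rm * \<epsilon> rm + rm * vm\<^sup>2 / 2 + p rm) * vm - (r * \<epsilon> r + r * (\<beta>\<^sup>2 + \<epsilon>1 + \<epsilon>2) / 2 + p r) * \<beta>"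
    and e2: "\<nu> * (r * \<epsilon> r + r * (\<beta>\<^sup>2 + \<epsilon>1 + \<epsilon>2) / 2 - (rp * \<epsilon> rp + rp * vp\<^sup>2 / 2))
       \<le> (r * \<epsilon> r + r * (\<beta>\<^sup>2 + \<epsilon>1 + \<epsilon>2) / 2 + p r) * \<beta> - (rp * \<epsilon> rp + rp * vp\<^sup>2 / 2 + p rp) * vp"
  shows "admissible_weak_solution p \<epsilon> (riemann_data rm rp) (riemann_data (vector [\<alpha>, vm]) (vector [\<alpha>, vp]))
    (fan_density \<mu> \<nu> rm r rp) (fan_velocity \<mu> \<nu> \<alpha> vm \<beta> vp v)"
proof -
  let ?\<Omega> = "wedge \<mu> \<nu>"
  let ?\<rho> = "fan_density \<mu> \<nu> rm r rp" and ?v = "fan_velocity \<mu> \<nu> \<alpha> vm \<beta> vp v"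
  obtain B where mv: "v \<in> borel_measurable borel" and mu: "u \<in> borel_measurable borel"
    and z0: "\<And>z. z \<notin> ?\<Omega> \<Longrightarrow> v z = 0 \<and> u z = 0" and B: "\<And>z. norm (v z) \<le> B \<and> norm (u z) \<le> B"
    and cd: "local_divfree (\<lambda>_. 0) v" "local_divfree (\<lambda>z. Re (v z)) u" "local_divfree (\<lambda>z. Im (v z)) (\<lambda>z. - \<i> * u z)"
    and rel: "AE z in lborel. z \<in> ?\<Omega> \<longrightarrow> (norm (Complex \<alpha> \<beta> + v z))\<^sup>2 = C \<and> 2 * (u0 + u z) = (Complex \<alpha> \<beta> + v z)\<^sup>2"
    using w unfolding wild_def by blast
  have mRe: "(\<lambda>z. Re (v z)) \<in> borel_measurable borel" and mIm: "(\<lambda>z. Im (v z)) \<in> borel_measurable borel"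
    using mv by simp_all
  have m\<rho>: "?\<rho> \<in> borel_measurable borel"
    unfolding fan_density_def[abs_def] by (intro borel_measurable_sectorwise) auto
  have v1: "?v z $ 1 = sectorwise \<mu> \<nu> \<alpha> (\<alpha> + Re (v z)) \<alpha> z" and v2: "?v z $ 2 = sectorwise \<mu> \<nu> vm (\<beta> + Im (v z)) vp z" for z
    by (simp_all add: fan_velocity_def sectorwise_def)
  have mv1: "(\<lambda>z. ?v z $ 1) \<in> borel_measurable borel" and mv2: "(\<lambda>z. ?v z $ 2) \<in> borel_measurable borel"
    unfolding v1 v2 by (rule borel_measurable_sectorwise; use mRe mIm in simp)+
  have mvv: "?v \<in> borel_measurable borel"
  proof (rule borel_measurable_euclidean_space[THEN iffD2], rule ballI)
    fix i :: "real^2" assume "i \<in> Basis"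
    then obtain k where "i = axis k 1" by (auto simp: Basis_vec_def)
    moreover have "(\<lambda>z. ?v z $ k) \<in> borel_measurable borel" using mv1 mv2 exhaust_2[of k] by auto
    ultimately show "(\<lambda>z. ?v z \<bullet> i) \<in> borel_measurable borel" by (simp add: inner_axis)
  qed
  have neg: "z \<notin> ?\<Omega>" if "snd z < 0" for z using that by (simp add: wedge_def)
  have out: "v z = 0 \<and> u z = 0" if "fst z $ 2 < \<mu> * snd z \<or> fst z $ 2 \<ge> \<nu> * snd z" for z
    using that by (intro z0) (auto simp: wedge_def)
  have mid: "AE z in lborel. snd z \<ge> 0 \<and> \<not> fst z $ 2 < \<mu> * snd z \<and> \<not> fst z $ 2 \<ge> \<nu> * snd z \<longrightarrow>
     (\<alpha> + Re (v z))\<^sup>2 = C / 2 + Re u0 + Re (u z) \<and> (\<beta> + Im (v z))\<^sup>2 = C / 2 - Re u0 - Re (u z) \<and> (\<alpha> + Re (v z)) * (\<beta> + Im (v z)) = Im u0 + Im (u z)"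
    using rel AE_off_line[of \<mu>]
  proof eventually_elim
    case (elim z)
    show ?case
    proof
      assume a: "snd z \<ge> 0 \<and> \<not> fst z $ 2 < \<mu> * snd z \<and> \<not> fst z $ 2 \<ge> \<nu> * snd z"
      then have "snd z \<noteq> 0" by auto
      then have "z \<in> ?\<Omega>" using a elim(2) by (auto simp: wedge_def)
      with elim(1) have r: "(norm (Complex \<alpha> \<beta> + v z))\<^sup>2 = C" "2 * (u0 + u z) = (Complex \<alpha> \<beta> + v z)\<^sup>2" by auto
      have 1: "(\<alpha> + Re (v z))\<^sup>2 + (\<beta> + Im (v z))\<^sup>2 = C" using r(1) by (simp add: cmod_power2)
      have 2: "2 * (Re u0 + Re (u z)) = (\<alpha> + Re (v z))\<^sup>2 - (\<beta> + Im (v z))\<^sup>2"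
        using arg_cong[OF r(2), of Re] by (simp add: power2_eq_square)
      have 3: "2 * (Im u0 + Im (u z)) = 2 * ((\<alpha> + Re (v z)) * (\<beta> + Im (v z)))"
        using arg_cong[OF r(2), of Im] by (simp add: power2_eq_square mult.commute)
      show "(\<alpha> + Re (v z))\<^sup>2 = C / 2 + Re u0 + Re (u z) \<and> (\<beta> + Im (v z))\<^sup>2 = C / 2 - Re u0 - Re (u z) \<and> (\<alpha> + Re (v z)) * (\<beta> + Im (v z)) = Im u0 + Im (u z)"
      proof -
        have "X = C / 2 + k + l \<and> Y = C / 2 - k - l \<and> Z = m + n" if "X + Y = C" "2 * (k + l) = X - Y" "2 * (m + n) = 2 * Z" for X Y Z k l m n :: real
          using that by (simp add: field_simps)
        from this[OF 1 2 3] show ?thesis .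
      qed
    qed
  qed
  have bs: "bounded_state ?\<rho> ?v"
    unfolding bounded_state_def
  proof (intro conjI exI)
    show "?\<rho> \<in> borel_measurable half_space" "?v \<in> borel_measurable half_space"
      by (rule half_space_measurable[OF m\<rho>], rule half_space_measurable[OF mvv])
    let ?K = "\<bar>rm\<bar> + \<bar>r\<bar> + \<bar>rp\<bar> + ((\<bar>\<alpha>\<bar> + B) + (\<bar>vm\<bar> + \<bar>\<beta>\<bar> + B + \<bar>vp\<bar>))"
    have "\<bar>?\<rho> z\<bar> \<le> ?K \<and> norm (?v z) \<le> ?K" for z
    proof -
      have b: "\<bar>Re (v z)\<bar> \<le> B" "\<bar>Im (v z)\<bar> \<le> B" "0 \<le> B"
        using B[of z] abs_Re_le_cmod[of "v z"] abs_Im_le_cmod[of "v z"] norm_ge_zero[of "v z"] by linarith+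
      have "norm (?v z) \<le> \<bar>?v z $ 1\<bar> + \<bar>?v z $ 2\<bar>" using norm_le_l1_cart[of "?v z"] by (simp add: sum_2)
      moreover have "\<bar>?v z $ 1\<bar> \<le> \<bar>\<alpha>\<bar> + B" unfolding v1 sectorwise_def using b by auto
      moreover have "\<bar>?v z $ 2\<bar> \<le> \<bar>vm\<bar> + \<bar>\<beta>\<bar> + B + \<bar>vp\<bar>" unfolding v2 sectorwise_def using b by auto
      moreover have "\<bar>?\<rho> z\<bar> \<le> \<bar>rm\<bar> + \<bar>r\<bar> + \<bar>rp\<bar>" unfolding fan_density_def sectorwise_def by auto
      moreover have "d \<le> D + (E + F) \<and> n \<le> D + (E + F)" if "n \<le> x + y" "x \<le> E" "y \<le> F" "d \<le> D" "0 \<le> D" "0 \<le> E" "0 \<le> F" for d n x y D E F :: real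
        using that by linarith
      moreover have "0 \<le> \<bar>rm\<bar> + \<bar>r\<bar> + \<bar>rp\<bar>" "0 \<le> \<bar>\<alpha>\<bar> + B" "0 \<le> \<bar>vm\<bar> + \<bar>\<beta>\<bar> + B + \<bar>vp\<bar>" using b(3) by simp_all
      ultimately show ?thesis by blast
    qed
    then show "AE z in half_space. \<bar>?\<rho> z\<bar> \<le> ?K \<and> norm (?v z) \<le> ?K" by simp
    show "AE z in half_space. ?\<rho> z > 0" using pos by (intro AE_I2) (auto simp: fan_density_def sectorwise_def)
  qed
  have B0: "0 \<le> B" using B norm_ge_zero order_trans by blast
  have mreg: "(\<lambda>z. sectorwise \<mu> \<nu> k l m z) \<in> borel_measurable borel" for k l m :: "'x::{second_countable_topology, t2_space}"
    by (intro borel_measurable_sectorwise) auto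
  have wild_part: "\<bar>0\<bar> \<le> \<bar>k\<bar> * B \<and> norm (k *\<^sub>R v z) \<le> \<bar>k\<bar> * B" "snd z < 0 \<Longrightarrow> (0::real) = 0 \<and> k *\<^sub>R v z = 0"
    "(\<lambda>z. k *\<^sub>R v z) \<in> borel_measurable borel" "local_divfree (\<lambda>_. 0) (\<lambda>z. k *\<^sub>R v z)" for k z
    using B[of z] B0 z0[OF neg] mv local_divfree_scale[OF cd(1), of k] by (auto intro!: mult_left_mono)
  have mass: "(\<integral>z. ?\<rho> z * time_deriv \<psi> z + ?\<rho> z * (?v z \<bullet> space_grad \<psi> z) \<partial>half_space)
        + (\<integral>x. riemann_data rm rp x * \<psi> (x, 0) \<partial>lebesgue) = 0"
    and en: "(\<forall>x. \<forall>t\<ge>0. \<psi> (x, t) \<ge> 0) \<Longrightarrow> (\<integral>z. energy \<epsilon> (?\<rho> z) (?v z) * time_deriv \<psi> z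
            + (energy \<epsilon> (?\<rho> z) (?v z) + p (?\<rho> z)) * (?v z \<bullet> space_grad \<psi> z) \<partial>half_space)
        + (\<integral>x. energy \<epsilon> (riemann_data rm rp x) (riemann_data (vector [\<alpha>, vm]) (vector [\<alpha>, vp]) x) * \<psi> (x, 0) \<partial>lebesgue) \<ge> 0"
    if t: "test_function \<psi>" for \<psi> :: "spacetime \<Rightarrow> real"
  proof -
    obtain G S where C1: "C1_grad \<psi> G" and S: "bounded S" "\<And>z. z \<notin> S \<Longrightarrow> \<psi> z = 0 \<and> G z = 0"
      and G: "\<And>z h. G z \<bullet> h = frechet_derivative \<psi> (at z) h"
      using test_function_C1[OF t bounded_linear_ident] by blast
    have td: "time_deriv \<psi> z = snd (G z)" for z using time_deriv_eq[OF t, of z] G[of z axis_t] by simp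
    have sg: "space_grad \<psi> z = fst (G z)" for z
    proof (cases z)
      case (Pair x s)
      then show ?thesis
        using G[of z] by (simp add: vec_eq_iff space_grad_def space_frechet_eq[OF t] inner_axis_Pair[symmetric])
    qed
    note mG = C1_grad_measurable[OF C1]
    obtain bm bp where sgn: "(\<And>z. snd z \<ge> 0 \<Longrightarrow> \<psi> z \<ge> 0) \<Longrightarrow> bm \<ge> 0 \<and> bp \<le> 0"
      and ci: "\<And>k l. integrable lborel (\<lambda>x. (if x $ 2 < 0 then k else l) * \<psi> (x, 0))"
      and I: "\<And>fm f1 fp gm g1 gp q w B. \<lbrakk>local_divfree q w; q \<in> borel_measurable borel; w \<in> borel_measurable borel;
       \<And>z. \<bar>q z\<bar> \<le> B \<and> norm (w z) \<le> B; \<And>z. snd z < 0 \<Longrightarrow> q z = 0 \<and> w z = 0\<rbrakk> \<Longrightarrow>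
      integrable lborel (\<lambda>z. indicator {z. snd z \<ge> 0} z * ((sectorwise \<mu> \<nu> fm f1 fp z + q z) * snd (G z) + (sectorwise \<mu> \<nu> gm g1 gp z + w z) \<bullet> space_part (G z))) \<and>
      (\<integral>z. indicator {z. snd z \<ge> 0} z * ((sectorwise \<mu> \<nu> fm f1 fp z + q z) * snd (G z) + (sectorwise \<mu> \<nu> gm g1 gp z + w z) \<bullet> space_part (G z)) \<partial>lborel)
       + (\<integral>x. (if x $ 2 < 0 then fm else fp) * \<psi> (x, 0) \<partial>lborel)
      = bm * (\<mu> * (f1 - fm) + Im gm - Im g1) + bp * (\<nu> * (f1 - fp) + Im gp - Im g1)"
      using fan_identity[OF C1 S \<mu>\<nu>] by blast
    have vG: "?v z \<bullet> fst (G z) = ?v z $ 1 * fst (G z) $ 1 + ?v z $ 2 * fst (G z) $ 2" for z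
      by (simp add: inner_vec_def sum_2)
    show "(\<integral>z. ?\<rho> z * time_deriv \<psi> z + ?\<rho> z * (?v z \<bullet> space_grad \<psi> z) \<partial>half_space)
        + (\<integral>x. riemann_data rm rp x * \<psi> (x, 0) \<partial>lebesgue) = 0"
    proof -
      let ?g = "sectorwise \<mu> \<nu> (Complex (rm * \<alpha>) (rm * vm)) (Complex (r * \<alpha>) (r * \<beta>)) (Complex (rp * \<alpha>) (rp * vp))"
      have "(\<integral>z. ?\<rho> z * time_deriv \<psi> z + ?\<rho> z * (?v z \<bullet> space_grad \<psi> z) \<partial>half_space)
        = (\<integral>z. indicator {z. snd z \<ge> 0} z * ((sectorwise \<mu> \<nu> rm r rp z + 0) * snd (G z) + (?g z + r *\<^sub>R v z) \<bullet> space_part (G z)) \<partial>lborel)"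
        unfolding td sg vG
      proof (rule half_space_integral)
        show "(\<lambda>z. ?\<rho> z * snd (G z) + ?\<rho> z * (?v z $ 1 * fst (G z) $ 1 + ?v z $ 2 * fst (G z) $ 2)) \<in> borel_measurable borel"
          by (intro borel_measurable_add borel_measurable_times m\<rho> mv1 mv2 mG)
        show "(\<lambda>z. (sectorwise \<mu> \<nu> rm r rp z + 0) * snd (G z) + (?g z + r *\<^sub>R v z) \<bullet> space_part (G z)) \<in> borel_measurable borel"
          by (intro borel_measurable_add borel_measurable_times borel_measurable_inner mreg wild_part(3) borel_measurable_const mG)
        show "AE z in lborel. snd z \<ge> 0 \<longrightarrow> ?\<rho> z * snd (G z) + ?\<rho> z * (?v z $ 1 * fst (G z) $ 1 + ?v z $ 2 * fst (G z) $ 2)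
          = (sectorwise \<mu> \<nu> rm r rp z + 0) * snd (G z) + (?g z + r *\<^sub>R v z) \<bullet> space_part (G z)"
          using out by (intro AE_I2) (auto simp: v1 v2 fan_density_def sectorwise_def space_part_def inner_complex_def algebra_simps)
      qed
      moreover have "(\<integral>x. riemann_data rm rp x * \<psi> (x, 0) \<partial>lebesgue) = (\<integral>x. (if x $ 2 < 0 then rm else rp) * \<psi> (x, 0) \<partial>lborel)"
        by (rule lebesgue_integral_lborel[OF ci]) (simp add: riemann_data_def)
      moreover note I[where fm1=rm and ?f1.1=r and fp1=rp and gm1="Complex (rm * \<alpha>) (rm * vm)" and ?g1.1="Complex (r * \<alpha>) (r * \<beta>)" and gp1="Complex (rp * \<alpha>) (rp * vp)",
          OF wild_part(4)[of r] borel_measurable_const wild_part(3)[of r] wild_part(1)[of r] wild_part(2)[of _ r]]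
      moreover have "\<mu> * (r - rm) + rm * vm - r * \<beta> = 0" "\<nu> * (r - rp) + rp * vp - r * \<beta> = 0" using m1 m2 by (simp_all add: algebra_simps)
      ultimately show ?thesis by simp
    qed
    show "(\<integral>z. energy \<epsilon> (?\<rho> z) (?v z) * time_deriv \<psi> z
            + (energy \<epsilon> (?\<rho> z) (?v z) + p (?\<rho> z)) * (?v z \<bullet> space_grad \<psi> z) \<partial>half_space)
        + (\<integral>x. energy \<epsilon> (riemann_data rm rp x) (riemann_data (vector [\<alpha>, vm]) (vector [\<alpha>, vp]) x) * \<psi> (x, 0) \<partial>lebesgue) \<ge> 0"
      if nn: "\<forall>x. \<forall>t\<ge>0. \<psi> (x, t) \<ge> 0"
    proof -
      define Em where "Em = rm * \<epsilon> rm + rm * (\<alpha>\<^sup>2 + vm\<^sup>2) / 2"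
      define Ep where "Ep = rp * \<epsilon> rp + rp * (\<alpha>\<^sup>2 + vp\<^sup>2) / 2"
      \<comment> \<open>The energy density in the wedge, constant because the speed is; only the
        velocity factor of the energy flux fluctuates.\<close>
      define E1 where "E1 = r * \<epsilon> r + r * C / 2"
      let ?k = "E1 + p r"
      let ?e = "\<lambda>z. ?\<rho> z * \<epsilon> (?\<rho> z) + ?\<rho> z * (?v z $ 1 * ?v z $ 1 + ?v z $ 2 * ?v z $ 2) / 2"
      let ?g = "sectorwise \<mu> \<nu> (Complex ((Em + p rm) * \<alpha>) ((Em + p rm) * vm)) (Complex (?k * \<alpha>) (?k * \<beta>)) (Complex ((Ep + p rp) * \<alpha>) ((Ep + p rp) * vp))"
      have nv: "(norm x)\<^sup>2 = x $ 1 * x $ 1 + x $ 2 * x $ 2" for x :: "real^2"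
        by (simp add: power2_norm_eq_inner inner_vec_def sum_2)
      have nvec: "(norm (vector [x, y] :: real^2))\<^sup>2 = x\<^sup>2 + y\<^sup>2" for x y :: real
        unfolding nv by (simp add: power2_eq_square)
      have ee: "energy \<epsilon> (?\<rho> z) (?v z) = ?e z" for z by (simp add: energy_def nv)
      have m\<epsilon>: "(\<lambda>z. \<epsilon> (?\<rho> z)) \<in> borel_measurable borel" "(\<lambda>z. p (?\<rho> z)) \<in> borel_measurable borel"
      proof -
        have "\<epsilon> (?\<rho> z) = sectorwise \<mu> \<nu> (\<epsilon> rm) (\<epsilon> r) (\<epsilon> rp) z" "p (?\<rho> z) = sectorwise \<mu> \<nu> (p rm) (p r) (p rp) z" for z
          by (simp_all add: fan_density_def sectorwise_def)
        then show "(\<lambda>z. \<epsilon> (?\<rho> z)) \<in> borel_measurable borel" "(\<lambda>z. p (?\<rho> z)) \<in> borel_measurable borel"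
          using mreg by simp_all
      qed
      have "(\<integral>z. energy \<epsilon> (?\<rho> z) (?v z) * time_deriv \<psi> z + (energy \<epsilon> (?\<rho> z) (?v z) + p (?\<rho> z)) * (?v z \<bullet> space_grad \<psi> z) \<partial>half_space)
        = (\<integral>z. indicator {z. snd z \<ge> 0} z * ((sectorwise \<mu> \<nu> Em E1 Ep z + 0) * snd (G z) + (?g z + ?k *\<^sub>R v z) \<bullet> space_part (G z)) \<partial>lborel)"
        unfolding td sg vG ee
      proof (rule half_space_integral)
        show "(\<lambda>z. ?e z * snd (G z) + (?e z + p (?\<rho> z)) * (?v z $ 1 * fst (G z) $ 1 + ?v z $ 2 * fst (G z) $ 2)) \<in> borel_measurable borel"
          by (intro borel_measurable_add borel_measurable_times borel_measurable_divide borel_measurable_const m\<rho> m\<epsilon> mv1 mv2 mG)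
        show "(\<lambda>z. (sectorwise \<mu> \<nu> Em E1 Ep z + 0) * snd (G z) + (?g z + ?k *\<^sub>R v z) \<bullet> space_part (G z)) \<in> borel_measurable borel"
          by (intro borel_measurable_add borel_measurable_times borel_measurable_inner mreg wild_part(3) borel_measurable_const mG)
        show "AE z in lborel. snd z \<ge> 0 \<longrightarrow> ?e z * snd (G z) + (?e z + p (?\<rho> z)) * (?v z $ 1 * fst (G z) $ 1 + ?v z $ 2 * fst (G z) $ 2)
          = (sectorwise \<mu> \<nu> Em E1 Ep z + 0) * snd (G z) + (?g z + ?k *\<^sub>R v z) \<bullet> space_part (G z)"
          using mid
        proof eventually_elim
          case (elim z)
          show ?case
          proof
            assume z: "snd z \<ge> 0"
            consider "fst z $ 2 < \<mu> * snd z" | "\<not> fst z $ 2 < \<mu> * snd z" "fst z $ 2 \<ge> \<nu> * snd z"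
              | "\<not> fst z $ 2 < \<mu> * snd z" "\<not> fst z $ 2 \<ge> \<nu> * snd z" by blast
            then show "?e z * snd (G z) + (?e z + p (?\<rho> z)) * (?v z $ 1 * fst (G z) $ 1 + ?v z $ 2 * fst (G z) $ 2)
              = (sectorwise \<mu> \<nu> Em E1 Ep z + 0) * snd (G z) + (?g z + ?k *\<^sub>R v z) \<bullet> space_part (G z)"
            proof cases
              case 1
              then have "?e z = Em" by (simp add: v1 v2 fan_density_def sectorwise_def Em_def power2_eq_square)
              then show ?thesis using 1 out[of z] unfolding \<open>?e z = Em\<close>
                by (simp add: v1 v2 fan_density_def sectorwise_def space_part_def inner_complex_def algebra_simps)
            next
              case 2
              then have "?e z = Ep" by (simp add: v1 v2 fan_density_def sectorwise_def Ep_def power2_eq_square)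
              then show ?thesis using 2 out[of z] unfolding \<open>?e z = Ep\<close>
                by (simp add: v1 v2 fan_density_def sectorwise_def space_part_def inner_complex_def algebra_simps)
            next
              case 3
              have "(\<alpha> + Re (v z))\<^sup>2 + (\<beta> + Im (v z))\<^sup>2 = C" using elim z 3 by simp
              then have "?e z = E1" using 3 by (simp add: v1 v2 fan_density_def sectorwise_def E1_def power2_eq_square)
              then show ?thesis using 3 unfolding \<open>?e z = E1\<close>
                by (simp add: v1 v2 fan_density_def sectorwise_def space_part_def inner_complex_def algebra_simps)
            qed
          qed
        qed
      qed
      moreover have "(\<integral>x. energy \<epsilon> (riemann_data rm rp x) (riemann_data (vector [\<alpha>, vm]) (vector [\<alpha>, vp]) x) * \<psi> (x, 0) \<partial>lebesgue)
        = (\<integral>x. (if x $ 2 < 0 then Em else Ep) * \<psi> (x, 0) \<partial>lborel)"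
        by (rule lebesgue_integral_lborel[OF ci]) (simp add: riemann_data_def energy_def nvec Em_def Ep_def)
      moreover note I[where fm1=Em and ?f1.1=E1 and fp1=Ep and
          gm1="Complex ((Em + p rm) * \<alpha>) ((Em + p rm) * vm)" and ?g1.1="Complex (?k * \<alpha>) (?k * \<beta>)" and gp1="Complex ((Ep + p rp) * \<alpha>) ((Ep + p rp) * vp)",
          OF wild_part(4)[of ?k] borel_measurable_const wild_part(3)[of ?k] wild_part(1)[of ?k] wild_part(2)[of _ ?k]]
      \<comment> \<open>Nonnegativity of the test function fixes the signs of \<open>bm\<close> and
        \<open>bp\<close>, which are opposite; \<open>e1\<close> and \<open>e2\<close> give the
        defects on the two lines the matching signs.\<close>
      moreover have "bm * (\<mu> * (E1 - Em) + (Em + p rm) * vm - ?k * \<beta>) \<ge> 0"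
      proof (rule mult_nonneg_nonneg)
        show "bm \<ge> 0" using sgn nn by force
        have "\<mu> * (E1 - Em) + (Em + p rm) * vm - ?k * \<beta> =
          (rm * \<epsilon> rm + rm * vm\<^sup>2 / 2 + p rm) * vm - (r * \<epsilon> r + r * (\<beta>\<^sup>2 + \<epsilon>1 + \<epsilon>2) / 2 + p r) * \<beta>
          - \<mu> * (rm * \<epsilon> rm + rm * vm\<^sup>2 / 2 - (r * \<epsilon> r + r * (\<beta>\<^sup>2 + \<epsilon>1 + \<epsilon>2) / 2)) + \<alpha>\<^sup>2 / 2 * (rm * vm - r * \<beta> - \<mu> * (rm - r))"
          by (simp add: E1_def Em_def C field_simps)
        then show "\<mu> * (E1 - Em) + (Em + p rm) * vm - ?k * \<beta> \<ge> 0" using e1 m1 by simp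
      qed
      moreover have "bp * (\<nu> * (E1 - Ep) + (Ep + p rp) * vp - ?k * \<beta>) \<ge> 0"
      proof (rule mult_nonpos_nonpos)
        show "bp \<le> 0" using sgn nn by force
        have "\<nu> * (E1 - Ep) + (Ep + p rp) * vp - ?k * \<beta> =
          \<nu> * (r * \<epsilon> r + r * (\<beta>\<^sup>2 + \<epsilon>1 + \<epsilon>2) / 2 - (rp * \<epsilon> rp + rp * vp\<^sup>2 / 2))
          - ((r * \<epsilon> r + r * (\<beta>\<^sup>2 + \<epsilon>1 + \<epsilon>2) / 2 + p r) * \<beta> - (rp * \<epsilon> rp + rp * vp\<^sup>2 / 2 + p rp) * vp) + \<alpha>\<^sup>2 / 2 * (\<nu> * (r - rp) - (r * \<beta> - rp * vp))"
          by (simp add: E1_def Ep_def C field_simps)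
        then show "\<nu> * (E1 - Ep) + (Ep + p rp) * vp - ?k * \<beta> \<le> 0" using e2 m2 by simp
      qed
      ultimately show ?thesis by simp
    qed
  qed
  have momentum: "(\<integral>z. ?\<rho> z * (?v z \<bullet> time_deriv \<phi> z) + ?\<rho> z * (tensor (?v z) (?v z) \<bullet> space_jacobian \<phi> z) + p (?\<rho> z) * space_div \<phi> z \<partial>half_space)
        + (\<integral>x. riemann_data rm rp x * (riemann_data (vector [\<alpha>, vm]) (vector [\<alpha>, vp]) x \<bullet> \<phi> (x, 0)) \<partial>lebesgue) = 0"
    if t: "test_function \<phi>" for \<phi> :: "spacetime \<Rightarrow> real^2"
  proof -
    have bl: "bounded_linear (\<lambda>x::real^2. x $ i)" for i by (rule bounded_linear_vec_nth)
    obtain G S where C1: "C1_grad (\<lambda>z. \<phi> z $ 1) G" and S: "bounded S" "\<And>z. z \<notin> S \<Longrightarrow> \<phi> z $ 1 = 0 \<and> G z = 0"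
      and G: "\<And>z h. G z \<bullet> h = frechet_derivative \<phi> (at z) h $ 1"
      using test_function_C1[OF t bl[of 1]] by blast
    obtain K T where C2: "C1_grad (\<lambda>z. \<phi> z $ 2) K" and T: "bounded T" "\<And>z. z \<notin> T \<Longrightarrow> \<phi> z $ 2 = 0 \<and> K z = 0"
      and K: "\<And>z h. K z \<bullet> h = frechet_derivative \<phi> (at z) h $ 2"
      using test_function_C1[OF t bl[of 2]] by blast
    have td: "time_deriv \<phi> z $ 1 = snd (G z)" "time_deriv \<phi> z $ 2 = snd (K z)" for z
      using time_deriv_eq[OF t, of z] G[of z axis_t] K[of z axis_t] by simp_all
    have sj: "space_jacobian \<phi> z $ 1 $ j = fst (G z) $ j" "space_jacobian \<phi> z $ 2 $ j = fst (K z) $ j" for z j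
    proof -
      have "space_jacobian \<phi> z $ i $ j = frechet_derivative \<phi> (at z) (axis j 1, 0) $ i" for i
        by (cases z) (simp add: space_jacobian_def jacobian_def matrix_def space_frechet_eq[OF t])
      then show "space_jacobian \<phi> z $ 1 $ j = fst (G z) $ j" "space_jacobian \<phi> z $ 2 $ j = fst (K z) $ j"
        using G[of z "(axis j 1, 0)"] K[of z "(axis j 1, 0)"] by (simp_all add: inner_axis_Pair)
    qed
    let ?F = "\<lambda>z. ?\<rho> z * (?v z $ 1 * snd (G z) + ?v z $ 2 * snd (K z))
      + ?\<rho> z * (?v z $ 1 * ?v z $ 1 * fst (G z) $ 1 + ?v z $ 1 * ?v z $ 2 * fst (G z) $ 2 + ?v z $ 2 * ?v z $ 1 * fst (K z) $ 1 + ?v z $ 2 * ?v z $ 2 * fst (K z) $ 2)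
      + p (?\<rho> z) * (fst (G z) $ 1 + fst (K z) $ 2)"
    have F: "?\<rho> z * (?v z \<bullet> time_deriv \<phi> z) + ?\<rho> z * (tensor (?v z) (?v z) \<bullet> space_jacobian \<phi> z) + p (?\<rho> z) * space_div \<phi> z = ?F z" for z
      by (simp add: inner_vec_def sum_2 td sj tensor_def space_div_def trace_def)
    note mG = C1_grad_measurable[OF C1] and mK = C1_grad_measurable[OF C2]
    obtain bm bp where "(\<And>z. snd z \<ge> 0 \<Longrightarrow> \<phi> z $ 1 \<ge> 0) \<Longrightarrow> bm \<ge> 0 \<and> bp \<le> 0"
      and ci: "\<And>k l. integrable lborel (\<lambda>x. (if x $ 2 < 0 then k else l) * \<phi> (x, 0) $ 1)"
      and I: "\<And>fm f1 fp gm g1 gp q w B. \<lbrakk>local_divfree q w; q \<in> borel_measurable borel; w \<in> borel_measurable borel;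
       \<And>z. \<bar>q z\<bar> \<le> B \<and> norm (w z) \<le> B; \<And>z. snd z < 0 \<Longrightarrow> q z = 0 \<and> w z = 0\<rbrakk> \<Longrightarrow>
      integrable lborel (\<lambda>z. indicator {z. snd z \<ge> 0} z * ((sectorwise \<mu> \<nu> fm f1 fp z + q z) * snd (G z) + (sectorwise \<mu> \<nu> gm g1 gp z + w z) \<bullet> space_part (G z))) \<and>
      (\<integral>z. indicator {z. snd z \<ge> 0} z * ((sectorwise \<mu> \<nu> fm f1 fp z + q z) * snd (G z) + (sectorwise \<mu> \<nu> gm g1 gp z + w z) \<bullet> space_part (G z)) \<partial>lborel)
       + (\<integral>x. (if x $ 2 < 0 then fm else fp) * \<phi> (x, 0) $ 1 \<partial>lborel)
      = bm * (\<mu> * (f1 - fm) + Im gm - Im g1) + bp * (\<nu> * (f1 - fp) + Im gp - Im g1)"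
      using fan_identity[OF C1 S \<mu>\<nu>] by blast
    obtain bm' bp' where "(\<And>z. snd z \<ge> 0 \<Longrightarrow> \<phi> z $ 2 \<ge> 0) \<Longrightarrow> bm' \<ge> 0 \<and> bp' \<le> 0"
      and ci': "\<And>k l. integrable lborel (\<lambda>x. (if x $ 2 < 0 then k else l) * \<phi> (x, 0) $ 2)"
      and I': "\<And>fm f1 fp gm g1 gp q w B. \<lbrakk>local_divfree q w; q \<in> borel_measurable borel; w \<in> borel_measurable borel;
       \<And>z. \<bar>q z\<bar> \<le> B \<and> norm (w z) \<le> B; \<And>z. snd z < 0 \<Longrightarrow> q z = 0 \<and> w z = 0\<rbrakk> \<Longrightarrow>
      integrable lborel (\<lambda>z. indicator {z. snd z \<ge> 0} z * ((sectorwise \<mu> \<nu> fm f1 fp z + q z) * snd (K z) + (sectorwise \<mu> \<nu> gm g1 gp z + w z) \<bullet> space_part (K z))) \<and>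
      (\<integral>z. indicator {z. snd z \<ge> 0} z * ((sectorwise \<mu> \<nu> fm f1 fp z + q z) * snd (K z) + (sectorwise \<mu> \<nu> gm g1 gp z + w z) \<bullet> space_part (K z)) \<partial>lborel)
       + (\<integral>x. (if x $ 2 < 0 then fm else fp) * \<phi> (x, 0) $ 2 \<partial>lborel)
      = bm' * (\<mu> * (f1 - fm) + Im gm - Im g1) + bp' * (\<nu> * (f1 - fp) + Im gp - Im g1)"
      using fan_identity[OF C2 T \<mu>\<nu>] by blast
    let ?f1 = "sectorwise \<mu> \<nu> (rm * \<alpha>) (r * \<alpha>) (rp * \<alpha>)" and ?f2 = "sectorwise \<mu> \<nu> (rm * vm) (r * \<beta>) (rp * vp)"
    \<comment> \<open>Rows of the momentum flux in the three sectors. In the wedge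
      \<open>C / 2 + Re u0 = \<alpha>^2 + \<epsilon>2\<close> and
      \<open>C / 2 - Re u0 = \<beta>^2 + \<epsilon>1\<close>, so that only
      \<open>\<epsilon>1\<close> reaches the jump conditions; the fluctuating rows are
      \<open>u\<close> and \<open>- \<i> * u\<close>.\<close>
    let ?am = "Complex (rm * \<alpha>\<^sup>2 + p rm) (rm * \<alpha> * vm)" and ?a = "Complex (r * (C / 2 + Re u0) + p r) (r * Im u0)" and ?ap = "Complex (rp * \<alpha>\<^sup>2 + p rp) (rp * \<alpha> * vp)"
    let ?bm = "Complex (rm * \<alpha> * vm) (rm * vm\<^sup>2 + p rm)" and ?b = "Complex (r * Im u0) (r * (C / 2 - Re u0) + p r)" and ?bp = "Complex (rp * \<alpha> * vp) (rp * vp\<^sup>2 + p rp)"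
    let ?h1 = "\<lambda>z. (?f1 z + r * Re (v z)) * snd (G z) + (sectorwise \<mu> \<nu> ?am ?a ?ap z + r *\<^sub>R u z) \<bullet> space_part (G z)"
    let ?h2 = "\<lambda>z. (?f2 z + r * Im (v z)) * snd (K z) + (sectorwise \<mu> \<nu> ?bm ?b ?bp z + r *\<^sub>R (- \<i> * u z)) \<bullet> space_part (K z)"
    have Bz: "\<bar>r * Re (v z)\<bar> \<le> r * B \<and> norm (r *\<^sub>R u z) \<le> r * B" "\<bar>r * Im (v z)\<bar> \<le> r * B \<and> norm (r *\<^sub>R (- \<i> * u z)) \<le> r * B" for z
      using B[of z] abs_Re_le_cmod[of "v z"] abs_Im_le_cmod[of "v z"] pos(3) by (auto simp: abs_mult norm_mult)
    have nz: "snd z < 0 \<Longrightarrow> r * Re (v z) = 0 \<and> r *\<^sub>R u z = 0" "snd z < 0 \<Longrightarrow> r * Im (v z) = 0 \<and> r *\<^sub>R (- \<i> * u z) = 0" for z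
      using z0[OF neg[of z]] by auto
    have mq: "(\<lambda>z. r * Re (v z)) \<in> borel_measurable borel" "(\<lambda>z. r * Im (v z)) \<in> borel_measurable borel"
      "(\<lambda>z. r *\<^sub>R u z) \<in> borel_measurable borel" "(\<lambda>z. r *\<^sub>R (- \<i> * u z)) \<in> borel_measurable borel"
      using mRe mIm mu by simp_all
    have J1: "integrable lborel (\<lambda>z. indicator {z. snd z \<ge> 0} z * ?h1 z) \<and>
        (\<integral>z. indicator {z. snd z \<ge> 0} z * ?h1 z \<partial>lborel) + (\<integral>x. (if x $ 2 < 0 then rm * \<alpha> else rp * \<alpha>) * \<phi> (x, 0) $ 1 \<partial>lborel)
      = bm * (\<mu> * (r * \<alpha> - rm * \<alpha>) + Im ?am - Im ?a) + bp * (\<nu> * (r * \<alpha> - rp * \<alpha>) + Im ?ap - Im ?a)"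
      by (rule I[OF local_divfree_scale[OF cd(2)] mq(1,3) Bz(1) nz(1)])
    have J2: "integrable lborel (\<lambda>z. indicator {z. snd z \<ge> 0} z * ?h2 z) \<and>
        (\<integral>z. indicator {z. snd z \<ge> 0} z * ?h2 z \<partial>lborel) + (\<integral>x. (if x $ 2 < 0 then rm * vm else rp * vp) * \<phi> (x, 0) $ 2 \<partial>lborel)
      = bm' * (\<mu> * (r * \<beta> - rm * vm) + Im ?bm - Im ?b) + bp' * (\<nu> * (r * \<beta> - rp * vp) + Im ?bp - Im ?b)"
      by (rule I'[OF local_divfree_scale[OF cd(3)] mq(2,4) Bz(2) nz(2)])
    have "(\<integral>z. ?F z \<partial>half_space) = (\<integral>z. indicator {z. snd z \<ge> 0} z * (?h1 z + ?h2 z) \<partial>lborel)"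
    proof (rule half_space_integral)
      have mp: "(\<lambda>z. p (?\<rho> z)) \<in> borel_measurable borel"
      proof -
        have "p (?\<rho> z) = sectorwise \<mu> \<nu> (p rm) (p r) (p rp) z" for z by (simp add: fan_density_def sectorwise_def)
        then show ?thesis using mreg by simp
      qed
      show "?F \<in> borel_measurable borel"
        by (intro borel_measurable_add borel_measurable_times m\<rho> mp mv1 mv2 mG mK)
      show "(\<lambda>z. ?h1 z + ?h2 z) \<in> borel_measurable borel"
        by (intro borel_measurable_add borel_measurable_times borel_measurable_inner mreg mq borel_measurable_const mG mK)
      show "AE z in lborel. snd z \<ge> 0 \<longrightarrow> ?F z = ?h1 z + ?h2 z"
        using mid
      proof eventually_elim
        case (elim z)
        show ?case
        proof
          assume z: "snd z \<ge> 0"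
          consider "fst z $ 2 < \<mu> * snd z" | "\<not> fst z $ 2 < \<mu> * snd z" "fst z $ 2 \<ge> \<nu> * snd z"
            | "\<not> fst z $ 2 < \<mu> * snd z" "\<not> fst z $ 2 \<ge> \<nu> * snd z" by blast
          then show "?F z = ?h1 z + ?h2 z"
          proof cases
            case 1
            then show ?thesis using out[of z]
              by (simp add: v1 v2 fan_density_def sectorwise_def space_part_def inner_complex_def power2_eq_square algebra_simps)
          next
            case 2
            then show ?thesis using out[of z]
              by (simp add: v1 v2 fan_density_def sectorwise_def space_part_def inner_complex_def power2_eq_square algebra_simps)
          next
            case 3
            define a b where "a = \<alpha> + Re (v z)" and "b = \<beta> + Im (v z)"
            have ab: "a * a = C / 2 + Re u0 + Re (u z)" "b * b = C / 2 - Re u0 - Re (u z)" "a * b = Im u0 + Im (u z)"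
              using elim z 3 by (auto simp: a_def b_def power2_eq_square)
            have "?F z = r * (a * snd (G z) + b * snd (K z)) + r * (a * a * fst (G z) $ 1 + a * b * fst (G z) $ 2 + b * a * fst (K z) $ 1 + b * b * fst (K z) $ 2)
              + p r * (fst (G z) $ 1 + fst (K z) $ 2)"
              using 3 by (simp add: v1 v2 fan_density_def sectorwise_def a_def b_def)
            also have "\<dots> = ?h1 z + ?h2 z"
              unfolding momentum_flux_identity[OF ab]
              using 3 by (simp add: sectorwise_def space_part_def inner_complex_def a_def b_def algebra_simps)
            finally show ?thesis .
          qed
        qed
      qed
    qed
    also have "\<dots> = (\<integral>z. indicator {z. snd z \<ge> 0} z * ?h1 z + indicator {z. snd z \<ge> 0} z * ?h2 z \<partial>lborel)"
      by (simp only: distrib_left)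
    also have "\<dots> = (\<integral>z. indicator {z. snd z \<ge> 0} z * ?h1 z \<partial>lborel) + (\<integral>z. indicator {z. snd z \<ge> 0} z * ?h2 z \<partial>lborel)"
      using J1 J2 by (intro Bochner_Integration.integral_add) blast+
    finally have int: "(\<integral>z. ?F z \<partial>half_space) = (\<integral>z. indicator {z. snd z \<ge> 0} z * ?h1 z \<partial>lborel) + (\<integral>z. indicator {z. snd z \<ge> 0} z * ?h2 z \<partial>lborel)" .
    have "(\<integral>x. riemann_data rm rp x * (riemann_data (vector [\<alpha>, vm]) (vector [\<alpha>, vp]) x \<bullet> \<phi> (x, 0)) \<partial>lebesgue)
      = (\<integral>x. (if x $ 2 < 0 then rm * \<alpha> else rp * \<alpha>) * \<phi> (x, 0) $ 1 + (if x $ 2 < 0 then rm * vm else rp * vp) * \<phi> (x, 0) $ 2 \<partial>lborel)"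
      by (rule lebesgue_integral_lborel[OF Bochner_Integration.integrable_add[OF ci ci']])
        (simp add: riemann_data_def inner_vec_def sum_2 algebra_simps)
    also have "\<dots> = (\<integral>x. (if x $ 2 < 0 then rm * \<alpha> else rp * \<alpha>) * \<phi> (x, 0) $ 1 \<partial>lborel) + (\<integral>x. (if x $ 2 < 0 then rm * vm else rp * vp) * \<phi> (x, 0) $ 2 \<partial>lborel)"
      by (rule Bochner_Integration.integral_add[OF ci ci'])
    finally have init: "(\<integral>x. riemann_data rm rp x * (riemann_data (vector [\<alpha>, vm]) (vector [\<alpha>, vp]) x \<bullet> \<phi> (x, 0)) \<partial>lebesgue)
      = (\<integral>x. (if x $ 2 < 0 then rm * \<alpha> else rp * \<alpha>) * \<phi> (x, 0) $ 1 \<partial>lborel) + (\<integral>x. (if x $ 2 < 0 then rm * vm else rp * vp) * \<phi> (x, 0) $ 2 \<partial>lborel)" .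
    have "\<mu> * (r * \<alpha> - rm * \<alpha>) + rm * \<alpha> * vm - r * (\<alpha> * \<beta>) = \<alpha> * (rm * vm - r * \<beta> - \<mu> * (rm - r))"
      "\<nu> * (r * \<alpha> - rp * \<alpha>) + rp * \<alpha> * vp - r * (\<alpha> * \<beta>) = \<alpha> * (\<nu> * (r - rp) - (r * \<beta> - rp * vp))"
      by (simp_all add: algebra_simps)
    then have r1: "\<mu> * (r * \<alpha> - rm * \<alpha>) + Im ?am - Im ?a = 0" "\<nu> * (r * \<alpha> - rp * \<alpha>) + Im ?ap - Im ?a = 0"
      using m1 m2 by (simp_all add: u0)
    have r2: "\<mu> * (r * \<beta> - rm * vm) + Im ?bm - Im ?b = 0" "\<nu> * (r * \<beta> - rp * vp) + Im ?bp - Im ?b = 0"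
      using f1 f2 by (simp_all add: u0 algebra_simps)
    show ?thesis
      unfolding F int init using J1 J2 unfolding r1 r2 by simp
  qed
  show ?thesis
    unfolding admissible_weak_solution_def weak_solution_def
    using bs mass momentum en by blast
qed

text \<open>Here \<open>V^2 - 2 * u\<close> is the real number
  \<open>\<epsilon>1 - \<epsilon>2\<close>, and its modulus is below
  \<open>\<epsilon>1 + \<epsilon>2\<close> because both are positive.\<close>

lemma subsol_of_fan:
  assumes "\<epsilon>1 > 0" "\<epsilon>2 > 0" "C = \<alpha>\<^sup>2 + \<beta>\<^sup>2 + \<epsilon>1 + \<epsilon>2"
  shows "subsol C (Complex \<alpha> \<beta>) (Complex (C / 2 - \<beta>\<^sup>2 - \<epsilon>1) (\<alpha> * \<beta>))"
proof -
  have "(Complex \<alpha> \<beta>)\<^sup>2 - 2 * Complex (C / 2 - \<beta>\<^sup>2 - \<epsilon>1) (\<alpha> * \<beta>) = of_real (\<epsilon>1 - \<epsilon>2)"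
    by (simp add: complex_eq_iff assms(3) power2_eq_square field_simps)
  then have "norm ((Complex \<alpha> \<beta>)\<^sup>2 - 2 * Complex (C / 2 - \<beta>\<^sup>2 - \<epsilon>1) (\<alpha> * \<beta>)) = \<bar>\<epsilon>1 - \<epsilon>2\<bar>"
    by (simp only: norm_of_real)
  then show ?thesis using assms(1,2) unfolding subsol_def assms(3) by (simp add: cmod_power2)
qed

lemma fan_velocity_distinct:
  assumes w: "wild C V0 u0 (wedge \<mu> \<nu>) v u" "wild C V0 u0 (wedge \<mu> \<nu>) v' u'"
    and ae: "AE z in half_space. fan_velocity \<mu> \<nu> \<alpha> vm \<beta> vp v z = fan_velocity \<mu> \<nu> \<alpha> vm \<beta> vp v' z"
  shows "AE z in lborel. v z = v' z"
  using AE_half_space_lborel[OF ae]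
proof eventually_elim
  case (elim z)
  show ?case
  proof (cases "z \<in> wedge \<mu> \<nu>")
    case True
    then have "snd z \<ge> 0" "\<not> fst z $ 2 < \<mu> * snd z" "\<not> fst z $ 2 \<ge> \<nu> * snd z" by (auto simp: wedge_def)
    then have eq: "(vector [\<alpha> + Re (v z), \<beta> + Im (v z)] :: real^2) = vector [\<alpha> + Re (v' z), \<beta> + Im (v' z)]"
      using elim by (simp add: fan_velocity_def sectorwise_def)
    from arg_cong[OF eq, of "\<lambda>x. x $ 1"] arg_cong[OF eq, of "\<lambda>x. x $ 2"]
    show ?thesis by (simp add: complex_eq_iff)
  next
    case False
    then show ?thesis using w unfolding wild_def by metis
  qed
qed

lemma infinite_solutions_of_fan:
  assumes pos: "rm > 0" "rp > 0" and fan: "fan \<gamma> rm vm rp vp"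
  shows "infinite ({(\<rho>, v). admissible_weak_solution (pressure \<gamma>) (internal_energy \<gamma>)
             (riemann_data rm rp) (riemann_data (vector [\<alpha>, vm]) (vector [\<alpha>, vp])) \<rho> v} // ae_equal)"
proof -
  let ?S = "{(\<rho>, v). admissible_weak_solution (pressure \<gamma>) (internal_energy \<gamma>)
             (riemann_data rm rp) (riemann_data (vector [\<alpha>, vm]) (vector [\<alpha>, vp])) \<rho> v}"
  obtain r \<beta> \<epsilon>1 \<epsilon>2 \<mu> \<nu> where r: "r > 0" and \<epsilon>: "\<epsilon>1 > 0" "\<epsilon>2 > 0" and \<mu>\<nu>: "\<mu> < \<nu>"
    and eqs: "\<mu> * (rm - r) = rm * vm - r * \<beta>"
     "\<mu> * (rm * vm - r * \<beta>) = rm * vm\<^sup>2 + pressure \<gamma> rm - (r * \<beta>\<^sup>2 + r * \<epsilon>1 + pressure \<gamma> r)"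
     "\<nu> * (r - rp) = r * \<beta> - rp * vp"
     "\<nu> * (r * \<beta> - rp * vp) = r * \<beta>\<^sup>2 + r * \<epsilon>1 + pressure \<gamma> r - (rp * vp\<^sup>2 + pressure \<gamma> rp)"
     "\<mu> * (rm * internal_energy \<gamma> rm + rm * vm\<^sup>2 / 2 - (r * internal_energy \<gamma> r + r * (\<beta>\<^sup>2 + \<epsilon>1 + \<epsilon>2) / 2))
       \<le> (rm * internal_energy \<gamma> rm + rm * vm\<^sup>2 / 2 + pressure \<gamma> rm) * vm
        - (r * internal_energy \<gamma> r + r * (\<beta>\<^sup>2 + \<epsilon>1 + \<epsilon>2) / 2 + pressure \<gamma> r) * \<beta>"
     "\<nu> * (r * internal_energy \<gamma> r + r * (\<beta>\<^sup>2 + \<epsilon>1 + \<epsilon>2) / 2 - (rp * internal_energy \<gamma> rp + rp * vp\<^sup>2 / 2))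
       \<le> (r * internal_energy \<gamma> r + r * (\<beta>\<^sup>2 + \<epsilon>1 + \<epsilon>2) / 2 + pressure \<gamma> r) * \<beta>
        - (rp * internal_energy \<gamma> rp + rp * vp\<^sup>2 / 2 + pressure \<gamma> rp) * vp"
    using fan unfolding fan_def by blast
  define C where "C = \<alpha>\<^sup>2 + \<beta>\<^sup>2 + \<epsilon>1 + \<epsilon>2"
  define u0 where "u0 = Complex (C / 2 - \<beta>\<^sup>2 - \<epsilon>1) (\<alpha> * \<beta>)"
  have "subsol C (Complex \<alpha> \<beta>) u0" unfolding u0_def by (rule subsol_of_fan[OF \<epsilon> C_def])
  then obtain v u :: "nat \<Rightarrow> spacetime \<Rightarrow> complex" where w: "\<And>m. wild C (Complex \<alpha> \<beta>) u0 (wedge \<mu> \<nu>) (v m) (u m)"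
    and ne: "\<And>m n. m \<noteq> n \<Longrightarrow> \<not> (AE z in lborel. v m z = v n z)"
    using wild_family[OF _ open_wedge unbounded_wedge[OF \<mu>\<nu>]] by blast
  define x where "x m = (fan_density \<mu> \<nu> rm r rp, fan_velocity \<mu> \<nu> \<alpha> vm \<beta> vp (v m))" for m
  have xS: "x m \<in> ?S" for m
    using fan_admissible[OF pos r \<mu>\<nu> C_def u0_def w eqs] by (simp add: x_def)
  \<comment> \<open>Since \<open>ae_equal\<close> is reflexive on these pairs, equal classes would
    make the velocities equal almost everywhere, hence also the wild fields.\<close>
  have "inj (\<lambda>m. ae_equal `` {x m})"
  proof (rule injI, rule ccontr)
    fix m n assume eq: "ae_equal `` {x m} = ae_equal `` {x n}" and mn: "m \<noteq> n"
    have "x n \<in> ae_equal `` {x n}" by (simp add: ae_equal_def x_def)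
    then have "(x m, x n) \<in> ae_equal" using eq by auto
    then have "AE z in half_space. fan_velocity \<mu> \<nu> \<alpha> vm \<beta> vp (v m) z = fan_velocity \<mu> \<nu> \<alpha> vm \<beta> vp (v n) z"
      by (simp add: ae_equal_def x_def)
    from fan_velocity_distinct[OF w w this] ne[OF mn] show False by blast
  qed
  then have "infinite (range (\<lambda>m. ae_equal `` {x m}))" by (rule range_inj_infinite)
  moreover have "range (\<lambda>m. ae_equal `` {x m}) \<subseteq> ?S // ae_equal"
    using quotientI[OF xS] by blast
  ultimately show ?thesis using infinite_super by blast
qed

theorem theorem1:
  fixes \<gamma> rho_m rho_p v_p2 :: real
  assumes "\<gamma> > 1" and "rho_m > 0" and "rho_p > 0" and "rho_m \<noteq> rho_p"
  shows "\<exists>V :: real.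
    V < sqrt ((rho_p - rho_m) * (pressure \<gamma> rho_p - pressure \<gamma> rho_m) / (rho_p * rho_m)) \<and>
    (\<forall>v_m2 v_m1 v_p1 :: real.
       V < v_m2 - v_p2 \<and>
       v_m2 - v_p2
         < sqrt ((rho_p - rho_m) * (pressure \<gamma> rho_p - pressure \<gamma> rho_m) / (rho_p * rho_m)) \<and>
       v_m1 = v_p1 \<longrightarrow>
       infinite
         ({(\<rho>, v). admissible_weak_solution (pressure \<gamma>) (internal_energy \<gamma>)
             (riemann_data rho_m rho_p)
             (riemann_data (vector [v_m1, v_m2]) (vector [v_p1, v_p2])) \<rho> v} // ae_equal))"
proof -
  obtain V where V: "V < sqrt ((rho_p - rho_m) * (pressure \<gamma> rho_p - pressure \<gamma> rho_m) / (rho_p * rho_m))"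
    "\<forall>v_m2. V < v_m2 - v_p2 \<and> v_m2 - v_p2 < sqrt ((rho_p - rho_m) * (pressure \<gamma> rho_p - pressure \<gamma> rho_m) / (rho_p * rho_m))
      \<longrightarrow> fan \<gamma> rho_m v_m2 rho_p v_p2"
    using fan_exists[OF assms] by blast
  show ?thesis
  proof (intro exI[of _ V] conjI V(1) allI impI, elim conjE)
    fix v_m2 v_m1 v_p1 :: real
    assume "V < v_m2 - v_p2" "v_m2 - v_p2 < sqrt ((rho_p - rho_m) * (pressure \<gamma> rho_p - pressure \<gamma> rho_m) / (rho_p * rho_m))"
      and eq: "v_m1 = v_p1"
    then have "fan \<gamma> rho_m v_m2 rho_p v_p2" using V(2) by blast
    from infinite_solutions_of_fan[OF assms(2,3) this, of v_p1]
    show "infinite ({(\<rho>, v). admissible_weak_solution (pressure \<gamma>) (internal_energy \<gamma>)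
             (riemann_data rho_m rho_p) (riemann_data (vector [v_m1, v_m2]) (vector [v_p1, v_p2])) \<rho> v} // ae_equal)"
      unfolding eq .
  qed
qed

end
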